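(* Let $X$ be a reflexive Banach space, $T>0$, and $m\ge 1$ an integer. Let $G(t)=A+B(t)$, $t\in[0,T]$, be operators in $X$ such that: (1) for every $t\in[0,T]$, $G(t)$ is the generator of a quasicontraction semigroup on $X$, with a common contraction constant $\omega$ for all $t\in[0,T]$; (2) $A$ is closed with non-empty resolvent set; (3) for every $t\in[0,T]$, $B(t)$ is $A$-bounded of order $m$, with maximal relative bound over $t\in[0,T]$ strictly smaller than $1$; (4) the Lipschitz condition $$L_m := \sup_{t,t'\in[0,T],\,t'\neq t}\ \sum_{k=1}^m \frac{\|B(t')-B(t)\|_{(k,k-1)}}{|t'-t|} < \infty$$ holds. Then the evolution equation $\partial_t u(t)=G(t)u(t)$, $t\in[0,T]$, has a well-defined evolution system $U(t,s)$, $0\le s\le t\le T$, given by the limit $U(t,s)x=\lim_{k\to\infty}U_k(t,s)x$ ($x\in X$) of the stepwise static approximations $U_k(t,s)$, and for all $0\le s\le t\le T$ and all $0\le k\le m$ the operator $U(t,s)$ is bounded as a map $D(A^k)\to D(A^k)$, where $D(A^k)$ carries its graph norm.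
   Context: Operators are linear and generally unbounded; $D(\cdot)$ denotes the domain. For a closed operator $A$ in $X$, $D(A^k)$ is the set of $x\in X$ for which $A^jx\in X$ is defined for all $1\le j\le k$, with $D(A^0)=X$, equipped with the graph norm $$\|x\|_{(k)}=\|x\|+\|Ax\|+\dots+\|A^kx\|.$$ The operator norm is $\|S\|_{(k,l)}=\sup_{0\ne x\in D(A^k)}\|Sx\|_{(l)}/\|x\|_{(k)}$. The resolvent set of a closed operator $A$ is the set of $\lambda\in\mathbb{C}$ such that $A-\lambda I$ has full range $X$ and a bounded inverse. Relative boundedness of order $m$: for densely defined operators $A,B$ with $A$ closed, $B$ is called $A$-bounded of order $m$ if (i) $D(A)\subseteq D(B)$ and (ii) there are $a,b\ge 0$ such that for all $1\le k\le m$ and all $x\in D(A^k)$ one has $\|Bx\|_{(k-1)}\le a\|A^kx\|+b\|x\|_{(k-1)}$ (in particular $Bx\in D(A^{k-1})$). The infimum of possible values of $a$ is the relative bound (of order $m$) of $B$ with respect to $A$. The domain of $G(t)=A+B(t)$ is $D(G)=D(A)$. A quasicontraction semigroup with contraction constant $\omega$ is a strongly continuous semigroup $V(t)$ on $X$ with $\|V(t)x\|\le e^{\omega t}\|x\|$ for all $x\in X$, $t\ge 0$. Evolution system: a two-parameter family of bounded linear operators $U(t,s)$, $0\le s\le t\le T$, on $X$ such that (i) $U(s,s)=I$ and $U(t,r)U(r,s)=U(t,s)$ for all $0\le s\le r\le t\le T$; (ii) $(t,s)\mapsto U(t,s)$ is jointly strongly continuous; and on $D(G)$ it solves $\partial_tU(t,s)=G(t)U(t,s)$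 and $\partial_sU(t,s)=-U(t,s)G(s)$. Stepwise static approximation: for $k\in\mathbb{N}$ let $t_i=iT/k$, $0\le i\le k$, and let $U_k^{(i)}$ be the semigroup generated by the static generator $G(t_i)$, $0\le i\le k-1$. Set $U_k(t,s)=U_k^{(i)}(t-s)$ if $t_i\le s\le t\le t_{i+1}$, and otherwise $U_k(t,s)=U_k(t,t_i)U_k(t_i,s)$ with $s<t_i<t$. *)

theory Defs
  imports "HOL-Analysis.Analysis"
begin

section \<open>Complex Banach spaces\<close>

class complex_normed_vector = real_normed_vector +
  fixes scaleC :: "complex \<Rightarrow> 'a \<Rightarrow> 'a"  (infixr "*\<^sub>C" 75)
  assumes scaleC_add_right: "c *\<^sub>C (x + y) = c *\<^sub>C x + c *\<^sub>C y"
    and scaleC_add_left: "(c + d) *\<^sub>C x = c *\<^sub>C x + d *\<^sub>C x"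
    and scaleC_scaleC: "c *\<^sub>C d *\<^sub>C x = (c * d) *\<^sub>C x"
    and scaleR_scaleC: "r *\<^sub>R x = complex_of_real r *\<^sub>C x"
    and norm_scaleC: "norm (c *\<^sub>C x) = cmod c * norm x"

class complex_banach = complex_normed_vector + banach

instantiation complex :: complex_normed_vector
begin

definition scaleC_complex :: "complex \<Rightarrow> complex \<Rightarrow> complex" where
  "scaleC_complex c x = c * x"

instance
  by standard (auto simp: scaleC_complex_def algebra_simps scaleR_conv_of_real norm_mult)

end

instance complex :: complex_banach ..

definition bounded_clinear :: "('a::complex_normed_vector \<Rightarrow> 'b::complex_normed_vector) \<Rightarrow> bool" where
  "bounded_clinear f \<longleftrightarrow> bounded_linear f \<and> (\<forall>c x. f (c *\<^sub>C x) = c *\<^sub>C f x)"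

text \<open>
  Surjectivity of the canonical map into the bidual. The dual is the set of functionals
  \<open>f\<close> with \<open>bounded_clinear f\<close>, normed by \<open>onorm\<close>; an element of the bidual is a function
  \<open>\<phi>\<close> whose values matter on this set only.
\<close>

definition in_bidual :: "(('a::complex_normed_vector \<Rightarrow> complex) \<Rightarrow> complex) \<Rightarrow> bool" where
  "in_bidual \<phi> \<longleftrightarrow>
     (\<forall>f g. bounded_clinear f \<and> bounded_clinear g \<longrightarrow> \<phi> (\<lambda>x. f x + g x) = \<phi> f + \<phi> g) \<and>
     (\<forall>c f. bounded_clinear f \<longrightarrow> \<phi> (\<lambda>x. c * f x) = c * \<phi> f) \<and>
     (\<exists>C. \<forall>f. bounded_clinear f \<longrightarrow> cmod (\<phi> f) \<le> C * onorm f)"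

definition reflexive_space :: "'a::complex_normed_vector itself \<Rightarrow> bool" where
  "reflexive_space _ \<longleftrightarrow>
     (\<forall>\<phi> :: ('a \<Rightarrow> complex) \<Rightarrow> complex. in_bidual \<phi> \<longrightarrow>
        (\<exists>x. \<forall>f. bounded_clinear f \<longrightarrow> \<phi> f = f x))"


section \<open>Unbounded operators\<close>

text \<open>
  An operator consists of its domain and a function, whose values outside the domain are
  irrelevant to all the notions below.
\<close>

datatype 'a operator = Operator (opdom: "'a set") (app: "'a \<Rightarrow> 'a")

definition linear_op :: "'a::complex_normed_vector operator \<Rightarrow> bool" where
  "linear_op A \<longleftrightarrow>
     0 \<in> opdom A \<and>
     (\<forall>x\<in>opdom A. \<forall>y\<in>opdom A. x + y \<in> opdom A \<and> app A (x + y) = app A x + app A y) \<and>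
     (\<forall>c. \<forall>x\<in>opdom A. c *\<^sub>C x \<in> opdom A \<and> app A (c *\<^sub>C x) = c *\<^sub>C app A x)"

definition densely_defined :: "'a::complex_normed_vector operator \<Rightarrow> bool" where
  "densely_defined A \<longleftrightarrow> closure (opdom A) = UNIV"

definition closed_op :: "'a::complex_normed_vector operator \<Rightarrow> bool" where
  "closed_op A \<longleftrightarrow> closed {(x, app A x) | x. x \<in> opdom A}"

definition resolvent_set :: "'a::complex_normed_vector operator \<Rightarrow> complex set" where
  "resolvent_set A =
     {\<mu>. bij_betw (\<lambda>x. app A x - \<mu> *\<^sub>C x) (opdom A) UNIV \<and>
         bounded_clinear (inv_into (opdom A) (\<lambda>x. app A x - \<mu> *\<^sub>C x))}"

text \<open>
  The sum keeps the domain of the first summand; it is only used for a second summand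
  whose domain is at least as large.
\<close>

definition perturb :: "'a::complex_normed_vector operator \<Rightarrow> 'a operator \<Rightarrow> 'a operator" where
  "perturb A B = Operator (opdom A) (\<lambda>x. app A x + app B x)"

definition dom_pow :: "'a::complex_normed_vector operator \<Rightarrow> nat \<Rightarrow> 'a set" where
  "dom_pow A k = {x. \<forall>j<k. (app A ^^ j) x \<in> opdom A}"

definition graph_norm :: "'a::complex_normed_vector operator \<Rightarrow> nat \<Rightarrow> 'a \<Rightarrow> real" where
  "graph_norm A k x = (\<Sum>j\<le>k. norm ((app A ^^ j) x))"

text \<open>
  The norm of \<open>S : D(A\<^sup>k) \<rightarrow> D(A\<^sup>l)\<close>. It is meaningful only if \<open>S\<close> maps \<open>D(A\<^sup>k)\<close> into
  \<open>D(A\<^sup>l)\<close>, which has to be required separately.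
\<close>

definition op_norm :: "'a::complex_normed_vector operator \<Rightarrow> nat \<Rightarrow> nat \<Rightarrow> ('a \<Rightarrow> 'a) \<Rightarrow> ennreal" where
  "op_norm A k l S = (SUP x\<in>dom_pow A k - {0}. ennreal (graph_norm A l (S x) / graph_norm A k x))"


section \<open>Relative boundedness of higher order\<close>

definition rel_bound_consts ::
  "nat \<Rightarrow> 'a::complex_normed_vector operator \<Rightarrow> 'a operator \<Rightarrow> real \<Rightarrow> real \<Rightarrow> bool" where
  "rel_bound_consts m A B a b \<longleftrightarrow> 0 \<le> a \<and> 0 \<le> b \<and>
     (\<forall>k\<in>{1..m}. \<forall>x\<in>dom_pow A k.
        app B x \<in> dom_pow A (k - 1) \<and>
        graph_norm A (k - 1) (app B x) \<le> a * norm ((app A ^^ k) x) + b * graph_norm A (k - 1) x)"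

definition rel_bounded ::
  "nat \<Rightarrow> 'a::complex_normed_vector operator \<Rightarrow> 'a operator \<Rightarrow> bool" where
  "rel_bounded m A B \<longleftrightarrow>
     densely_defined A \<and> densely_defined B \<and> closed_op A \<and>
     opdom A \<subseteq> opdom B \<and> (\<exists>a b. rel_bound_consts m A B a b)"

definition rel_bound ::
  "nat \<Rightarrow> 'a::complex_normed_vector operator \<Rightarrow> 'a operator \<Rightarrow> ennreal" where
  "rel_bound m A B = Inf {ennreal a | a. \<exists>b. rel_bound_consts m A B a b}"

definition lipschitz_sup ::
  "nat \<Rightarrow> 'a::complex_normed_vector operator \<Rightarrow> (real \<Rightarrow> 'a operator) \<Rightarrow> real \<Rightarrow> ennreal" where
  "lipschitz_sup m A B T =
     (SUP (t, t')\<in>{(t, t'). t \<in> {0..T} \<and> t' \<in> {0..T} \<and> t' \<noteq> t}.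
        \<Sum>k=1..m. op_norm A k (k - 1) (\<lambda>x. app (B t') x - app (B t) x) / ennreal \<bar>t' - t\<bar>)"


section \<open>Semigroups and evolution systems\<close>

text \<open>Only the values of \<open>V\<close> at times \<open>t \<ge> 0\<close> are relevant.\<close>

definition c0_semigroup :: "(real \<Rightarrow> 'a::complex_normed_vector \<Rightarrow> 'a) \<Rightarrow> bool" where
  "c0_semigroup V \<longleftrightarrow>
     (\<forall>t\<ge>0. bounded_clinear (V t)) \<and>
     V 0 = id \<and>
     (\<forall>s\<ge>0. \<forall>t\<ge>0. V (s + t) = V s \<circ> V t) \<and>
     (\<forall>x. continuous_on {0..} (\<lambda>t. V t x))"

definition quasicontraction_semigroup ::
  "real \<Rightarrow> (real \<Rightarrow> 'a::complex_normed_vector \<Rightarrow> 'a) \<Rightarrow> bool" where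
  "quasicontraction_semigroup \<omega> V \<longleftrightarrow>
     c0_semigroup V \<and> (\<forall>t\<ge>0. \<forall>x. norm (V t x) \<le> exp (\<omega> * t) * norm x)"

definition is_generator ::
  "'a::complex_normed_vector operator \<Rightarrow> (real \<Rightarrow> 'a \<Rightarrow> 'a) \<Rightarrow> bool" where
  "is_generator G V \<longleftrightarrow>
     (\<forall>x y. x \<in> opdom G \<and> app G x = y \<longleftrightarrow>
        ((\<lambda>h. (V h x - x) /\<^sub>R h) \<longlongrightarrow> y) (at_right 0))"

text \<open>The choice does not matter: a generator determines its semigroup at all times \<open>t \<ge> 0\<close>.\<close>

definition semigroup_of :: "'a::complex_normed_vector operator \<Rightarrow> real \<Rightarrow> 'a \<Rightarrow> 'a" where
  "semigroup_of G = (SOME V. c0_semigroup V \<and> is_generator G V)"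

text \<open>
  The derivatives are strong derivatives in the norm of the space, one-sided at the ends of
  the respective time interval.
\<close>

definition evolution_system ::
  "real \<Rightarrow> (real \<Rightarrow> 'a::complex_normed_vector operator) \<Rightarrow> (real \<Rightarrow> real \<Rightarrow> 'a \<Rightarrow> 'a) \<Rightarrow> bool" where
  "evolution_system T G U \<longleftrightarrow>
     (\<forall>s t. 0 \<le> s \<and> s \<le> t \<and> t \<le> T \<longrightarrow> bounded_clinear (U t s)) \<and>
     (\<forall>s\<in>{0..T}. U s s = id) \<and>
     (\<forall>s r t. 0 \<le> s \<and> s \<le> r \<and> r \<le> t \<and> t \<le> T \<longrightarrow> U t r \<circ> U r s = U t s) \<and>
     (\<forall>x. continuous_on {(t, s). 0 \<le> s \<and> s \<le> t \<and> t \<le> T} (\<lambda>(t, s). U t s x)) \<and>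
     (\<forall>s t. 0 \<le> s \<and> s \<le> t \<and> t \<le> T \<longrightarrow> (\<forall>x\<in>opdom (G s).
        U t s x \<in> opdom (G t) \<and>
        ((\<lambda>\<tau>. U \<tau> s x) has_vector_derivative app (G t) (U t s x)) (at t within {s..T}) \<and>
        ((\<lambda>\<sigma>. U t \<sigma> x) has_vector_derivative - U t s (app (G s) x)) (at s within {0..t})))"


section \<open>Stepwise static approximation\<close>

definition grid :: "real \<Rightarrow> nat \<Rightarrow> nat \<Rightarrow> real" where
  "grid T k i = real i * T / real k"

text \<open>
  \<open>stepwise_upto \<tau> V n\<close> uses the grid points \<open>\<tau> 0, \<dots>, \<tau> n\<close> and the semigroups
  \<open>V 0, \<dots>, V n\<close>, splitting off the last step first. The lemmas below confirm that
  splitting at any other intermediate grid point gives the same operators.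
\<close>

primrec stepwise_upto ::
  "(nat \<Rightarrow> real) \<Rightarrow> (nat \<Rightarrow> real \<Rightarrow> 'a \<Rightarrow> 'a) \<Rightarrow> nat \<Rightarrow> real \<Rightarrow> real \<Rightarrow> 'a \<Rightarrow> 'a" where
  "stepwise_upto \<tau> V 0 t s = V 0 (t - s)"
| "stepwise_upto \<tau> V (Suc n) t s =
     (if t \<le> \<tau> (Suc n) then stepwise_upto \<tau> V n t s
      else if \<tau> (Suc n) \<le> s then V (Suc n) (t - s)
      else V (Suc n) (t - \<tau> (Suc n)) \<circ> stepwise_upto \<tau> V n (\<tau> (Suc n)) s)"

definition stepwise_approx ::
  "real \<Rightarrow> (real \<Rightarrow> 'a::complex_normed_vector operator) \<Rightarrow> nat \<Rightarrow> real \<Rightarrow> real \<Rightarrow> 'a \<Rightarrow> 'a" where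
  "stepwise_approx T G k =
     stepwise_upto (grid T k) (\<lambda>i. semigroup_of (G (grid T k i))) (k - 1)"

lemma stepwise_upto_refl:
  assumes "\<And>i. i \<le> n \<Longrightarrow> V i 0 = id"
  shows "stepwise_upto \<tau> V n s s = id"
  using assms by (induction n) auto

lemma stepwise_upto_single:
  assumes "\<And>i. i \<le> n \<Longrightarrow> V i 0 = id" and "mono \<tau>"
    and "i \<le> n" "\<tau> i \<le> s" "s \<le> t" "t \<le> \<tau> (Suc i)"
  shows "stepwise_upto \<tau> V n t s = V i (t - s)"
  using assms
proof (induction n)
  case 0
  then show ?case by simp
next
  case (Suc n)
  show ?case
  proof (cases "i = Suc n")
    case True
    show ?thesis
    proof (cases "t \<le> \<tau> (Suc n)")
      case True
      with \<open>i = Suc n\<close> Suc.prems have "s = t" by simp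
      then show ?thesis
        using stepwise_upto_refl[of "Suc n" V \<tau> s, OF Suc.prems(1)] Suc.prems(1)[of "Suc n"] \<open>i = Suc n\<close>
        by (metis diff_self order_refl)
    next
      case False
      then show ?thesis using \<open>i = Suc n\<close> Suc.prems by simp
    qed
  next
    case False
    then have "i \<le> n" using Suc.prems by simp
    then have "\<tau> (Suc i) \<le> \<tau> (Suc n)"
      using \<open>mono \<tau>\<close> by (simp add: monoD)
    then show ?thesis using Suc \<open>i \<le> n\<close> by simp
  qed
qed

lemma stepwise_upto_split:
  assumes "mono \<tau>" "1 \<le> i" "i \<le> n" "s < \<tau> i" "\<tau> i < t"
  shows "stepwise_upto \<tau> V n t s = stepwise_upto \<tau> V n t (\<tau> i) \<circ> stepwise_upto \<tau> V n (\<tau> i) s"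
  using assms
proof (induction n arbitrary: t)
  case 0
  then show ?case by simp
next
  case (Suc n)
  have le: "\<tau> i \<le> \<tau> (Suc n)" using Suc.prems by (simp add: monoD)
  show ?case
  proof (cases "\<tau> i = \<tau> (Suc n)")
    case True
    then show ?thesis using Suc.prems by simp
  next
    case False
    then have lt: "\<tau> i < \<tau> (Suc n)" and "i \<le> n"
      using le Suc.prems(3) by (auto simp: le_Suc_eq)
    have IH: "stepwise_upto \<tau> V n t' s =
        stepwise_upto \<tau> V n t' (\<tau> i) \<circ> stepwise_upto \<tau> V n (\<tau> i) s" if "\<tau> i < t'" for t'
      by (rule Suc.IH) (use Suc.prems that \<open>i \<le> n\<close> in \<open>auto simp del: stepwise_upto.simps\<close>)
    show ?thesis
      using Suc.prems lt IH[of t] IH[of "\<tau> (Suc n)"] by (auto simp: comp_assoc)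
  qed
qed

lemma c0_semigroup_semigroup_of:
  assumes "c0_semigroup V" "is_generator G V"
  shows "c0_semigroup (semigroup_of G)" "is_generator G (semigroup_of G)"
  using someI[of "\<lambda>V. c0_semigroup V \<and> is_generator G V" V] assms
  by (auto simp: semigroup_of_def)

lemma mono_grid: "0 \<le> T \<Longrightarrow> mono (grid T k)"
  by (auto simp: mono_def grid_def intro!: divide_right_mono mult_right_mono)

lemma stepwise_approx_single:
  assumes "0 \<le> T" "\<And>t. t \<in> {0..T} \<Longrightarrow> \<exists>V. c0_semigroup V \<and> is_generator (G t) V"
    and "i < k" "grid T k i \<le> s" "s \<le> t" "t \<le> grid T k (Suc i)"
  shows "stepwise_approx T G k t s = semigroup_of (G (grid T k i)) (t - s)"
proof -
  have "semigroup_of (G (grid T k j)) 0 = id" if "j \<le> k - 1" for j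
  proof -
    have "real j / real k \<le> 1" using that \<open>i < k\<close> by simp
    from mult_right_mono[OF this \<open>0 \<le> T\<close>] have "grid T k j \<in> {0..T}"
      using \<open>0 \<le> T\<close> by (simp add: grid_def)
    from assms(2)[OF this] show ?thesis
      using c0_semigroup_semigroup_of(1) c0_semigroup_def by metis
  qed
  then show ?thesis
    unfolding stepwise_approx_def
    using assms by (intro stepwise_upto_single) (auto simp: mono_grid)
qed

lemma stepwise_approx_split:
  assumes "0 \<le> T" "i < k" "0 \<le> s" "s < grid T k i" "grid T k i < t"
  shows "stepwise_approx T G k t s =
    stepwise_approx T G k t (grid T k i) \<circ> stepwise_approx T G k (grid T k i) s"
proof -
  have "1 \<le> i" using assms by (cases i) (auto simp: grid_def)
  then show ?thesis
    unfolding stepwise_approx_def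
    using assms by (intro stepwise_upto_split) (auto simp: mono_grid)
qed

end

theory Submission
  imports Defs
begin

text \<open>
  For large real \<open>\<mu>\<close> the operators \<open>\<mu> - A - s B\<close>, \<open>0 \<le> s \<le> 1\<close>, are
  bounded below on \<open>X\<close> because \<open>A + B\<close> is quasi-dissipative and \<open>B\<close> has relative bound below \<open>1\<close>; the
  continuity method along \<open>s\<close>, first from \<open>s = 1\<close> to \<open>s = 0\<close> on \<open>D(A)\<close> and then back on \<open>D(A\<^sup>k)\<close>, shows
  that \<open>S(t) = \<mu> - A - B(t)\<close> maps \<open>D(A\<^sup>k)\<close> onto \<open>D(A\<^sup>k\<^sup>-\<^sup>1)\<close>. So the static semigroups leave
  \<open>D(A\<^sup>k)\<close> invariant and are quasicontractive for the norms \<open>\<parallel>S(t)\<^sup>k x\<parallel>\<close>, which depend on \<open>t\<close> in a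
  Lipschitz way. This makes the approximations stable on \<open>D(A\<^sup>k)\<close> and, by Duhamel's principle, Cauchy.
  The commutator of \<open>S\<close> with the approximations from \<open>s\<close> to \<open>t\<close> is \<open>O(t - s)\<close> on \<open>D(A)\<close>. Reflexivity
  carries this bound over to the limit \<open>U\<close>, where it makes \<open>S(t) U(t,s) x\<close> norm continuous in \<open>t\<close>; no
  differentiability of \<open>B\<close> is needed. The right derivative of \<open>U(t,s) x\<close> is thus continuous, hence a
  two-sided derivative.
\<close>

section \<open>Norming functionals\<close>

text \<open>Estimates on D(A^k) have to survive a product of up to \<open>n\<close> semigroups, so a
  norm in which every factor loses a fixed constant is useless. Since \<open>V t\<close> commutes
  with \<open>S t\<close>, the norm of S(t)^k x loses only \<open>exp (\<Omega> * h)\<close> inside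
  a cell. Changing the norm at a grid point costs a factor \<open>1 + c * (T / n)\<close>, and these
  multiply to at most \<open>exp (c * T)\<close>. The detour through \<open>A\<close> also has a
  reason. In \<mu> x - A x - B x = g, solving for A x brings in B x, which is only known to be as
  regular as A x, so nothing is gained; A x = \<mu> x - g raises the regularity of x order by order.
  A relative bound below 1 need not make B composed with a resolvent a contraction, so a path with a
  uniform a priori bound replaces a single Neumann series. The second constant of the relative bound
  may depend on t; the Lipschitz condition and a finite grid make it uniform, at the price of a
  larger first constant, still below 1. In Duhamel's principle, bounds on one-sided increments take
  the place of an integral formula.\<close>

definition sublinear :: "('a::real_vector \<Rightarrow> real) \<Rightarrow> bool" where
  "sublinear q \<longleftrightarrow> (\<forall>x y. q (x + y) \<le> q x + q y) \<and> (\<forall>x. \<forall>c>0. q (c *\<^sub>R x) = c * q x)"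

lemma sublinear_zero: "sublinear q \<Longrightarrow> q 0 = 0"
  unfolding sublinear_def by (metis mult_2 scaleR_zero_right zero_less_numeral add_cancel_right_left)

lemma sublinear_lower: "sublinear q \<Longrightarrow> - q (- x) \<le> q x"
  using sublinear_zero[of q] unfolding sublinear_def by (metis add.right_inverse neg_le_iff_le diff_0 diff_le_eq)

text \<open>For sublinear \<open>q\<close> the value at \<open>- x\<close> is at most
  \<open>- q x\<close> (take t = 1), so a linear functional below \<open>sub_shift q x\<close> is at
  least \<open>q x\<close> at \<open>x\<close>. This serves twice: a minimal functional is unchanged
  by the shift, which makes it additive, and the shifted norm yields norming functionals.\<close>

definition sub_shift :: "('a::real_vector \<Rightarrow> real) \<Rightarrow> 'a \<Rightarrow> 'a \<Rightarrow> real" where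
  "sub_shift q x y = (INF t\<in>{0..}. q (y + t *\<^sub>R x) - t * q x)"

text \<open>Keeps the set in \<open>sub_shift\<close> bounded below; a real infimum over an
  unbounded set would carry no information.\<close>

lemma sub_shift_lower:
  assumes "sublinear q" "0 \<le> t"
  shows "- q (- y) \<le> q (y + t *\<^sub>R x) - t * q x"
proof (cases "t = 0")
  case True
  then show ?thesis using sublinear_lower[OF assms(1), of y] by simp
next
  case False
  then have "t * q x = q ((y + t *\<^sub>R x) + (- y))" using assms by (simp add: sublinear_def)
  also have "\<dots> \<le> q (y + t *\<^sub>R x) + q (- y)" using assms(1) unfolding sublinear_def by blast
  finally show ?thesis by simp
qed

lemma sub_shift_bdd: "sublinear q \<Longrightarrow> bdd_below ((\<lambda>t. q (y + t *\<^sub>R x) - t * q x) ` {0..})"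
  by (rule bdd_belowI2[of _ "- q (- y)"]) (use sub_shift_lower in auto)

lemma sub_shift_le:
  assumes "sublinear q" "0 \<le> t"
  shows "sub_shift q x y \<le> q (y + t *\<^sub>R x) - t * q x"
  unfolding sub_shift_def by (rule cINF_lower[OF sub_shift_bdd[OF assms(1)]]) (use assms in auto)

text \<open>Parameters \<open>s\<close> for \<open>y\<close> and \<open>t\<close> for
  \<open>z\<close> combine to \<open>s + t\<close> for \<open>y + z\<close>, and the two infima are
  taken one after the other. For scaling, \<open>t\<close> is replaced by \<open>c * t\<close>; the
  reverse inequality is the same one for \<open>1 / c\<close>.\<close>

lemma sublinear_sub_shift:
  assumes q: "sublinear q"
  shows "sublinear (sub_shift q x)"
  unfolding sublinear_def
proof (intro conjI allI impI)
  fix y z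
  have *: "sub_shift q x (y + z) \<le> (q (y + s *\<^sub>R x) - s * q x) + (q (z + t *\<^sub>R x) - t * q x)"
    if "s \<ge> 0" "t \<ge> 0" for s t
  proof -
    have "sub_shift q x (y + z) \<le> q ((y + z) + (s + t) *\<^sub>R x) - (s + t) * q x"
      using that by (intro sub_shift_le[OF q]) auto
    also have "(y + z) + (s + t) *\<^sub>R x = (y + s *\<^sub>R x) + (z + t *\<^sub>R x)" by (simp add: algebra_simps)
    also have "q \<dots> \<le> q (y + s *\<^sub>R x) + q (z + t *\<^sub>R x)" using q unfolding sublinear_def by blast
    finally show ?thesis by (simp add: algebra_simps)
  qed
  have **: "sub_shift q x (y + z) - (q (y + s *\<^sub>R x) - s * q x) \<le> sub_shift q x z" if "s \<ge> 0" for s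
    unfolding sub_shift_def[of q x z]
  proof (rule cINF_greatest)
    show "sub_shift q x (y + z) - (q (y + s *\<^sub>R x) - s * q x) \<le> q (z + t *\<^sub>R x) - t * q x"
      if "t \<in> {0..}" for t using *[of s t] \<open>s \<ge> 0\<close> that by simp
  qed simp
  have "sub_shift q x (y + z) - sub_shift q x z \<le> sub_shift q x y"
    unfolding sub_shift_def[of q x y]
  proof (rule cINF_greatest)
    show "sub_shift q x (y + z) - sub_shift q x z \<le> q (y + s *\<^sub>R x) - s * q x"
      if "s \<in> {0..}" for s using **[of s] that by simp
  qed simp
  then show "sub_shift q x (y + z) \<le> sub_shift q x y + sub_shift q x z" by simp
next
  have *: "sub_shift q x (c *\<^sub>R y) \<le> c * sub_shift q x y" if "c > 0" for c y
  proof -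
    have "sub_shift q x (c *\<^sub>R y) / c \<le> q (y + t *\<^sub>R x) - t * q x" if "t \<ge> 0" for t
    proof -
      have "sub_shift q x (c *\<^sub>R y) \<le> q (c *\<^sub>R y + (c * t) *\<^sub>R x) - (c * t) * q x"
        using that \<open>c > 0\<close> by (intro sub_shift_le[OF q]) auto
      also have "c *\<^sub>R y + (c * t) *\<^sub>R x = c *\<^sub>R (y + t *\<^sub>R x)" by (simp add: algebra_simps)
      also have "q \<dots> = c * q (y + t *\<^sub>R x)" using q \<open>c > 0\<close> unfolding sublinear_def by blast
      finally show ?thesis using \<open>c > 0\<close> by (simp add: field_simps)
    qed
    then have "sub_shift q x (c *\<^sub>R y) / c \<le> sub_shift q x y"
      unfolding sub_shift_def[of q x y] by (intro cINF_greatest) auto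
    then show ?thesis using \<open>c > 0\<close> by (simp add: field_simps)
  qed
  fix y and c :: real assume "c > 0"
  show "sub_shift q x (c *\<^sub>R y) = c * sub_shift q x y"
  proof (rule antisym[OF *[OF \<open>c > 0\<close>]])
    show "c * sub_shift q x y \<le> sub_shift q x (c *\<^sub>R y)"
      using *[of "1/c" "c *\<^sub>R y"] \<open>c > 0\<close> by (simp add: field_simps)
  qed
qed

text \<open>A pointwise infimum of sublinear functionals is in general not subadditive. In a chain,
  however, any \<open>q\<close> and \<open>r\<close> have a common lower member \<open>w\<close>,
  and subadditivity of \<open>w\<close> bounds the infimum at \<open>y + z\<close> by
  \<open>q y + r z\<close>.\<close>

lemma sublinear_INF_chain:
  assumes C: "C \<noteq> {}" "\<And>q. q \<in> C \<Longrightarrow> sublinear q \<and> (\<forall>x. q x \<le> p x)"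
    and chain: "\<And>q r. q \<in> C \<Longrightarrow> r \<in> C \<Longrightarrow> (\<forall>x. q x \<le> r x) \<or> (\<forall>x. r x \<le> q x)"
  shows "sublinear (\<lambda>x. INF q\<in>C. q x)" and "q \<in> C \<Longrightarrow> (INF q\<in>C. q x) \<le> q x"
proof -
  let ?u = "\<lambda>x. INF q\<in>C. q x"
  have bdd: "bdd_below ((\<lambda>q. q x) ` C)" for x
  proof (rule bdd_belowI2[of _ "- p (- x)"])
    fix q assume "q \<in> C"
    then show "- p (- x) \<le> q x" using C(2)[of q] sublinear_lower[of q x] by (smt (verit))
  qed
  have le: "?u x \<le> q x" if "q \<in> C" for q x
    by (rule cINF_lower[OF bdd that])
  then show "q \<in> C \<Longrightarrow> (INF q\<in>C. q x) \<le> q x" .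
  show "sublinear ?u" unfolding sublinear_def
  proof (intro conjI allI impI)
    fix y z
    have *: "?u (y + z) \<le> q y + r z" if qr: "q \<in> C" "r \<in> C" for q r
    proof -
      have "(\<forall>x. q x \<le> r x) \<or> (\<forall>x. r x \<le> q x)" using chain qr by blast
      then obtain w where w: "w \<in> C" "\<forall>x. w x \<le> q x" "\<forall>x. w x \<le> r x"
        using qr by blast
      have "?u (y + z) \<le> w (y + z)" using le w(1) .
      also have "\<dots> \<le> w y + w z" using C(2)[OF w(1)] by (simp add: sublinear_def)
      also have "\<dots> \<le> q y + r z" using w by (simp add: add_mono)
      finally show ?thesis .
    qed
    have **: "?u (y + z) - q y \<le> ?u z" if "q \<in> C" for q
    proof (rule cINF_greatest[OF C(1)])
      show "?u (y + z) - q y \<le> r z" if "r \<in> C" for r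
        using *[OF \<open>q \<in> C\<close> that] by simp
    qed
    have "?u (y + z) - ?u z \<le> ?u y"
    proof (rule cINF_greatest[OF C(1)])
      show "?u (y + z) - ?u z \<le> q y" if "q \<in> C" for q
        using **[OF that] by simp
    qed
    then show "?u (y + z) \<le> ?u y + ?u z" by simp
  next
    have *: "?u (c *\<^sub>R y) \<le> c * ?u y" if "c > 0" for c y
    proof -
      have "?u (c *\<^sub>R y) / c \<le> q y" if "q \<in> C" for q
        using le[OF that, of "c *\<^sub>R y"] C(2)[OF that] \<open>c > 0\<close> by (simp add: sublinear_def field_simps)
      then have "?u (c *\<^sub>R y) / c \<le> ?u y" using C(1) by (intro cINF_greatest) auto
      then show ?thesis using \<open>c > 0\<close> by (simp add: field_simps)
    qed
    fix y and c :: real assume "c > 0"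
    show "?u (c *\<^sub>R y) = c * ?u y"
    proof (rule antisym[OF *[OF \<open>c > 0\<close>]])
      show "c * ?u y \<le> ?u (c *\<^sub>R y)"
        using *[of "1/c" "c *\<^sub>R y"] \<open>c > 0\<close> by (simp add: field_simps)
    qed
  qed
qed

text \<open>A minimal sublinear functional \<open>q\<close> is additive: minimality forces \<open>sub_shift q x = q\<close>.\<close>

lemma sublinear_dominates_linear:
  fixes p :: "'a::real_vector \<Rightarrow> real"
  assumes "sublinear p"
  obtains f where "linear f" "\<And>x. f x \<le> p x"
proof -
  define S where "S = {q. sublinear q \<and> (\<forall>x. q x \<le> p x)}"
  \<comment> \<open>The order is reversed, so that the maximal element given by Zorn's lemma is a
    minimal functional.\<close>
  define P where "P = (\<lambda>q r :: 'a \<Rightarrow> real. \<forall>x. r x \<le> q x)"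
  have "\<exists>f\<in>S. \<forall>q\<in>S. P f q \<longrightarrow> q = f"
  proof (rule predicate_Zorn)
    show "partial_order_on S (relation_of P S)"
      by (rule partial_order_on_relation_ofI) (use order_trans order_antisym in \<open>unfold P_def fun_eq_iff, blast+\<close>)
    fix C assume C: "C \<in> Chains (relation_of P S)"
    show "\<exists>u\<in>S. \<forall>a\<in>C. P a u"
    proof (cases "C = {}")
      case True
      then show ?thesis using assms by (auto simp: S_def)
    next
      case False
      have CS: "\<And>q. q \<in> C \<Longrightarrow> sublinear q \<and> (\<forall>x. q x \<le> p x)"
        using C by (auto simp: Chains_def relation_of_def S_def)
      have ch: "\<And>q r. q \<in> C \<Longrightarrow> r \<in> C \<Longrightarrow> (\<forall>x. q x \<le> r x) \<or> (\<forall>x. r x \<le> q x)"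
        using C by (auto simp: Chains_def relation_of_def P_def)
      have I: "sublinear (\<lambda>x. INF q\<in>C. q x)" "\<And>q x. q \<in> C \<Longrightarrow> (INF q\<in>C. q x) \<le> q x"
        using sublinear_INF_chain[of C p] False CS ch by blast+
      obtain q where q: "q \<in> C" using False by blast
      have "(INF q\<in>C. q x) \<le> p x" for x
        using order_trans[OF I(2)[OF q]] CS[OF q] by blast
      then have "(\<lambda>x. INF q\<in>C. q x) \<in> S" unfolding S_def using I(1) by simp
      then show ?thesis using I(2) by (auto simp: P_def intro!: bexI[of _ "\<lambda>x. INF q\<in>C. q x"])
    qed
  qed
  then obtain f where f: "f \<in> S" "\<And>q. q \<in> S \<Longrightarrow> P f q \<Longrightarrow> q = f" by blast
  have fs: "sublinear f" and fp: "\<And>x. f x \<le> p x" using f(1) by (auto simp: S_def)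
  have eq: "sub_shift f x = f" for x
  proof (rule f(2))
    have le: "sub_shift f x y \<le> f y" for y using sub_shift_le[OF fs, of 0 x y] by simp
    then show "P f (sub_shift f x)" by (simp add: P_def)
    show "sub_shift f x \<in> S" using sublinear_sub_shift[OF fs] le fp by (auto simp: S_def intro: order_trans)
  qed
  have add: "f (x + y) = f x + f y" for x y
  proof (rule antisym)
    show "f (x + y) \<le> f x + f y" using fs by (simp add: sublinear_def)
    show "f x + f y \<le> f (x + y)"
      using sub_shift_le[OF fs, of 1 x y] eq[of x] by (simp add: algebra_simps)
  qed
  have neg: "f (- x) = - f x" for x
    using add[of x "- x"] sublinear_zero[OF fs] by simp
  have "f (c *\<^sub>R x) = c * f x" for c x
  proof (cases c "0::real" rule: linorder_cases)
    case less
    have "f (c *\<^sub>R x) = - f ((- c) *\<^sub>R x)" using neg[of "(- c) *\<^sub>R x"] by simp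
    also have "\<dots> = - ((- c) * f x)"
      using fs less unfolding sublinear_def by (metis neg_0_less_iff_less)
    finally show ?thesis by simp
  qed (use fs sublinear_zero[OF fs] in \<open>auto simp: sublinear_def\<close>)
  then have "linear f" using add by (intro linearI) auto
  then show ?thesis using that fp by blast
qed

text \<open>Shifting the norm along \<open>x0\<close> replaces the extension of a functional from
  the line through \<open>x0\<close>.\<close>

lemma norming_functional_real:
  fixes x0 :: "'a::real_normed_vector"
  obtains f where "linear f" "\<And>x. f x \<le> norm x" "norm x0 \<le> (f x0 :: real)"
proof -
  have n: "sublinear (norm :: 'a \<Rightarrow> real)" by (simp add: sublinear_def norm_triangle_ineq)
  obtain f where f: "linear f" "\<And>x. f x \<le> sub_shift norm x0 x"
    using sublinear_dominates_linear[OF sublinear_sub_shift[OF n, of x0]] by blast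
  have "f x \<le> norm x" for x using f(2)[of x] sub_shift_le[OF n, of 0 x0 x] by simp
  moreover have "f (- x0) \<le> - norm x0" using f(2)[of "- x0"] sub_shift_le[OF n, of 1 x0 "- x0"] by simp
  then have "norm x0 \<le> f x0" using f(1) by (simp add: linear_neg)
  ultimately show ?thesis using that f(1) by blast
qed

lemma scaleC_of_real: "complex_of_real r *\<^sub>C x = r *\<^sub>R (x :: 'a::complex_normed_vector)"
  by (simp add: scaleR_scaleC)

lemma scaleC_diff_right: "c *\<^sub>C (x - y) = c *\<^sub>C x - c *\<^sub>C (y :: 'a::complex_normed_vector)"
  by (metis add_diff_cancel_right' diff_add_cancel scaleC_add_right)

lemma norming_functional:
  fixes x0 :: "'a::complex_normed_vector"
  obtains f :: "'a \<Rightarrow> complex"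
  where "bounded_clinear f" "\<And>x. cmod (f x) \<le> norm x" "norm x0 \<le> cmod (f x0)"
proof -
  obtain g :: "'a \<Rightarrow> real" where g: "linear g" "\<And>x. g x \<le> norm x" "norm x0 \<le> g x0"
    using norming_functional_real[of x0] by blast
  define f where "f = (\<lambda>x. Complex (g x) (- g (\<i> *\<^sub>C x)))"
  have ii: "\<i> *\<^sub>C \<i> *\<^sub>C x = - x" for x :: 'a
    using scaleC_scaleC[of \<i> \<i> x] scaleC_of_real[of "-1" x] by simp
  have gi: "g (\<i> *\<^sub>C \<i> *\<^sub>C x) = - g x" for x using ii[of x] g(1) by (simp add: linear_neg)
  have add: "f (x + y) = f x + f y" for x y
    by (simp add: f_def linear_add[OF g(1)] scaleC_add_right complex_eq_iff)
  have comm: "\<i> *\<^sub>C r *\<^sub>R x = r *\<^sub>R \<i> *\<^sub>C x" for r and x :: 'a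
    by (simp add: scaleR_scaleC scaleC_scaleC mult.commute)
  have real: "f (r *\<^sub>R x) = of_real r * f x" for r x
    by (simp add: f_def comm linear_scale[OF g(1)] complex_eq_iff)
  have i: "f (\<i> *\<^sub>C x) = \<i> * f x" for x
    by (simp add: f_def gi complex_eq_iff)
  have scale: "f (c *\<^sub>C x) = c * f x" for c x
  proof -
    have "c *\<^sub>C x = Re c *\<^sub>R x + Im c *\<^sub>R \<i> *\<^sub>C x"
      by (metis complex_eq mult.commute scaleC_add_left scaleC_of_real scaleC_scaleC)
    then have "f (c *\<^sub>C x) = of_real (Re c) * f x + of_real (Im c) * (\<i> * f x)"
      by (simp add: add real i)
    then show ?thesis by (simp add: complex_eq_iff)
  qed
  have le: "cmod (f x) \<le> norm x" for x
  proof (cases "f x = 0")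
    case False
    \<comment> \<open>A rotation that makes \<open>f (c x)\<close> real and equal to the modulus of
      \<open>f x\<close>; there \<open>f\<close> agrees with its real part \<open>g\<close>, which
      is bounded by the norm.\<close>
    define c where "c = cnj (f x) / cmod (f x)"
    have "f (c *\<^sub>C x) = of_real (cmod (f x))"
      using False complex_norm_square[of "f x"] unfolding scale c_def
      by (simp add: field_simps power2_eq_square)
    then have "cmod (f x) = g (c *\<^sub>C x)" by (simp add: f_def complex_eq_iff)
    also have "\<dots> \<le> norm (c *\<^sub>C x)" by (rule g)
    also have "\<dots> = norm x" using False by (simp add: norm_scaleC c_def norm_divide)
    finally show ?thesis .
  qed simp
  have "bounded_clinear f" unfolding bounded_clinear_def
  proof (intro conjI allI)
    show "bounded_linear f"
      by (rule bounded_linear_intro[of _ 1]) (use add real le in \<open>auto simp: scaleR_conv_of_real\<close>)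
    show "f (c *\<^sub>C x) = c *\<^sub>C f x" for c x by (simp add: scale scaleC_complex_def)
  qed
  moreover have "norm x0 \<le> cmod (f x0)" using g(3) abs_Re_le_cmod[of "f x0"] by (simp add: f_def)
  ultimately show ?thesis using that le by blast
qed

section \<open>Weak compactness in reflexive spaces\<close>

lemma bounded_clinear_bounded_linear: "bounded_clinear f \<Longrightarrow> bounded_linear f"
  by (simp add: bounded_clinear_def)

lemma bounded_clinear_compose:
  assumes "bounded_clinear f" "bounded_clinear g" shows "bounded_clinear (\<lambda>x. f (g x))"
  using assms bounded_linear_compose unfolding bounded_clinear_def by auto

text \<open>Tychonoff's theorem gives a cluster point in a product of discs. Over an arbitrary index
  type no subsequence need converge, so a filter finer than \<open>sequentially\<close> takes its
  place; limits known along \<open>sequentially\<close> persist along it.\<close>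

lemma bounded_pointwise_cluster_filter:
  fixes v :: "nat \<Rightarrow> 'b \<Rightarrow> complex"
  assumes "\<And>n i. cmod (v n i) \<le> C i"
  obtains F \<phi> where "F \<noteq> bot" "F \<le> sequentially" "\<And>i. ((\<lambda>n. v n i) \<longlongrightarrow> \<phi> i) F"
proof -
  let ?K = "\<Pi>\<^sub>E i\<in>UNIV. cball (0::complex) (C i)"
  have "compact ?K"
    using compactin_PiE[of "\<lambda>_. euclidean" UNIV "\<lambda>i. cball (0::complex) (C i)"]
    by (simp add: euclidean_product_topology)
  moreover have "eventually (\<lambda>x. x \<in> ?K) (filtermap v sequentially)"
    using assms unfolding eventually_filtermap by (intro always_eventually) auto
  moreover have "filtermap v sequentially \<noteq> bot" by (simp add: filtermap_bot_iff)
  ultimately obtain \<phi> where \<phi>: "inf (nhds \<phi>) (filtermap v sequentially) \<noteq> bot"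
    unfolding compact_filter by blast
  \<comment> \<open>Pulling back the neighbourhoods of the cluster point forces convergence along
    \<open>F\<close>; the cluster property says that \<open>F\<close> is proper.\<close>
  define F where "F = inf (filtercomap v (nhds \<phi>)) sequentially"
  have "F \<noteq> bot"
  proof
    assume "F = bot"
    then have "eventually (\<lambda>_. False) F" by simp
    then obtain P Q where PQ: "eventually P (nhds \<phi>)" "eventually Q sequentially" "\<And>n. P (v n) \<Longrightarrow> Q n \<Longrightarrow> False"
      unfolding F_def eventually_inf eventually_filtercomap by metis
    have "eventually (\<lambda>x. \<not> P x) (filtermap v sequentially)"
      unfolding eventually_filtermap using PQ(2) by eventually_elim (use PQ(3) in blast)
    then have "eventually (\<lambda>_. False) (inf (nhds \<phi>) (filtermap v sequentially))"
      unfolding eventually_inf using PQ(1) by blast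
    then show False using \<phi> by (simp add: eventually_False)
  qed
  moreover have "F \<le> sequentially" by (simp add: F_def)
  moreover have "((\<lambda>n. v n i) \<longlongrightarrow> \<phi> i) F" for i
  proof -
    have "((\<lambda>x. x i) \<longlongrightarrow> \<phi> i) (nhds \<phi>)"
    proof (rule iffD1[OF tendsto_at_iff_tendsto_nhds])
      show "((\<lambda>x. x i) \<longlongrightarrow> \<phi> i) (at \<phi>)"
        using continuous_on_product_coordinates[of i] unfolding continuous_on_def by blast
    qed
    moreover have "filterlim v (nhds \<phi>) F"
      by (rule filterlim_mono[OF filterlim_filtercomap order_refl]) (simp add: F_def)
    ultimately show ?thesis by (rule filterlim_compose)
  qed
  ultimately show ?thesis using that by blast
qed

text \<open>Cluster values of \<open>f (y n)\<close> over all functionals \<open>f\<close> form an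
  element of the bidual, hence come from a point \<open>y0\<close>. Weak continuity of
  \<open>R\<close> and weak lower semicontinuity of the norm give the two claims. In the
  applications \<open>R\<close> is a resolvent or a power of one, and the point is that
  \<open>x\<close> lies in its range; the moving centre \<open>z\<close> lets an estimate against a
  convergent sequence pass to the limit.\<close>

lemma reflexive_range_closed:
  fixes R :: "'a::complex_banach \<Rightarrow> 'a"
  assumes refl: "reflexive_space TYPE('a)" and R: "bounded_clinear R"
    and lim: "(\<lambda>n. R (y n)) \<longlonglongrightarrow> x" "z \<longlonglongrightarrow> z0" and le: "\<And>n. norm (y n - z n) \<le> \<rho>"
  shows "\<exists>y0. R y0 = x \<and> norm (y0 - z0) \<le> \<rho>"
proof -
  obtain D where D: "\<And>n. norm (z n) \<le> D"
    using lim(2) by (meson Bseq_def convergentI convergent_imp_Bseq)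
  have yb: "norm (y n) \<le> D + \<rho>" for n
    using D[of n] le[of n] norm_triangle_ineq[of "z n" "y n - z n"] by simp
  then have Dr: "0 \<le> D + \<rho>" using norm_ge_zero order_trans by blast
  \<comment> \<open>The product runs over all functions, so those outside the dual get the constant
    value 0.\<close>
  define v where "v = (\<lambda>n f. if bounded_clinear f then f (y n) else 0 :: complex)"
  have vb: "cmod (v n f) \<le> onorm f * (D + \<rho>)" if "bounded_clinear f" for n f
  proof -
    have "cmod (f (y n)) \<le> onorm f * norm (y n)"
      using that by (intro onorm) (simp add: bounded_clinear_def)
    also have "\<dots> \<le> onorm f * (D + \<rho>)"
      using yb that by (intro mult_left_mono onorm_pos_le) (auto simp: bounded_clinear_def)
    finally show ?thesis using that by (simp add: v_def)
  qed
  have "cmod (v n f) \<le> (if bounded_clinear f then onorm f * (D + \<rho>) else 0)" for n f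
    using vb by (auto simp: v_def)
  then obtain F \<phi> where F: "F \<noteq> bot" "F \<le> sequentially" and \<phi>: "\<And>f. ((\<lambda>n. v n f) \<longlongrightarrow> \<phi> f) F"
    using bounded_pointwise_cluster_filter[of v "\<lambda>f. if bounded_clinear f then onorm f * (D + \<rho>) else 0"]
    by blast
  have \<phi>f: "((\<lambda>n. f (y n)) \<longlongrightarrow> \<phi> f) F" if "bounded_clinear f" for f
    using \<phi>[of f] that by (simp add: v_def)
  have add: "bounded_clinear (\<lambda>x. f x + g x)" if "bounded_clinear f" "bounded_clinear g" for f g :: "'a \<Rightarrow> complex"
    using that bounded_linear_add unfolding bounded_clinear_def by (auto simp: scaleC_complex_def algebra_simps)
  have scale: "bounded_clinear (\<lambda>x. c * f x)" if "bounded_clinear f" for c and f :: "'a \<Rightarrow> complex"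
    using that bounded_linear_const_mult unfolding bounded_clinear_def by (auto simp: scaleC_complex_def algebra_simps)
  have "in_bidual \<phi>" unfolding in_bidual_def
  proof (intro conjI allI impI)
    fix f g :: "'a \<Rightarrow> complex" assume fg: "bounded_clinear f \<and> bounded_clinear g"
    show "\<phi> (\<lambda>x. f x + g x) = \<phi> f + \<phi> g"
      using tendsto_unique[OF F(1) \<phi>f[OF add] tendsto_add[OF \<phi>f[of f] \<phi>f[of g]]] fg by blast
  next
    fix f :: "'a \<Rightarrow> complex" and c assume f: "bounded_clinear f"
    show "\<phi> (\<lambda>x. c * f x) = c * \<phi> f"
      using tendsto_unique[OF F(1) \<phi>f[OF scale] tendsto_mult_left[OF \<phi>f[of f]]] f by blast
  next
    show "\<exists>C. \<forall>f. bounded_clinear f \<longrightarrow> cmod (\<phi> f) \<le> C * onorm f"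
    proof (intro exI[of _ "D + \<rho>"] allI impI)
      fix f :: "'a \<Rightarrow> complex" assume f: "bounded_clinear f"
      have "((\<lambda>n. cmod (v n f)) \<longlongrightarrow> cmod (\<phi> f)) F" using \<phi> by (rule tendsto_norm)
      then show "cmod (\<phi> f) \<le> (D + \<rho>) * onorm f"
        by (rule tendsto_upperbound) (use vb[OF f] F(1) in \<open>auto simp: mult.commute\<close>)
    qed
  qed
  then obtain y0 where y0: "\<And>f. bounded_clinear f \<Longrightarrow> \<phi> f = f y0"
    using refl unfolding reflexive_space_def by blast
  have "R y0 = x"
  proof -
    obtain f :: "'a \<Rightarrow> complex" where f: "bounded_clinear f" "norm (R y0 - x) \<le> cmod (f (R y0 - x))"
      using norming_functional by blast
    have "((\<lambda>n. f (R (y n))) \<longlongrightarrow> f (R y0)) F"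
      using \<phi>f[OF bounded_clinear_compose[OF f(1) R]] y0[OF bounded_clinear_compose[OF f(1) R]] by simp
    moreover have "((\<lambda>n. f (R (y n))) \<longlongrightarrow> f x) F"
      using tendsto_mono[OF F(2) bounded_linear.tendsto[OF bounded_clinear_bounded_linear[OF f(1)] lim(1)]] .
    ultimately have "f (R y0) = f x" using tendsto_unique F(1) by blast
    then have "f (R y0 - x) = 0" by (simp add: linear_diff bounded_linear.linear bounded_clinear_bounded_linear[OF f(1)])
    then show ?thesis using f(2) by simp
  qed
  moreover have "norm (y0 - z0) \<le> \<rho>"
  proof -
    obtain f :: "'a \<Rightarrow> complex" where f: "bounded_clinear f" "\<And>x. cmod (f x) \<le> norm x" "norm (y0 - z0) \<le> cmod (f (y0 - z0))"
      using norming_functional by blast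
    note lf = bounded_linear.linear[OF bounded_clinear_bounded_linear[OF f(1)]]
    have "((\<lambda>n. f (z n)) \<longlongrightarrow> f z0) F"
      using tendsto_mono[OF F(2) bounded_linear.tendsto[OF bounded_clinear_bounded_linear[OF f(1)] lim(2)]] .
    moreover have "((\<lambda>n. f (y n)) \<longlongrightarrow> f y0) F" using \<phi>f[OF f(1)] y0[OF f(1)] by simp
    ultimately have "((\<lambda>n. cmod (f (y n) - f (z n))) \<longlongrightarrow> cmod (f y0 - f z0)) F"
      by (intro tendsto_norm tendsto_diff)
    then have "cmod (f y0 - f z0) \<le> \<rho>"
    proof (rule tendsto_upperbound[OF _ always_eventually F(1)], intro allI)
      fix n show "cmod (f (y n) - f (z n)) \<le> \<rho>"
        using f(2)[of "y n - z n"] le[of n] by (simp add: linear_diff[OF lf])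
    qed
    then show ?thesis using f(3) by (simp add: linear_diff[OF lf])
  qed
  ultimately show ?thesis by blast
qed

section \<open>Right derivatives\<close>

text \<open>The set where the bound with slope \<open>C + e\<close> holds is closed, and its
  supremum cannot lie before \<open>b\<close>, since \<open>D\<close> extends it to the right. Only
  increments are estimated, which suits curves built from two propagators whose derivative has not
  been identified.\<close>

lemma right_difference_bound:
  fixes f :: "real \<Rightarrow> 'a::real_normed_vector"
  assumes "a \<le> b" and cont: "continuous_on {a..b} f"
    and D: "\<And>r e. a \<le> r \<Longrightarrow> r < b \<Longrightarrow> 0 < e \<Longrightarrow>
      eventually (\<lambda>h. norm (f (r + h) - f r) \<le> (C + e) * h) (at_right 0)"
  shows "norm (f b - f a) \<le> C * (b - a)"
proof -
  have main: "norm (f b - f a) \<le> (C + e) * (b - a)" if "e > 0" for e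
  proof -
    define S where "S = {r \<in> {a..b}. norm (f r - f a) \<le> (C + e) * (r - a)}"
    have cl: "closed S" unfolding S_def
      by (intro continuous_on_closed_Collect_le continuous_intros cont)
    have "a \<in> S" using \<open>a \<le> b\<close> by (simp add: S_def)
    have bdd: "bdd_above S" by (rule bdd_aboveI[of _ b]) (simp add: S_def)
    define s where "s = Sup S"
    have sS: "s \<in> S" unfolding s_def using closed_contains_Sup[OF _ bdd cl] \<open>a \<in> S\<close> by blast
    have "s = b"
    proof (rule ccontr)
      assume "s \<noteq> b"
      then have s: "a \<le> s" "s < b" using sS by (auto simp: S_def)
      have "eventually (\<lambda>h::real. h < b - s) (at_right 0)"
        using s by (intro eventually_at_rightI[of 0 "b - s"]) auto
      with D[OF s \<open>e > 0\<close>] have "eventually (\<lambda>h. h > 0 \<and> norm (f (s + h) - f s) \<le> (C + e) * h \<and> h < b - s) (at_right 0)"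
        using eventually_at_right_less[of 0] by eventually_elim auto
      then obtain h where h: "h > 0" "norm (f (s + h) - f s) \<le> (C + e) * h" "h < b - s"
        using eventually_happens[of _ "at_right (0::real)"] by auto
      have "norm (f (s + h) - f a) \<le> norm (f (s + h) - f s) + norm (f s - f a)"
        by (metis add.commute dist_norm dist_triangle)
      also have "\<dots> \<le> (C + e) * h + (C + e) * (s - a)"
        using h sS by (intro add_mono) (auto simp: S_def)
      finally have "s + h \<in> S" using h s by (simp add: S_def algebra_simps)
      then have "s + h \<le> s" unfolding s_def by (rule cSup_upper[OF _ bdd])
      then show False using h by simp
    qed
    then show ?thesis using sS by (simp add: S_def)
  qed
  show ?thesis
  proof (rule field_le_epsilon)
    fix e :: real assume "e > 0"
    \<comment> \<open>The slack is divided by \<open>b - a + 1\<close> because \<open>a = b\<close>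
      is allowed.\<close>
    have "norm (f b - f a) \<le> (C + e / (b - a + 1)) * (b - a)"
      using main[of "e / (b - a + 1)"] \<open>e > 0\<close> \<open>a \<le> b\<close> by simp
    also have "\<dots> \<le> C * (b - a) + e"
      using \<open>e > 0\<close> \<open>a \<le> b\<close> by (simp add: field_simps)
    finally show "norm (f b - f a) \<le> C * (b - a) + e" .
  qed
qed

lemma right_derivative_bound:
  fixes f :: "real \<Rightarrow> 'a::real_normed_vector"
  assumes "a \<le> b" and cont: "continuous_on {a..b} f"
    and D: "\<And>r. a \<le> r \<Longrightarrow> r < b \<Longrightarrow> ((\<lambda>h. (f (r + h) - f r) /\<^sub>R h) \<longlongrightarrow> f' r) (at_right 0)"
    and le: "\<And>r. a \<le> r \<Longrightarrow> r < b \<Longrightarrow> norm (f' r) \<le> C"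
  shows "norm (f b - f a) \<le> C * (b - a)"
proof (rule right_difference_bound[OF assms(1,2)])
  fix r e :: real assume r: "a \<le> r" "r < b" and "0 < e"
  have "((\<lambda>h. norm ((f (r + h) - f r) /\<^sub>R h)) \<longlongrightarrow> norm (f' r)) (at_right 0)"
    by (rule tendsto_norm[OF D[OF r]])
  moreover have "norm (f' r) < C + e" using le[OF r] \<open>0 < e\<close> by simp
  ultimately have "eventually (\<lambda>h. norm ((f (r + h) - f r) /\<^sub>R h) < C + e) (at_right 0)"
    by (rule order_tendstoD)
  then show "eventually (\<lambda>h. norm (f (r + h) - f r) \<le> (C + e) * h) (at_right 0)"
    using eventually_at_right_less[of 0]
  proof eventually_elim
    case (elim h)
    have "norm (f (r + h) - f r) = h * norm ((f (r + h) - f r) /\<^sub>R h)" using elim by simp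
    also have "\<dots> \<le> h * (C + e)" using elim by (intro mult_left_mono) auto
    finally show ?case by (simp add: mult.commute)
  qed
qed

lemma has_vector_derivative_iff_quotient:
  "(f has_vector_derivative d) (at x within S) \<longleftrightarrow> ((\<lambda>y. (f y - f x) /\<^sub>R (y - x)) \<longlongrightarrow> d) (at x within S)"
proof -
  have "norm (f y - f x - (y - x) *\<^sub>R d) / norm (y - x) = norm ((f y - f x) /\<^sub>R (y - x) - d)" if "y \<noteq> x" for y
  proof -
    have "(f y - f x) /\<^sub>R (y - x) - d = (f y - f x - (y - x) *\<^sub>R d) /\<^sub>R (y - x)"
      using that by (simp add: scaleR_diff_right[of "inverse _"])
    then show ?thesis by (simp add: divide_inverse mult.commute)
  qed
  then have "((\<lambda>y. norm (f y - f x - (y - x) *\<^sub>R d) / norm (y - x)) \<longlongrightarrow> 0) (at x within S)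
      \<longleftrightarrow> ((\<lambda>y. norm ((f y - f x) /\<^sub>R (y - x) - d)) \<longlongrightarrow> 0) (at x within S)"
    by (intro tendsto_cong) (auto simp: eventually_at_filter)
  then show ?thesis
    unfolding has_vector_derivative_def has_derivative_iff_norm tendsto_norm_zero_iff LIM_zero_iff
    by (simp add: bounded_linear_scaleR_left)
qed

section \<open>Generators of quasicontraction semigroups\<close>

lemma exp_difference_quotient: "((\<lambda>h. (exp (c * h) - 1) / h) \<longlongrightarrow> (c::real)) (at_right 0)"
proof -
  have "((\<lambda>x. exp (c * x)) has_real_derivative c) (at 0)"
    by (auto intro!: derivative_eq_intros)
  then have "((\<lambda>h. (exp (c * h) - 1) / h) \<longlongrightarrow> c) (at 0)" by (simp add: DERIV_def)
  then show ?thesis by (rule tendsto_within_subset) simp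
qed

lemma linear_op_add: "linear_op A \<Longrightarrow> x \<in> opdom A \<Longrightarrow> y \<in> opdom A \<Longrightarrow> x + y \<in> opdom A \<and> app A (x + y) = app A x + app A y"
  by (simp add: linear_op_def)

lemma linear_op_scaleR: "linear_op A \<Longrightarrow> x \<in> opdom A \<Longrightarrow> c *\<^sub>R x \<in> opdom A \<and> app A (c *\<^sub>R x) = c *\<^sub>R app A x"
  by (simp add: linear_op_def scaleR_scaleC)

lemma linear_op_zero: "linear_op A \<Longrightarrow> 0 \<in> opdom A \<and> app A 0 = 0"
  using linear_op_scaleR[of A 0 0] by (auto simp: linear_op_def)

lemma linear_op_diff:
  assumes "linear_op A" "x \<in> opdom A" "y \<in> opdom A"
  shows "x - y \<in> opdom A \<and> app A (x - y) = app A x - app A y"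
  using linear_op_add[OF assms(1,2), of "(-1) *\<^sub>R y"] linear_op_scaleR[OF assms(1,3), of "-1"] by simp

locale qc_generator =
  fixes G :: "'a::complex_banach operator" and V :: "real \<Rightarrow> 'a \<Rightarrow> 'a" and \<omega> :: real
  assumes qc: "quasicontraction_semigroup \<omega> V" and gen: "is_generator G V" and lin: "linear_op G"
begin

lemma V_clinear: "0 \<le> t \<Longrightarrow> bounded_clinear (V t)"
  using qc by (simp add: quasicontraction_semigroup_def c0_semigroup_def)

lemma V_linear: "0 \<le> t \<Longrightarrow> bounded_linear (V t)"
  using V_clinear bounded_clinear_bounded_linear by blast

lemma V_diff: "0 \<le> t \<Longrightarrow> V t (x - y) = V t x - V t y"
  by (simp add: linear_diff bounded_linear.linear[OF V_linear])

lemma V_scaleR: "0 \<le> t \<Longrightarrow> V t (c *\<^sub>R y) = c *\<^sub>R V t y"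
  by (simp add: linear_scale bounded_linear.linear[OF V_linear])

lemma V_0: "V 0 = id"
  using qc by (simp add: quasicontraction_semigroup_def c0_semigroup_def)

lemma V_add: "0 \<le> s \<Longrightarrow> 0 \<le> t \<Longrightarrow> V (s + t) x = V s (V t x)"
  using qc by (simp add: quasicontraction_semigroup_def c0_semigroup_def)

lemma V_cont: "continuous_on {0..} (\<lambda>t. V t x)"
  using qc by (simp add: quasicontraction_semigroup_def c0_semigroup_def)

lemma V_bound: "0 \<le> t \<Longrightarrow> norm (V t x) \<le> exp (\<omega> * t) * norm x"
  using qc by (simp add: quasicontraction_semigroup_def)

lemma gen_limit: "x \<in> opdom G \<Longrightarrow> ((\<lambda>h. (V h x - x) /\<^sub>R h) \<longlongrightarrow> app G x) (at_right 0)"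
  using gen unfolding is_generator_def by blast

lemma gen_limitD: "((\<lambda>h. (V h x - x) /\<^sub>R h) \<longlongrightarrow> y) (at_right 0) \<Longrightarrow> x \<in> opdom G \<and> app G x = y"
  using gen unfolding is_generator_def by blast

lemma V_tendsto_0: "((\<lambda>h. V h x) \<longlongrightarrow> x) (at_right 0)"
proof -
  have "((\<lambda>t. V t x) \<longlongrightarrow> V 0 x) (at 0 within {0..})"
    using V_cont[of x] by (simp add: continuous_on_def)
  then have "((\<lambda>t. V t x) \<longlongrightarrow> V 0 x) (at_right 0)" by (rule tendsto_within_subset) auto
  then show ?thesis by (simp add: V_0)
qed

lemma gen_limit_at:
  assumes "x \<in> opdom G" "0 \<le> t"
  shows "((\<lambda>h. (V (t + h) x - V t x) /\<^sub>R h) \<longlongrightarrow> V t (app G x)) (at_right 0)"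
proof -
  have "((\<lambda>h. V t ((V h x - x) /\<^sub>R h)) \<longlongrightarrow> V t (app G x)) (at_right 0)"
    by (rule bounded_linear.tendsto[OF V_linear[OF assms(2)] gen_limit[OF assms(1)]])
  moreover have "eventually (\<lambda>h. V t ((V h x - x) /\<^sub>R h) = (V (t + h) x - V t x) /\<^sub>R h) (at_right 0)"
    using eventually_at_right_less[of 0]
    by eventually_elim (use assms in \<open>simp add: V_scaleR V_diff V_add\<close>)
  ultimately show ?thesis by (rule Lim_transform_eventually)
qed

lemma gen_commute:
  assumes "x \<in> opdom G" "0 \<le> t"
  shows "V t x \<in> opdom G \<and> app G (V t x) = V t (app G x)"
proof (rule gen_limitD)
  have "eventually (\<lambda>h. (V (t + h) x - V t x) /\<^sub>R h = (V h (V t x) - V t x) /\<^sub>R h) (at_right 0)"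
    using eventually_at_right_less[of 0]
    by eventually_elim (use assms V_add in \<open>simp add: add.commute\<close>)
  with gen_limit_at[OF assms]
  show "((\<lambda>h. (V h (V t x) - V t x) /\<^sub>R h) \<longlongrightarrow> V t (app G x)) (at_right 0)"
    by (rule Lim_transform_eventually)
qed

text \<open>The curve \<open>V r x - r w\<close> has right derivative
  \<open>V r (app G x) - w\<close>. The free vector \<open>w\<close> serves two purposes: 0 gives
  the Lipschitz bound of an orbit, \<open>app G x\<close> the error of its linear
  approximation.\<close>

lemma V_increment:
  assumes x: "x \<in> opdom G" and "0 \<le> h" and le: "\<And>r. 0 \<le> r \<Longrightarrow> r < h \<Longrightarrow> norm (V r (app G x) - w) \<le> C"
  shows "norm (V h x - x - h *\<^sub>R w) \<le> C * h"
proof -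
  have "norm ((V h x - h *\<^sub>R w) - (V 0 x - 0 *\<^sub>R w)) \<le> C * (h - 0)"
  proof (rule right_derivative_bound[of 0 h "\<lambda>r. V r x - r *\<^sub>R w" "\<lambda>r. V r (app G x) - w"])
    show "continuous_on {0..h} (\<lambda>r. V r x - r *\<^sub>R w)"
      by (intro continuous_intros continuous_on_subset[OF V_cont]) auto
    fix r assume r: "0 \<le> r" "r < h"
    have "((\<lambda>h. (V (r + h) x - V r x) /\<^sub>R h - w) \<longlongrightarrow> V r (app G x) - w) (at_right 0)"
      by (intro tendsto_intros gen_limit_at[OF x r(1)])
    moreover have "eventually (\<lambda>h. (V (r + h) x - V r x) /\<^sub>R h - w =
        (V (r + h) x - (r + h) *\<^sub>R w - (V r x - r *\<^sub>R w)) /\<^sub>R h) (at_right 0)"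
      using eventually_at_right_less[of 0] by eventually_elim (simp add: algebra_simps)
    ultimately show "((\<lambda>h. (V (r + h) x - (r + h) *\<^sub>R w - (V r x - r *\<^sub>R w)) /\<^sub>R h) \<longlongrightarrow> V r (app G x) - w) (at_right 0)"
      by (rule Lim_transform_eventually)
    show "norm (V r (app G x) - w) \<le> C" by (rule le[OF r])
  qed (use assms in auto)
  then show ?thesis by (simp add: V_0 algebra_simps)
qed

text \<open>For small h > 0, \<mu> x - (V h x - x) / h is (\<mu> + 1 / h) x minus V h x / h. The
  triangle inequality and the growth bound of \<open>V h\<close> give the claim up to the difference
  quotient of \<open>exp (\<omega> * h)\<close>, which tends to \<open>\<omega>\<close>.\<close>

lemma dissipative:
  assumes x: "x \<in> opdom G"
  shows "(\<mu> - \<omega>) * norm x \<le> norm (\<mu> *\<^sub>R x - app G x)"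
proof (rule tendsto_le[of "at_right (0::real)"])
  show "((\<lambda>h. norm (\<mu> *\<^sub>R x - (V h x - x) /\<^sub>R h)) \<longlongrightarrow> norm (\<mu> *\<^sub>R x - app G x)) (at_right 0)"
    by (intro tendsto_intros gen_limit x)
  show "((\<lambda>h. (\<mu> - (exp (\<omega> * h) - 1) / h) * norm x) \<longlongrightarrow> (\<mu> - \<omega>) * norm x) (at_right 0)"
    by (intro tendsto_intros exp_difference_quotient)
  show "eventually (\<lambda>h. (\<mu> - (exp (\<omega> * h) - 1) / h) * norm x \<le> norm (\<mu> *\<^sub>R x - (V h x - x) /\<^sub>R h)) (at_right 0)"
    using eventually_at_right_less[of 0]
  proof eventually_elim
    fix h :: real assume "0 < h"
    have "(\<mu> - (exp (\<omega> * h) - 1) / h) * norm x = (\<mu> + 1 / h) * norm x - exp (\<omega> * h) * norm x / h"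
      by (simp add: algebra_simps diff_divide_distrib)
    also have "\<dots> \<le> norm ((\<mu> + 1 / h) *\<^sub>R x) - norm (V h x /\<^sub>R h)"
    proof (rule diff_mono)
      show "(\<mu> + 1 / h) * norm x \<le> norm ((\<mu> + 1 / h) *\<^sub>R x)"
        by (simp add: mult_right_mono)
      show "norm (V h x /\<^sub>R h) \<le> exp (\<omega> * h) * norm x / h"
        using V_bound[of h x] \<open>0 < h\<close> by (simp add: field_simps)
    qed
    also have "\<dots> \<le> norm ((\<mu> + 1 / h) *\<^sub>R x - V h x /\<^sub>R h)" by (rule norm_triangle_ineq2)
    also have "(\<mu> + 1 / h) *\<^sub>R x - V h x /\<^sub>R h = \<mu> *\<^sub>R x - (V h x - x) /\<^sub>R h"
      by (simp add: algebra_simps inverse_eq_divide)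
    finally show "(\<mu> - (exp (\<omega> * h) - 1) / h) * norm x \<le> norm (\<mu> *\<^sub>R x - (V h x - x) /\<^sub>R h)" .
  qed
qed simp

text \<open>
  With \<open>W r = exp (- \<mu> r) V r\<close> and a fixed point \<open>z = y + W 1 z\<close>, the solution is
  \<open>\<integral>\<^sub>0\<^sup>1 W r z dr\<close>; this avoids the Laplace transform over the half line.
\<close>

lemma resolvent_surj:
  assumes "\<omega> < \<mu>"
  obtains x where "x \<in> opdom G" "\<mu> *\<^sub>R x - app G x = y"
proof -
  define W where "W = (\<lambda>r x. exp (- \<mu> * r) *\<^sub>R V r x)"
  have Wcont: "continuous_on {0..} (\<lambda>r. W r x)" for x
    unfolding W_def by (intro continuous_intros V_cont)
  have Wadd: "W (s + t) x = W s (W t x)" if "0 \<le> s" "0 \<le> t" for s t x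
    using that by (simp add: W_def V_add V_scaleR ring_distribs exp_add[symmetric])
  have Wlin: "bounded_linear (W h)" if "0 \<le> h" for h
    unfolding W_def by (intro bounded_linear_scaleR_right[THEN bounded_linear_compose] V_linear that)
  have "\<exists>!z. y + W 1 z = z"
  proof (rule banach_fix_type[of "exp (\<omega> - \<mu>)"])
    show "exp (\<omega> - \<mu>) < 1" using assms by simp
    show "\<forall>z w. dist (y + W 1 z) (y + W 1 w) \<le> exp (\<omega> - \<mu>) * dist z w"
    proof (intro allI)
      fix z w
      have "dist (y + W 1 z) (y + W 1 w) = exp (- \<mu>) * norm (V 1 (z - w))"
        by (simp add: dist_norm W_def V_diff scaleR_diff_right[symmetric])
      also have "\<dots> \<le> exp (- \<mu>) * (exp (\<omega> * 1) * norm (z - w))"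
        by (intro mult_left_mono V_bound) auto
      finally show "dist (y + W 1 z) (y + W 1 w) \<le> exp (\<omega> - \<mu>) * dist z w"
        by (simp add: dist_norm exp_diff exp_minus field_simps)
    qed
  qed auto
  then obtain z where z: "y + W 1 z = z" by blast
  define F where "F = (\<lambda>u. integral {0..u} (\<lambda>r. W r z))"
  \<comment> \<open>The interval reaches up to 2 because \<open>F (u + h)\<close> is needed for
    \<open>u\<close> and \<open>h\<close> up to 1.\<close>
  have F': "(F has_vector_derivative W u z) (at u within {0..2})" if "u \<in> {0..2}" for u
    unfolding F_def
    by (intro integral_has_vector_derivative that continuous_on_subset[OF Wcont]) auto
  have Fright: "((\<lambda>h. (F (u + h) - F u) /\<^sub>R h) \<longlongrightarrow> W u z) (at_right 0)" if "0 \<le> u" "u \<le> 1" for u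
  proof -
    have "((\<lambda>v. (F v - F u) /\<^sub>R (v - u)) \<longlongrightarrow> W u z) (at u within {0..2})"
      using F'[of u] that by (simp add: has_vector_derivative_iff_quotient)
    then have "((\<lambda>v. (F v - F u) /\<^sub>R (v - u)) \<longlongrightarrow> W u z) (at u within {u..2})"
      by (rule tendsto_within_subset) (use that in auto)
    moreover have "at u within {u..2} = at_right u"
      using that by (intro at_within_Icc_at_right) simp
    ultimately show ?thesis
      by (simp add: filterlim_at_right_to_0[of _ _ u] add.commute)
  qed
  \<comment> \<open>In \<open>u\<close>, both \<open>W h (F u)\<close> and \<open>F (u + h)\<close>
    have derivative \<open>W (u + h) z\<close>, so their difference is constant; comparing
    \<open>u = 0\<close> with \<open>u = 1\<close> avoids moving \<open>W h\<close> under the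
    integral.\<close>
  have shift: "W h (F 1) = F (1 + h) - F h" if h: "0 \<le> h" "h \<le> 1" for h
  proof -
    have "\<exists>c. \<forall>u\<in>{0..1}. W h (F u) - F (u + h) = c"
    proof (rule has_vector_derivative_zero_constant[of "{0..1}" "\<lambda>u. W h (F u) - F (u + h)"])
      fix v :: real assume v: "v \<in> {0..1}"
      have "((\<lambda>u. W h (F u)) has_vector_derivative W h (W v z)) (at v within {0..1})"
        by (rule bounded_linear.has_vector_derivative[OF Wlin[OF h(1)]])
          (rule has_vector_derivative_within_subset[OF F'], use v in auto)
      moreover have "((\<lambda>u. F (u + h)) has_vector_derivative W (v + h) z) (at v within {0..1})"
      proof (rule vector_diff_chain_within[where f = "\<lambda>u. u + h" and g = F and f' = 1, unfolded o_def scaleR_one])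
        show "((\<lambda>u. u + h) has_vector_derivative 1) (at v within {0..1})"
          by (auto intro!: derivative_eq_intros)
        show "(F has_vector_derivative W (v + h) z) (at (v + h) within (\<lambda>u. u + h) ` {0..1})"
          by (rule has_vector_derivative_within_subset[OF F']) (use v h in auto)
      qed
      ultimately show "((\<lambda>u. W h (F u) - F (u + h)) has_vector_derivative 0) (at v within {0..1})"
        using has_vector_derivative_diff Wadd[of h v z] h v by (fastforce simp: add.commute)
    next
      fix c assume c: "\<And>x. x \<in> {0..1} \<Longrightarrow> W h (F x) - F (x + h) = c"
      then show "\<exists>c. \<forall>u\<in>{0..1}. W h (F u) - F (u + h) = c" by blast
    qed auto
    then have "W h (F 1) - F (1 + h) = W h (F 0) - F (0 + h)"
      by (metis atLeastAtMost_iff order_refl zero_le_one)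
    then show ?thesis
      using linear_0[OF bounded_linear.linear[OF Wlin[OF h(1)]]] by (simp add: F_def algebra_simps)
  qed
  define x where "x = F 1"
  \<comment> \<open>By \<open>shift\<close>, the quotient of \<open>V h x - x\<close> by
    \<open>h\<close> splits into right difference quotients of \<open>F\<close> at 1 and at 0 and a
    part from the exponential weight. In the limit the fixed point equation for \<open>z\<close>
    turns it into \<mu> x - y.\<close>
  have "((\<lambda>h. exp (\<mu> * h) *\<^sub>R ((F (1 + h) - F 1) /\<^sub>R h - (F (0 + h) - F 0) /\<^sub>R h) + ((exp (\<mu> * h) - 1) / h) *\<^sub>R x)
      \<longlongrightarrow> exp (\<mu> * 0) *\<^sub>R (W 1 z - W 0 z) + \<mu> *\<^sub>R x) (at_right 0)"
    by (intro tendsto_intros Fright exp_difference_quotient) auto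
  moreover have "eventually (\<lambda>h. exp (\<mu> * h) *\<^sub>R ((F (1 + h) - F 1) /\<^sub>R h - (F (0 + h) - F 0) /\<^sub>R h) + ((exp (\<mu> * h) - 1) / h) *\<^sub>R x
      = (V h x - x) /\<^sub>R h) (at_right 0)"
    using eventually_at_right_real[OF zero_less_one]
  proof (eventually_elim)
    fix h :: real assume "h \<in> {0<..<1}"
    then have h: "0 < h" "h < 1" by auto
    have F0: "F 0 = 0" by (simp add: F_def)
    have Vh: "V h x = exp (\<mu> * h) *\<^sub>R (F (1 + h) - F h)"
    proof -
      have "V h x = exp (\<mu> * h) *\<^sub>R W h x" by (simp add: W_def exp_minus)
      then show ?thesis using shift[of h] h by (simp add: x_def)
    qed
    show "exp (\<mu> * h) *\<^sub>R ((F (1 + h) - F 1) /\<^sub>R h - (F (0 + h) - F 0) /\<^sub>R h) + ((exp (\<mu> * h) - 1) / h) *\<^sub>R x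
      = (V h x - x) /\<^sub>R h"
      using h unfolding Vh F0 by (simp add: x_def algebra_simps divide_inverse)
  qed
  ultimately have "((\<lambda>h. (V h x - x) /\<^sub>R h) \<longlongrightarrow> exp (\<mu> * 0) *\<^sub>R (W 1 z - W 0 z) + \<mu> *\<^sub>R x) (at_right 0)"
    by (rule Lim_transform_eventually)
  then have "x \<in> opdom G \<and> app G x = exp (\<mu> * 0) *\<^sub>R (W 1 z - W 0 z) + \<mu> *\<^sub>R x" by (rule gen_limitD)
  moreover have "W 1 z - W 0 z = - y" using z by (simp add: W_def V_0 algebra_simps)
  ultimately show ?thesis using that by auto
qed

text \<open>The semigroup picked by \<open>semigroup_of\<close> comes without a growth bound and has
  to be identified with \<open>V\<close>. On the domain, \<open>V (t - r) (W r x)\<close> joins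
  \<open>V t x\<close> to \<open>W t x\<close>, and its right increments are o(h) because both
  semigroups have the same right derivative at \<open>W r x\<close>. Density does the rest.\<close>

lemma unique_semigroup:
  assumes W: "c0_semigroup W" "is_generator G W" and dense: "densely_defined G" and "0 \<le> t"
  shows "W t = V t"
proof
  have Wlin: "bounded_linear (W r)" if "0 \<le> r" for r
    using W that by (simp add: c0_semigroup_def bounded_clinear_def)
  have Wadd: "W (r + s) x = W r (W s x)" if "0 \<le> r" "0 \<le> s" for r s x
    using W that by (simp add: c0_semigroup_def)
  have W0: "W 0 = id" using W by (simp add: c0_semigroup_def)
  have eq: "W t x = V t x" if x: "x \<in> opdom G" for x
  proof -
    \<comment> \<open>Bounds \<open>V r\<close> for all \<open>r\<close> in [0, t], whatever the
      sign of \<open>\<omega>\<close>.\<close>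
    define M where "M = exp (\<bar>\<omega>\<bar> * t)"
    have VM: "norm (V r y) \<le> M * norm y" if "0 \<le> r" "r \<le> t" for r y
    proof -
      have "norm (V r y) \<le> exp (\<omega> * r) * norm y" by (rule V_bound[OF that(1)])
      also have "\<omega> * r \<le> \<bar>\<omega>\<bar> * t" using that by (intro mult_mono) auto
      then have "exp (\<omega> * r) * norm y \<le> M * norm y" unfolding M_def by (intro mult_right_mono) auto
      finally show ?thesis .
    qed
    have Wx: "W r x \<in> opdom G \<and> ((\<lambda>h. (W (r + h) x - W r x) /\<^sub>R h) \<longlongrightarrow> app G (W r x)) (at_right 0)" if "0 \<le> r" for r
    proof -
      have "((\<lambda>h. W r ((W h x - x) /\<^sub>R h)) \<longlongrightarrow> W r (app G x)) (at_right 0)"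
        using W(2) x by (intro bounded_linear.tendsto[OF Wlin[OF that]]) (unfold is_generator_def, blast)
      moreover have "eventually (\<lambda>h. W r ((W h x - x) /\<^sub>R h) = (W (r + h) x - W r x) /\<^sub>R h) (at_right 0)"
        using eventually_at_right_less[of 0]
        by eventually_elim (use that bounded_linear.linear[OF Wlin[OF that]] in \<open>simp add: linear_scale linear_diff Wadd\<close>)
      ultimately have *: "((\<lambda>h. (W (r + h) x - W r x) /\<^sub>R h) \<longlongrightarrow> W r (app G x)) (at_right 0)"
        by (rule Lim_transform_eventually)
      moreover have "eventually (\<lambda>h. (W (r + h) x - W r x) /\<^sub>R h = (W h (W r x) - W r x) /\<^sub>R h) (at_right 0)"
        using eventually_at_right_less[of 0]
        by eventually_elim (use that Wadd in \<open>simp add: add.commute\<close>)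
      ultimately have "((\<lambda>h. (W h (W r x) - W r x) /\<^sub>R h) \<longlongrightarrow> W r (app G x)) (at_right 0)"
        by (rule Lim_transform_eventually)
      then have "W r x \<in> opdom G \<and> app G (W r x) = W r (app G x)" using W(2) by (simp add: is_generator_def)
      then show ?thesis using * by simp
    qed
    have Wc: "continuous_on {0..} (\<lambda>r. W r x)" using W by (simp add: c0_semigroup_def)
    have "norm (V (t - t) (W t x) - V (t - 0) (W 0 x)) \<le> 0 * (t - 0)"
    proof (rule right_difference_bound[of 0 t "\<lambda>r. V (t - r) (W r x)" 0, OF \<open>0 \<le> t\<close>])
      show "continuous_on {0..t} (\<lambda>r. V (t - r) (W r x))"
        unfolding continuous_on_def
      proof (intro ballI)
        fix r assume r: "r \<in> {0..t}"
        have "continuous_on {0..t} (\<lambda>q. V (t - q) (W r x))"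
          by (rule continuous_on_compose2[OF V_cont]) (auto intro!: continuous_intros)
        then have "((\<lambda>q. V (t - q) (W r x)) \<longlongrightarrow> V (t - r) (W r x)) (at r within {0..t})"
          using r by (simp add: continuous_on_def)
        moreover have "((\<lambda>q. V (t - q) (W q x - W r x)) \<longlongrightarrow> 0) (at r within {0..t})"
        proof (rule Lim_null_comparison)
          show "eventually (\<lambda>q. norm (V (t - q) (W q x - W r x)) \<le> M * norm (W q x - W r x)) (at r within {0..t})"
            unfolding eventually_at_filter by (intro always_eventually) (auto intro: VM)
          have "((\<lambda>q. W q x) \<longlongrightarrow> W r x) (at r within {0..t})"
            using continuous_on_subset[OF Wc, of "{0..t}"] r by (auto simp: continuous_on_def)
          then show "((\<lambda>q. M * norm (W q x - W r x)) \<longlongrightarrow> 0) (at r within {0..t})"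
            by (auto intro!: tendsto_eq_intros)
        qed
        ultimately have "((\<lambda>q. V (t - q) (W r x) + V (t - q) (W q x - W r x)) \<longlongrightarrow> V (t - r) (W r x) + 0) (at r within {0..t})"
          by (rule tendsto_add)
        moreover have "eventually (\<lambda>q. V (t - q) (W r x) + V (t - q) (W q x - W r x) = V (t - q) (W q x)) (at r within {0..t})"
          unfolding eventually_at_filter by (intro always_eventually) (auto simp: V_diff)
        ultimately show "((\<lambda>q. V (t - q) (W q x)) \<longlongrightarrow> V (t - r) (W r x)) (at r within {0..t})"
          using Lim_transform_eventually by fastforce
      qed
      fix r e :: real assume r: "0 \<le> r" "r < t" and "0 < e"
      have "((\<lambda>h. (W (r + h) x - W r x) /\<^sub>R h - (V h (W r x) - W r x) /\<^sub>R h) \<longlongrightarrow> app G (W r x) - app G (W r x)) (at_right 0)"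
        by (intro tendsto_diff) (use Wx[OF r(1)] gen_limit in auto)
      then have "((\<lambda>h. norm ((W (r + h) x - W r x) /\<^sub>R h - (V h (W r x) - W r x) /\<^sub>R h)) \<longlongrightarrow> 0) (at_right 0)"
        by (simp add: tendsto_norm_zero_iff)
      moreover have "0 < e / M" using \<open>0 < e\<close> by (simp add: M_def)
      ultimately have "eventually (\<lambda>h. norm ((W (r + h) x - W r x) /\<^sub>R h - (V h (W r x) - W r x) /\<^sub>R h) < e / M) (at_right 0)"
        by (rule order_tendstoD)
      moreover have "eventually (\<lambda>h. h \<in> {0<..<t - r}) (at_right 0)" using r by (intro eventually_at_right_real) auto
      ultimately show "eventually (\<lambda>h. norm (V (t - (r + h)) (W (r + h) x) - V (t - r) (W r x)) \<le> (0 + e) * h) (at_right 0)"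
      proof eventually_elim
        case (elim h)
        then have h: "0 < h" "h < t - r" by auto
        have "V (t - r) (W r x) = V (t - (r + h)) (V h (W r x))"
          using V_add[of "t - (r + h)" h] h by simp
        then have "norm (V (t - (r + h)) (W (r + h) x) - V (t - r) (W r x)) = norm (V (t - (r + h)) (W (r + h) x - V h (W r x)))"
          using h by (simp add: V_diff)
        also have "\<dots> \<le> M * norm (W (r + h) x - V h (W r x))" using h r by (intro VM) auto
        also have "W (r + h) x - V h (W r x) = h *\<^sub>R ((W (r + h) x - W r x) /\<^sub>R h - (V h (W r x) - W r x) /\<^sub>R h)"
          using h by (simp add: algebra_simps)
        also have "M * norm \<dots> \<le> M * (h * (e / M))"
          unfolding norm_scaleR using less_imp_le[OF elim(1)] h
          by (intro mult_left_mono mult_mono) (auto simp: M_def)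
        also have "\<dots> = (0 + e) * h" by (simp add: M_def)
        finally show ?case .
      qed
    qed
    then show ?thesis by (simp add: V_0 W0)
  qed
  fix x
  have "x \<in> closure (opdom G)" using dense by (simp add: densely_defined_def)
  then obtain u where u: "\<And>n. u n \<in> opdom G" "u \<longlonglongrightarrow> x" unfolding closure_sequential by blast
  have "(\<lambda>n. W t (u n)) \<longlonglongrightarrow> W t x" by (rule bounded_linear.tendsto[OF Wlin[OF \<open>0 \<le> t\<close>] u(2)])
  moreover have "(\<lambda>n. V t (u n)) \<longlonglongrightarrow> V t x" by (rule bounded_linear.tendsto[OF V_linear[OF \<open>0 \<le> t\<close>] u(2)])
  ultimately show "W t x = V t x" using eq[OF u(1)] LIMSEQ_unique by auto
qed

end

section \<open>Graph norms\<close>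

lemma dom_pow_0 [simp]: "dom_pow A 0 = UNIV"
  by (simp add: dom_pow_def)

lemma dom_pow_Suc: "x \<in> dom_pow A (Suc k) \<longleftrightarrow> x \<in> opdom A \<and> app A x \<in> dom_pow A k"
  by (simp add: dom_pow_def All_less_Suc2 funpow_Suc_right del: funpow.simps)

lemma dom_pow_1: "dom_pow A (Suc 0) = opdom A"
  by (auto simp: dom_pow_Suc)

lemma dom_pow_mono: "k \<le> l \<Longrightarrow> x \<in> dom_pow A l \<Longrightarrow> x \<in> dom_pow A k"
  by (auto simp: dom_pow_def)

lemma graph_norm_0 [simp]: "graph_norm A 0 x = norm x"
  by (simp add: graph_norm_def)

lemma graph_norm_Suc: "graph_norm A (Suc k) x = graph_norm A k x + norm ((app A ^^ Suc k) x)"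
  by (simp add: graph_norm_def)

lemma graph_norm_Suc_shift: "graph_norm A (Suc k) x = norm x + graph_norm A k (app A x)"
  unfolding graph_norm_def sum.atMost_Suc_shift
  by (simp add: funpow_Suc_right del: funpow.simps)

lemma graph_norm_nonneg [simp]: "0 \<le> graph_norm A k x"
  by (simp add: graph_norm_def sum_nonneg)

lemma graph_norm_mono: "k \<le> l \<Longrightarrow> graph_norm A k x \<le> graph_norm A l x"
  unfolding graph_norm_def by (intro sum_mono2) auto

lemma norm_le_graph_norm: "norm x \<le> graph_norm A k x"
  using graph_norm_mono[of 0 k A x] by simp

lemma norm_funpow_le_graph_norm: "j \<le> k \<Longrightarrow> norm ((app A ^^ j) x) \<le> graph_norm A k x"
  unfolding graph_norm_def by (rule member_le_sum) auto

lemma dom_pow_combination: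
  assumes "linear_op A" "x \<in> dom_pow A k" "y \<in> dom_pow A k"
  shows "c *\<^sub>R x + d *\<^sub>R y \<in> dom_pow A k \<and>
    (\<forall>j\<le>k. (app A ^^ j) (c *\<^sub>R x + d *\<^sub>R y) = c *\<^sub>R (app A ^^ j) x + d *\<^sub>R (app A ^^ j) y)"
  using assms(2,3)
proof (induction k arbitrary: x y)
  case 0
  then show ?case by simp
next
  case (Suc k)
  let ?z = "c *\<^sub>R x + d *\<^sub>R y"
  have xy: "x \<in> opdom A" "y \<in> opdom A" "app A x \<in> dom_pow A k" "app A y \<in> dom_pow A k"
    using Suc.prems by (auto simp: dom_pow_Suc)
  have z: "?z \<in> opdom A" "app A ?z = c *\<^sub>R app A x + d *\<^sub>R app A y"
    using xy linear_op_add[OF assms(1)] linear_op_scaleR[OF assms(1)] by simp_all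
  note IH = Suc.IH[OF xy(3,4)]
  have "(app A ^^ j) ?z = c *\<^sub>R (app A ^^ j) x + d *\<^sub>R (app A ^^ j) y" if "j \<le> Suc k" for j
  proof (cases j)
    case (Suc i)
    then show ?thesis using that IH z(2) by (simp add: funpow_Suc_right del: funpow.simps)
  qed simp
  then show ?case using IH z by (simp add: dom_pow_Suc)
qed

lemma dom_pow_add: "linear_op A \<Longrightarrow> x \<in> dom_pow A k \<Longrightarrow> y \<in> dom_pow A k \<Longrightarrow> x + y \<in> dom_pow A k"
  using dom_pow_combination[of A x k y 1 1] by simp

lemma dom_pow_diff: "linear_op A \<Longrightarrow> x \<in> dom_pow A k \<Longrightarrow> y \<in> dom_pow A k \<Longrightarrow> x - y \<in> dom_pow A k"
  using dom_pow_combination[of A x k y 1 "-1"] by simp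

lemma dom_pow_scaleR: "linear_op A \<Longrightarrow> x \<in> dom_pow A k \<Longrightarrow> c *\<^sub>R x \<in> dom_pow A k"
  using dom_pow_combination[of A x k x c 0] by simp

lemma funpow_app_diff:
  "linear_op A \<Longrightarrow> x \<in> dom_pow A k \<Longrightarrow> y \<in> dom_pow A k \<Longrightarrow> j \<le> k \<Longrightarrow>
    (app A ^^ j) (x - y) = (app A ^^ j) x - (app A ^^ j) y"
  using dom_pow_combination[of A x k y 1 "-1"] by simp

lemma graph_norm_combination:
  assumes "linear_op A" "x \<in> dom_pow A k" "y \<in> dom_pow A k"
  shows "graph_norm A k (c *\<^sub>R x + d *\<^sub>R y) \<le> \<bar>c\<bar> * graph_norm A k x + \<bar>d\<bar> * graph_norm A k y"
proof -
  have "norm ((app A ^^ j) (c *\<^sub>R x + d *\<^sub>R y)) \<le> \<bar>c\<bar> * norm ((app A ^^ j) x) + \<bar>d\<bar> * norm ((app A ^^ j) y)"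
    if "j \<le> k" for j
    using dom_pow_combination[OF assms, of c d] that norm_triangle_ineq[of "c *\<^sub>R (app A ^^ j) x" "d *\<^sub>R (app A ^^ j) y"]
    by simp
  then show ?thesis
    unfolding graph_norm_def sum_distrib_left sum.distrib[symmetric] by (intro sum_mono) auto
qed

lemma graph_norm_add:
  "linear_op A \<Longrightarrow> x \<in> dom_pow A k \<Longrightarrow> y \<in> dom_pow A k \<Longrightarrow> graph_norm A k (x + y) \<le> graph_norm A k x + graph_norm A k y"
  using graph_norm_combination[of A x k y 1 1] by simp

lemma graph_norm_diff:
  "linear_op A \<Longrightarrow> x \<in> dom_pow A k \<Longrightarrow> y \<in> dom_pow A k \<Longrightarrow> graph_norm A k (x - y) \<le> graph_norm A k x + graph_norm A k y"
  using graph_norm_combination[of A x k y 1 "-1"] by simp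

lemma graph_norm_scaleR:
  "linear_op A \<Longrightarrow> x \<in> dom_pow A k \<Longrightarrow> graph_norm A k (c *\<^sub>R x) \<le> \<bar>c\<bar> * graph_norm A k x"
  using graph_norm_combination[of A x k x c 0] by simp

lemma graph_norm_minus_commute:
  assumes "linear_op A" "x \<in> dom_pow A k" "y \<in> dom_pow A k"
  shows "graph_norm A k (x - y) = graph_norm A k (y - x)"
  unfolding graph_norm_def
  by (intro sum.cong) (use funpow_app_diff[OF assms] funpow_app_diff[OF assms(1,3,2)] in \<open>auto simp: norm_minus_commute\<close>)

text \<open>Closedness of \<open>A\<close> alone suffices: the limit of \<open>app A (X n)\<close>
  is found in D(A^k) by induction, and the closed graph identifies it with
  \<open>app A x\<close>.\<close>

lemma dom_pow_complete:
  assumes A: "linear_op A" "closed_op A" and X: "\<And>n. X n \<in> dom_pow (A::'a::complex_banach operator) k"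
    and C: "\<And>j. j \<le> k \<Longrightarrow> Cauchy (\<lambda>n. (app A ^^ j) (X n))"
  shows "\<exists>x\<in>dom_pow A k. \<forall>j\<le>k. (\<lambda>n. (app A ^^ j) (X n)) \<longlonglongrightarrow> (app A ^^ j) x"
  using X C
proof (induction k arbitrary: X)
  case 0
  then show ?case using Cauchy_convergent[of X] by (force simp: convergent_def)
next
  case (Suc k)
  have AX: "\<And>n. X n \<in> opdom A" "\<And>n. app A (X n) \<in> dom_pow A k" using Suc.prems(1) by (auto simp: dom_pow_Suc)
  have "\<exists>z\<in>dom_pow A k. \<forall>j\<le>k. (\<lambda>n. (app A ^^ j) (app A (X n))) \<longlonglongrightarrow> (app A ^^ j) z"
  proof (rule Suc.IH)
    fix j assume "j \<le> k"
    then show "Cauchy (\<lambda>n. (app A ^^ j) (app A (X n)))"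
      using Suc.prems(2)[of "Suc j"] by (simp add: funpow_Suc_right del: funpow.simps)
  qed (rule AX)
  then obtain z where z: "z \<in> dom_pow A k" "\<And>j. j \<le> k \<Longrightarrow> (\<lambda>n. (app A ^^ j) (app A (X n))) \<longlonglongrightarrow> (app A ^^ j) z"
    by blast
  obtain x where x: "X \<longlonglongrightarrow> x" using Suc.prems(2)[of 0] Cauchy_convergent[of X] by (auto simp: convergent_def)
  have "(\<lambda>n. (X n, app A (X n))) \<longlonglongrightarrow> (x, z)" using x z(2)[of 0] by (intro tendsto_Pair) auto
  moreover have "(X n, app A (X n)) \<in> {(x, app A x) |x. x \<in> opdom A}" for n using AX by blast
  ultimately have "(x, z) \<in> {(x, app A x) |x. x \<in> opdom A}"
    using closed_sequentially[OF A(2)[unfolded closed_op_def]] by meson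
  then have xz: "x \<in> opdom A" "app A x = z" by auto
  have "(\<lambda>n. (app A ^^ j) (X n)) \<longlonglongrightarrow> (app A ^^ j) x" if "j \<le> Suc k" for j
  proof (cases j)
    case 0
    then show ?thesis using x by simp
  next
    case (Suc i)
    then show ?thesis using z(2)[of i] xz that by (simp add: funpow_Suc_right del: funpow.simps)
  qed
  moreover have "x \<in> dom_pow A (Suc k)" using xz z by (simp add: dom_pow_Suc)
  ultimately show ?case by blast
qed

text \<open>D(A^k) with its graph norm is complete but not a type, so Banach's theorem is applied to
  a metric space on a carrier set.\<close>

lemma graph_norm_fixed_point:
  fixes A :: "'a::complex_banach operator"
  assumes A: "linear_op A" "closed_op A"
    and f: "\<And>x. x \<in> dom_pow A k \<Longrightarrow> f x \<in> dom_pow A k" and "q < 1"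
    and le: "\<And>x y. x \<in> dom_pow A k \<Longrightarrow> y \<in> dom_pow A k \<Longrightarrow> graph_norm A k (f x - f y) \<le> q * graph_norm A k (x - y)"
  shows "\<exists>x\<in>dom_pow A k. f x = x"
proof -
  define W where "W = dom_pow A k"
  \<comment> \<open>The default 0 keeps \<open>d\<close> symmetric outside \<open>W\<close>, where
    \<open>A\<close> is not known to act linearly.\<close>
  define d where "d = (\<lambda>x y. if x \<in> W \<and> y \<in> W then graph_norm A k (x - y) else 0)"
  have zeroW: "0 \<in> W" unfolding W_def
    using linear_op_zero[OF A(1)] by (induction k) (auto simp: dom_pow_Suc)
  interpret Metric_space W d
  proof
    fix x y z
    show "0 \<le> d x y" by (simp add: d_def)
    show "d x y = d y x" using graph_norm_minus_commute[OF A(1)] by (auto simp: d_def W_def)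
    show "d x y = 0 \<longleftrightarrow> x = y" if "x \<in> W" "y \<in> W"
    proof
      assume "d x y = 0"
      then show "x = y" using that norm_le_graph_norm[of "x - y" A k] by (simp add: d_def)
    next
      assume "x = y"
      then show "d x y = 0" using that graph_norm_scaleR[OF A(1), of x k 0] graph_norm_nonneg[of A k 0]
        by (simp add: d_def W_def)
    qed
    show "d x z \<le> d x y + d y z" if "x \<in> W" "y \<in> W" "z \<in> W"
      using that graph_norm_add[OF A(1), of "x - y" k "y - z"] dom_pow_diff[OF A(1)] by (simp add: d_def W_def)
  qed
  have mcomplete unfolding mcomplete_def
  proof (intro allI impI)
    fix \<sigma> assume \<sigma>: "MCauchy \<sigma>"
    then have W: "\<sigma> n \<in> W" for n by (auto simp: MCauchy_def)
    have "Cauchy (\<lambda>n. (app A ^^ j) (\<sigma> n))" if "j \<le> k" for j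
    proof (rule CauchyI)
      fix e :: real assume "0 < e"
      then obtain N where N: "\<And>n n'. N \<le> n \<Longrightarrow> N \<le> n' \<Longrightarrow> d (\<sigma> n) (\<sigma> n') < e"
        using \<sigma> unfolding MCauchy_def by blast
      have "norm ((app A ^^ j) (\<sigma> n) - (app A ^^ j) (\<sigma> n')) < e" if "N \<le> n" "N \<le> n'" for n n'
        using N[OF that] W funpow_app_diff[OF A(1), of "\<sigma> n" k "\<sigma> n'" j] \<open>j \<le> k\<close>
          norm_funpow_le_graph_norm[OF \<open>j \<le> k\<close>, of A "\<sigma> n - \<sigma> n'"]
        by (simp add: d_def W_def)
      then show "\<exists>M. \<forall>m\<ge>M. \<forall>n\<ge>M. norm ((app A ^^ j) (\<sigma> m) - (app A ^^ j) (\<sigma> n)) < e" by blast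
    qed
    then obtain x where x: "x \<in> dom_pow A k" "\<And>j. j \<le> k \<Longrightarrow> (\<lambda>n. (app A ^^ j) (\<sigma> n)) \<longlonglongrightarrow> (app A ^^ j) x"
      using dom_pow_complete[OF A, of \<sigma> k] W by (auto simp: W_def)
    have "d (\<sigma> n) x = (\<Sum>j\<le>k. norm ((app A ^^ j) (\<sigma> n) - (app A ^^ j) x))" for n
      using W x(1) funpow_app_diff[OF A(1), of "\<sigma> n" k x] by (simp add: d_def W_def graph_norm_def)
    moreover have "(\<lambda>n. \<Sum>j\<le>k. norm ((app A ^^ j) (\<sigma> n) - (app A ^^ j) x)) \<longlonglongrightarrow> (\<Sum>j\<le>k. 0)"
      by (intro tendsto_sum tendsto_norm_zero LIM_zero x(2)) auto
    ultimately have "limitin mtopology \<sigma> x sequentially"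
      unfolding limitin_metric_dist_null using W x(1) by (simp add: W_def)
    then show "\<exists>x. limitin mtopology \<sigma> x sequentially" by blast
  qed
  then obtain x where "x \<in> W" "f x = x"
  proof (rule Banach_fixedpoint_thm[OF _ _ _ \<open>q < 1\<close>, of f])
    show "d (f x) (f y) \<le> q * d x y" if "x \<in> W" "y \<in> W" for x y
      using that f le by (simp add: d_def W_def)
    show "W \<noteq> {}" using zeroW by blast
    show "f \<in> W \<rightarrow> W" using f by (auto simp: W_def)
  qed
  then show ?thesis by (auto simp: W_def)
qed

text \<open>Surjectivity of \<open>T s\<close> passes to \<open>T r\<close> if \<open>r\<close> is
  close to \<open>s\<close>, by a contraction argument. The a priori constant \<open>c\<close> is
  the same along the whole segment, so the step length is too, and finitely many steps connect
  \<open>s0\<close> with \<open>s\<close>.\<close>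

lemma graph_norm_continuity_method:
  fixes A :: "'a::complex_banach operator" and T :: "real \<Rightarrow> 'a \<Rightarrow> 'a"
  assumes A: "linear_op A" "closed_op A"
    and maps: "\<And>s x. s \<in> {0..1} \<Longrightarrow> x \<in> dom_pow A k \<Longrightarrow> T s x \<in> dom_pow A l"
    and diff: "\<And>s x y. s \<in> {0..1} \<Longrightarrow> x \<in> dom_pow A k \<Longrightarrow> y \<in> dom_pow A k \<Longrightarrow> T s (x - y) = T s x - T s y"
    and below: "\<And>s x. s \<in> {0..1} \<Longrightarrow> x \<in> dom_pow A k \<Longrightarrow> graph_norm A k x \<le> c * graph_norm A l (T s x)"
    and lip: "\<And>s r x. s \<in> {0..1} \<Longrightarrow> r \<in> {0..1} \<Longrightarrow> x \<in> dom_pow A k \<Longrightarrow>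
      graph_norm A l (T s x - T r x) \<le> \<beta> * \<bar>s - r\<bar> * graph_norm A k x"
    and pos: "0 \<le> c" "0 \<le> \<beta>"
    and s0: "s0 \<in> {0..1}" "\<And>g. g \<in> dom_pow A l \<Longrightarrow> \<exists>x\<in>dom_pow A k. T s0 x = g"
    and s: "s \<in> {0..1}" "g \<in> dom_pow A l"
  shows "\<exists>x\<in>dom_pow A k. T s x = g"
proof -
  define onto where "onto = (\<lambda>s. \<forall>g\<in>dom_pow A l. \<exists>x\<in>dom_pow A k. T s x = g)"
  \<comment> \<open>Gives contraction constant 1/2; the \<open>+ 1\<close> covers
    \<open>c * \<beta> = 0\<close>.\<close>
  define \<delta> where "\<delta> = 1 / (2 * (c * \<beta> + 1))"
  have cb: "0 \<le> c * \<beta>" using pos by simp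
  have \<delta>: "\<delta> > 0" using cb by (simp add: \<delta>_def)
  have step: "onto r" if "onto s" and sr: "s \<in> {0..1}" "r \<in> {0..1}" "\<bar>s - r\<bar> \<le> \<delta>" for s r
    unfolding onto_def
  proof
    fix g assume g: "g \<in> dom_pow A l"
    \<comment> \<open>A fixed point \<open>x\<close> satisfies
      \<open>T s x = g + T s x - T r x\<close>, that is, \<open>T r x = g\<close>.\<close>
    define f where "f = (\<lambda>x. SOME z. z \<in> dom_pow A k \<and> T s z = g + T s x - T r x)"
    have f: "f x \<in> dom_pow A k \<and> T s (f x) = g + T s x - T r x" if "x \<in> dom_pow A k" for x
    proof -
      have "g + T s x - T r x \<in> dom_pow A l"
        using that g sr maps dom_pow_add[OF A(1)] dom_pow_diff[OF A(1)] by simp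
      then have "\<exists>z. z \<in> dom_pow A k \<and> T s z = g + T s x - T r x" using \<open>onto s\<close> unfolding onto_def by blast
      then show ?thesis unfolding f_def by (rule someI_ex)
    qed
    have "\<exists>x\<in>dom_pow A k. f x = x"
    proof (rule graph_norm_fixed_point[OF A])
      fix x y assume xy: "x \<in> dom_pow A k" "y \<in> dom_pow A k"
      then have xy': "x - y \<in> dom_pow A k" by (rule dom_pow_diff[OF A(1)])
      have "graph_norm A k (f x - f y) \<le> c * graph_norm A l (T s (f x - f y))"
        using xy f sr dom_pow_diff[OF A(1)] by (intro below) auto
      also have "T s (f x - f y) = T s (x - y) - T r (x - y)"
        using f[OF xy(1)] f[OF xy(2)] by (simp add: diff[OF sr(1)] diff[OF sr(2)] xy)
      also have "c * graph_norm A l \<dots> \<le> c * (\<beta> * \<bar>s - r\<bar> * graph_norm A k (x - y))"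
        using xy' sr pos by (intro mult_left_mono lip) auto
      also have "\<dots> \<le> c * (\<beta> * \<delta> * graph_norm A k (x - y))"
        using sr pos by (intro mult_left_mono mult_right_mono) auto
      also have "\<dots> = (c * \<beta> * \<delta>) * graph_norm A k (x - y)" by simp
      also have "\<dots> \<le> (1 / 2) * graph_norm A k (x - y)"
        using cb by (intro mult_right_mono) (auto simp: \<delta>_def field_simps)
      finally show "graph_norm A k (f x - f y) \<le> (1 / 2) * graph_norm A k (x - y)" .
    qed (use f in auto)
    then obtain x where "x \<in> dom_pow A k" "f x = x" by blast
    then show "\<exists>x\<in>dom_pow A k. T r x = g" using f[of x] by (intro bexI[of _ x]) auto
  qed
  have "\<bar>r - s0\<bar> \<le> real n * \<delta> \<Longrightarrow> r \<in> {0..1} \<Longrightarrow> onto r" for n r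
  proof (induction n arbitrary: r)
    case 0
    then show ?case using s0 by (simp add: onto_def)
  next
    case (Suc n)
    \<comment> \<open>The point at the fraction n / (n + 1) of the way from \<open>s0\<close> to
      \<open>r\<close>: within \<open>n\<close> steps of \<open>s0\<close> and one step of
      \<open>r\<close>.\<close>
    define q where "q = s0 + (real n / real (Suc n)) * (r - s0)"
    have qr: "r - q = (r - s0) / real (Suc n)" by (simp add: q_def field_simps)
    have conv: "q = (1 - real n / real (Suc n)) * s0 + (real n / real (Suc n)) * r"
    proof -
      have "s0 + c * (r - s0) = (1 - c) * s0 + c * r" for c by algebra
      then show ?thesis unfolding q_def .
    qed
    have "q \<in> {0..1}"
      using convexD_alt[of "{0..1::real}" s0 r "real n / real (Suc n)"] s0(1) Suc.prems(2) by (simp add: conv)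
    moreover have "\<bar>q - s0\<bar> \<le> real n * \<delta>"
    proof -
      have "\<bar>q - s0\<bar> = (real n / real (Suc n)) * \<bar>r - s0\<bar>" by (simp add: q_def abs_mult)
      also have "\<dots> \<le> (real n / real (Suc n)) * (real (Suc n) * \<delta>)" using Suc.prems by (intro mult_left_mono) auto
      finally show ?thesis by simp
    qed
    moreover have "\<bar>q - r\<bar> \<le> \<delta>"
    proof -
      have "\<bar>q - r\<bar> = \<bar>r - s0\<bar> / real (Suc n)" using qr by (simp add: abs_minus_commute[of q r])
      also have "\<dots> \<le> (real (Suc n) * \<delta>) / real (Suc n)" using Suc.prems by (intro divide_right_mono) auto
      finally show ?thesis by simp
    qed
    ultimately show ?case using Suc.IH[of q] step[of q r] Suc.prems by blast
  qed
  moreover obtain n where "\<bar>s - s0\<bar> \<le> real n * \<delta>"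
    using \<delta> real_arch_simple[of "\<bar>s - s0\<bar> / \<delta>"] by (auto simp: field_simps)
  ultimately show ?thesis using s unfolding onto_def by blast
qed

section \<open>Domains of powers of a perturbed generator\<close>

lemma linear_op_perturb:
  assumes "linear_op A" "linear_op B" "opdom A \<subseteq> opdom B"
  shows "linear_op (perturb A B)"
  using assms unfolding linear_op_def perturb_def
  by (auto simp: scaleC_add_right algebra_simps subset_iff)

text \<open>Index 0 belongs to the plain norm; index k + 1 bounds the graph norm of order k + 1 by
  that of order k of \<open>T s x\<close>. The \<open>+ 1\<close> comes from
  \<open>T_below_step\<close>, whose right side contains the norm of \<open>T s x\<close> besides
  the lower order norm of \<open>x\<close>.\<close>

primrec apriori_const :: "real \<Rightarrow> real \<Rightarrow> nat \<Rightarrow> real" where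
  "apriori_const \<kappa> c 0 = c"
| "apriori_const \<kappa> c (Suc k) = \<kappa> * (apriori_const \<kappa> c k + 1)"

text \<open>\<open>mu1\<close> makes the inverse of \<mu> - A - B a contraction. \<open>mu2\<close>
  makes \<open>(\<bar>\<omega>\<bar> + b) * norm x\<close> at most half of the gap
  \<open>1 - a\<close> times the norm of (\<mu> - A - B) x, so that these lower order terms can be
  absorbed.\<close>

locale perturbed_generator =
  fixes A B :: "'a::complex_banach operator" and a b \<omega> \<mu> :: real and m :: nat and V :: "real \<Rightarrow> 'a \<Rightarrow> 'a"
  assumes linA: "linear_op A" and linB: "linear_op B" and closedA: "closed_op A"
    and domAB: "opdom A \<subseteq> opdom B" and rb: "rel_bound_consts m A B a b" and a1: "a < 1" and m1: "1 \<le> m"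
    and mu0: "0 \<le> \<mu>" and mu1: "1 \<le> \<mu> - \<omega>" and mu2: "(\<bar>\<omega>\<bar> + b) / (\<mu> - \<omega>) \<le> (1 - a) / 2"
    and qcV: "quasicontraction_semigroup \<omega> V" and genV: "is_generator (perturb A B) V"
begin

sublocale qc_generator "perturb A B" V \<omega>
  by unfold_locales (use qcV genV linear_op_perturb[OF linA linB domAB] in auto)

section \<open>A priori estimates along the segment from A to A + B\<close>

definition T :: "real \<Rightarrow> 'a \<Rightarrow> 'a" where
  "T s x = \<mu> *\<^sub>R x - app A x - s *\<^sub>R app B x"

definition S :: "'a \<Rightarrow> 'a" where
  "S x = \<mu> *\<^sub>R x - app (perturb A B) x"

lemma S_T: "S x = T 1 x"
  by (simp add: S_def T_def perturb_def)

lemma ab0: "0 \<le> a" "0 \<le> b"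
  using rb by (auto simp: rel_bound_consts_def)

lemma B_dom: "k < m \<Longrightarrow> x \<in> dom_pow A (Suc k) \<Longrightarrow> app B x \<in> dom_pow A k"
  using rb unfolding rel_bound_consts_def by (metis One_nat_def Suc_leI atLeastAtMost_iff diff_Suc_1 le_add1 plus_1_eq_Suc)

lemma B_bound: "k < m \<Longrightarrow> x \<in> dom_pow A (Suc k) \<Longrightarrow>
    graph_norm A k (app B x) \<le> a * norm ((app A ^^ Suc k) x) + b * graph_norm A k x"
  using rb unfolding rel_bound_consts_def by (metis One_nat_def Suc_leI atLeastAtMost_iff diff_Suc_1 le_add1 plus_1_eq_Suc)

lemma B_bound': 
  assumes "k < m" "x \<in> dom_pow A (Suc k)"
  shows "graph_norm A k (app B x) \<le> (a + b) * graph_norm A (Suc k) x"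
proof -
  have "graph_norm A k (app B x) \<le> a * norm ((app A ^^ Suc k) x) + b * graph_norm A k x" by (rule B_bound[OF assms])
  also have "\<dots> \<le> a * graph_norm A (Suc k) x + b * graph_norm A (Suc k) x"
    using ab0 norm_funpow_le_graph_norm[of "Suc k" "Suc k" A x] graph_norm_mono[of k "Suc k" A x]
    by (intro add_mono mult_left_mono) auto
  finally show ?thesis by (simp add: algebra_simps)
qed

lemma T_dom:
  assumes "k < m" "x \<in> dom_pow A (Suc k)"
  shows "T s x \<in> dom_pow A k"
  using assms B_dom[OF assms] dom_pow_mono[of k "Suc k" x A] unfolding T_def
  by (intro dom_pow_diff[OF linA] dom_pow_scaleR[OF linA]) (auto simp: dom_pow_Suc)

lemma opdom_B: "x \<in> dom_pow A (Suc k) \<Longrightarrow> x \<in> opdom A \<and> x \<in> opdom B"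
  using domAB by (auto simp: dom_pow_Suc)

lemma T_diff:
  assumes "x \<in> opdom A" "y \<in> opdom A"
  shows "T s (x - y) = T s x - T s y"
proof -
  have "app B (x - y) = app B x - app B y" using linear_op_diff[OF linB, of x y] assms domAB by blast
  then show ?thesis using linear_op_diff[OF linA assms] by (simp add: T_def scaleR_diff_right)
qed

text \<open>
  The generator \<open>A + B\<close> is dissipative up to \<open>\<omega>\<close>, so \<open>v = (\<mu> - A - B) x\<close> controls \<open>x\<close>. With
  \<open>r = (\<mu> - A - s B) x\<close> one has \<open>(1 - s) B x = r - v\<close>, and the relative bound applied to \<open>(1 - s) x\<close>
  absorbs \<open>v\<close>: the whole segment from \<open>A + B\<close> down to \<open>A\<close> is bounded below.
\<close>

lemma T_below_0:
  assumes s: "s \<in> {0..1}" and x: "x \<in> opdom A"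
  shows "norm x \<le> 4 / (1 - a) * norm (T s x)"
proof -
  define \<sigma> where "\<sigma> = 1 - s"
  have \<sigma>: "0 \<le> \<sigma>" "\<sigma> \<le> 1" using s by (auto simp: \<sigma>_def)
  define v where "v = T 1 x"
  define r where "r = T s x"
  have rv: "\<sigma> *\<^sub>R app B x = r - v" by (simp add: \<sigma>_def r_def v_def T_def algebra_simps)
  have "\<sigma> *\<^sub>R app A x = (\<sigma> * \<mu>) *\<^sub>R x - \<sigma> *\<^sub>R v - \<sigma> *\<^sub>R app B x"
    by (simp add: v_def T_def algebra_simps)
  then have Ax: "\<sigma> *\<^sub>R app A x = (\<sigma> * \<mu>) *\<^sub>R x + (1 - \<sigma>) *\<^sub>R v - r"
    unfolding rv by (simp add: algebra_simps)
  have xv: "(\<mu> - \<omega>) * norm x \<le> norm v"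
    using dissipative[of x \<mu>] x by (simp add: v_def T_def perturb_def algebra_simps)
  have xv1: "norm x \<le> norm v"
    using xv mult_right_mono[OF mu1, of "norm x"] by simp
  have "norm v - norm r \<le> norm (\<sigma> *\<^sub>R app B x)"
    unfolding rv by (metis norm_minus_commute norm_triangle_ineq2)
  also have "\<dots> = \<sigma> * norm (app B x)" using \<sigma> by simp
  also have "\<dots> \<le> \<sigma> * (a * norm (app A x) + b * norm x)"
    using B_bound[of 0 x] m1 x \<sigma> by (intro mult_left_mono) (auto simp: dom_pow_Suc)
  also have "\<dots> = a * norm (\<sigma> *\<^sub>R app A x) + b * (\<sigma> * norm x)" using \<sigma> by (simp add: algebra_simps)
  also have "\<dots> \<le> a * (\<sigma> * (norm v + \<bar>\<omega>\<bar> * norm x) + (1 - \<sigma>) * norm v + norm r) + b * norm x"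
  proof (intro add_mono mult_left_mono ab0)
    have "norm (\<sigma> *\<^sub>R app A x) \<le> norm ((\<sigma> * \<mu>) *\<^sub>R x) + norm ((1 - \<sigma>) *\<^sub>R v) + norm r"
      unfolding Ax by (meson norm_triangle_ineq norm_triangle_ineq4 order_trans add_right_mono)
    also have "\<dots> = \<sigma> * (\<mu> * norm x) + (1 - \<sigma>) * norm v + norm r" using \<sigma> mu0 by simp
    also have "\<mu> * norm x \<le> norm v + \<bar>\<omega>\<bar> * norm x"
      using xv mult_right_mono[OF abs_ge_self, of "norm x" \<omega>] by (simp add: algebra_simps)
    finally show "norm (\<sigma> *\<^sub>R app A x) \<le> \<sigma> * (norm v + \<bar>\<omega>\<bar> * norm x) + (1 - \<sigma>) * norm v + norm r"
      using \<sigma> by (simp add: mult_left_mono)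
    show "\<sigma> * norm x \<le> norm x" using \<sigma> mult_right_mono[of \<sigma> 1 "norm x"] by simp
  qed
  also have "\<dots> = a * norm v + (a * \<sigma>) * (\<bar>\<omega>\<bar> * norm x) + a * norm r + b * norm x"
    by (simp add: algebra_simps)
  also have "\<dots> \<le> a * norm v + 1 * (\<bar>\<omega>\<bar> * norm x) + 1 * norm r + b * norm x"
    using ab0 a1 \<sigma> by (intro add_mono mult_right_mono order_refl) (auto simp: mult_le_one)
  also have "\<dots> = a * norm v + (\<bar>\<omega>\<bar> + b) * norm x + norm r" by (simp add: algebra_simps)
  also have "(\<bar>\<omega>\<bar> + b) * norm x \<le> (1 - a) / 2 * norm v"
  proof -
    have "(\<bar>\<omega>\<bar> + b) * norm x = (\<bar>\<omega>\<bar> + b) / (\<mu> - \<omega>) * ((\<mu> - \<omega>) * norm x)" using mu1 by simp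
    also have "\<dots> \<le> (1 - a) / 2 * norm v" using mu1 mu2 xv a1 by (intro mult_mono) auto
    finally show ?thesis .
  qed
  finally have "(1 - a) / 2 * norm v \<le> 2 * norm r" by (simp add: field_simps)
  then have "norm v \<le> 4 / (1 - a) * norm r" using a1 by (simp add: field_simps)
  then show ?thesis using xv1 by (simp add: r_def)
qed

abbreviation "\<kappa> \<equiv> (1 + \<mu> + b) / (1 - a)"
abbreviation "cst \<equiv> apriori_const \<kappa> (4 / (1 - a))"

lemma kappa_nonneg: "0 \<le> \<kappa>"
  using mu0 ab0 a1 by simp

lemma cst_nonneg: "0 \<le> cst k"
proof (induction k)
  case (Suc k)
  then show ?case unfolding apriori_const.simps by (intro mult_nonneg_nonneg kappa_nonneg) simp
qed (use a1 in simp)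

text \<open>Writing A x through T s x and B x bounds the top order part \<open>p\<close> by
  \<open>a * p\<close> plus known terms, and \<open>a < 1\<close> absorbs it. The result is then
  enlarged so that both known terms carry the same factor \<open>\<kappa>\<close>.\<close>

lemma T_below_step:
  assumes s: "s \<in> {0..1}" and kx: "k < m" "x \<in> dom_pow A (Suc k)"
  shows "graph_norm A (Suc k) x \<le> \<kappa> * (graph_norm A k x + graph_norm A k (T s x))"
proof -
  define p n t where "p = norm ((app A ^^ Suc k) x)" and "n = graph_norm A k x" and "t = graph_norm A k (T s x)"
  have x: "x \<in> dom_pow A k" using dom_pow_mono[OF _ kx(2), of k] by simp
  note d = dom_pow_scaleR[OF linA x, of \<mu>] dom_pow_scaleR[OF linA B_dom[OF kx], of s] T_dom[OF kx, of s]
  have "p \<le> graph_norm A k (app A x)"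
    using norm_funpow_le_graph_norm[of k k A "app A x"] by (simp add: p_def funpow_swap1)
  also have "app A x = \<mu> *\<^sub>R x - s *\<^sub>R app B x - T s x" by (simp add: T_def)
  also have "graph_norm A k \<dots> \<le> graph_norm A k (\<mu> *\<^sub>R x) + graph_norm A k (s *\<^sub>R app B x) + t"
    using graph_norm_diff[OF linA dom_pow_diff[OF linA d(1,2)] d(3)] graph_norm_diff[OF linA d(1,2)] by (simp add: t_def)
  also have "graph_norm A k (\<mu> *\<^sub>R x) \<le> \<mu> * n"
    using graph_norm_scaleR[OF linA x, of \<mu>] mu0 by (simp add: n_def)
  also have "graph_norm A k (s *\<^sub>R app B x) \<le> a * p + b * n"
  proof -
    have "graph_norm A k (s *\<^sub>R app B x) \<le> s * graph_norm A k (app B x)"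
      using graph_norm_scaleR[OF linA B_dom[OF kx], of s] s by simp
    also have "\<dots> \<le> 1 * graph_norm A k (app B x)" using s by (intro mult_right_mono) auto
    also have "\<dots> \<le> a * p + b * n" using B_bound[OF kx] by (simp add: p_def n_def)
    finally show ?thesis .
  qed
  finally have "p * (1 - a) \<le> (\<mu> + b) * n + t" by (simp add: algebra_simps)
  then have "p \<le> ((\<mu> + b) * n + t) / (1 - a)" using a1 by (simp add: pos_le_divide_eq)
  then have "n + p \<le> n + ((\<mu> + b) * n + t) / (1 - a)" by simp
  also have "\<dots> = ((1 + \<mu> + b) * n + t - a * n) / (1 - a)" using a1 by (simp add: field_simps)
  also have "\<dots> \<le> ((1 + \<mu> + b) * n + (1 + \<mu> + b) * t) / (1 - a)"
  proof -
    have "0 \<le> a * n" "0 \<le> (\<mu> + b) * t" using ab0 mu0 by (simp_all add: n_def t_def)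
    then show ?thesis using a1 by (intro divide_right_mono) (auto simp: algebra_simps)
  qed
  also have "\<dots> = \<kappa> * (n + t)" by (simp add: algebra_simps)
  finally show ?thesis by (simp add: p_def n_def t_def graph_norm_Suc)
qed

lemma T_below:
  assumes s: "s \<in> {0..1}" and "k < m" "x \<in> dom_pow A (Suc k)"
  shows "graph_norm A (Suc k) x \<le> cst (Suc k) * graph_norm A k (T s x)"
  using assms(2,3)
proof (induction k)
  case (Suc k)
  have x: "x \<in> dom_pow A (Suc k)" using dom_pow_mono[OF _ Suc.prems(2)] by simp
  have "graph_norm A (Suc k) x \<le> cst (Suc k) * graph_norm A k (T s x)"
    using Suc.IH[OF _ x] Suc.prems by simp
  also have "\<dots> \<le> cst (Suc k) * graph_norm A (Suc k) (T s x)"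
    by (intro mult_left_mono graph_norm_mono cst_nonneg) auto
  finally have "graph_norm A (Suc k) x + graph_norm A (Suc k) (T s x) \<le> (cst (Suc k) + 1) * graph_norm A (Suc k) (T s x)"
    by (simp only: distrib_right mult_1)
  from order_trans[OF T_below_step[OF s Suc.prems] mult_left_mono[OF this kappa_nonneg]] show ?case
    by (simp only: apriori_const.simps(2)[of _ _ "Suc k"] mult.assoc)
next
  case 0
  have "norm x + norm (T s x) \<le> (4 / (1 - a) + 1) * norm (T s x)"
    using T_below_0[OF s, of x] 0(2) by (simp add: dom_pow_1 distrib_right)
  from order_trans[OF T_below_step[OF s 0] mult_left_mono[OF this[folded graph_norm_0[of A]] kappa_nonneg]] show ?case
    by (simp only: apriori_const.simps mult.assoc)
qed

lemma T_lip:
  assumes "k < m" "x \<in> dom_pow A (Suc k)"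
  shows "graph_norm A k (T s x - T r x) \<le> (a + b) * \<bar>s - r\<bar> * graph_norm A (Suc k) x"
proof -
  have "T s x - T r x = (r - s) *\<^sub>R app B x" by (simp add: T_def algebra_simps)
  then have "graph_norm A k (T s x - T r x) \<le> \<bar>r - s\<bar> * graph_norm A k (app B x)"
    using graph_norm_scaleR[OF linA B_dom[OF assms]] by simp
  also have "\<dots> \<le> \<bar>r - s\<bar> * ((a + b) * graph_norm A (Suc k) x)"
    by (intro mult_left_mono B_bound' assms) auto
  finally show ?thesis by (simp add: abs_minus_commute algebra_simps)
qed

section \<open>Surjectivity on the domains of powers\<close>

lemma T_continuity:
  assumes "k < m" "s0 \<in> {0..1}" "s \<in> {0..1}"
    and "\<And>g. g \<in> dom_pow A k \<Longrightarrow> \<exists>x\<in>dom_pow A (Suc k). T s0 x = g"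
    and "g \<in> dom_pow A k"
  shows "\<exists>x\<in>dom_pow A (Suc k). T s x = g"
proof (rule graph_norm_continuity_method[OF linA closedA, where T = T and k = "Suc k" and l = k and ?s0.0 = s0
      and c = "cst (Suc k)" and \<beta> = "a + b"])
  show "\<And>s x. s \<in> {0..1} \<Longrightarrow> x \<in> dom_pow A (Suc k) \<Longrightarrow> T s x \<in> dom_pow A k" using T_dom assms(1) by blast
  show "\<And>s x y. s \<in> {0..1} \<Longrightarrow> x \<in> dom_pow A (Suc k) \<Longrightarrow> y \<in> dom_pow A (Suc k) \<Longrightarrow> T s (x - y) = T s x - T s y"
    using T_diff opdom_B by blast
  show "\<And>s x. s \<in> {0..1} \<Longrightarrow> x \<in> dom_pow A (Suc k) \<Longrightarrow> graph_norm A (Suc k) x \<le> cst (Suc k) * graph_norm A k (T s x)"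
    using T_below assms(1) by blast
  show "\<And>s r x. s \<in> {0..1} \<Longrightarrow> r \<in> {0..1} \<Longrightarrow> x \<in> dom_pow A (Suc k) \<Longrightarrow>
      graph_norm A k (T s x - T r x) \<le> (a + b) * \<bar>s - r\<bar> * graph_norm A (Suc k) x"
    using T_lip assms(1) by blast
  show "0 \<le> cst (Suc k)" by (rule cst_nonneg)
qed (use assms ab0 in auto)

lemma A_resolvent_onto: "\<exists>x\<in>opdom A. T 0 x = g"
proof -
  have "\<exists>x\<in>dom_pow A (Suc 0). T 1 x = g" for g
  proof -
    obtain x where "x \<in> opdom (perturb A B)" "\<mu> *\<^sub>R x - app (perturb A B) x = g"
      using resolvent_surj[of \<mu> g] mu1 by auto
    then show ?thesis by (intro bexI[of _ x]) (auto simp: dom_pow_1 T_def perturb_def)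
  qed
  then show ?thesis using T_continuity[of 0 1 0 g] m1 by (auto simp: dom_pow_1)
qed

lemma S_onto:
  assumes "k < m" "g \<in> dom_pow A k"
  shows "\<exists>x\<in>dom_pow A (Suc k). S x = g"
  unfolding S_T
proof (rule T_continuity[OF assms(1), of 0])
  fix g assume g: "g \<in> dom_pow A k"
  obtain x where x: "x \<in> opdom A" "T 0 x = g" using A_resolvent_onto by blast
  have Ax: "app A x = \<mu> *\<^sub>R x - g" using x(2) by (simp add: T_def algebra_simps)
  \<comment> \<open>Bootstrapping: if \<open>x\<close> lies in D(A^(j+1)), then so does \<mu> x - g
    = A x, which puts \<open>x\<close> into D(A^(j+2)).\<close>
  have "x \<in> dom_pow A (Suc j)" if "j \<le> k" for j using that
  proof (induction j)
    case 0
    then show ?case using x by (simp add: dom_pow_1)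
  next
    case (Suc j)
    then have "app A x \<in> dom_pow A (Suc j)"
      unfolding Ax using g by (intro dom_pow_diff[OF linA] dom_pow_scaleR[OF linA] dom_pow_mono[OF _ g]) auto
    then show ?case using x by (simp add: dom_pow_Suc)
  qed
  then show "\<exists>x\<in>dom_pow A (Suc k). T 0 x = g" using x by blast
qed (use assms in auto)

section \<open>The resolvent and its powers\<close>

definition R :: "'a \<Rightarrow> 'a" where
  "R y = (SOME x. x \<in> opdom A \<and> S x = y)"

lemma R: "R y \<in> opdom A" "S (R y) = y"
proof -
  have "\<exists>x. x \<in> opdom A \<and> S x = y" using S_onto[of 0 y] m1 by (auto simp: dom_pow_1)
  then have "R y \<in> opdom A \<and> S (R y) = y" unfolding R_def by (rule someI_ex)
  then show "R y \<in> opdom A" "S (R y) = y" by auto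
qed

lemma S_inj: "x \<in> opdom A \<Longrightarrow> y \<in> opdom A \<Longrightarrow> S x = S y \<Longrightarrow> x = y"
  using T_below_0[of 1 "x - y"] T_diff[of x y 1] linear_op_diff[OF linA, of x y] by (simp add: S_T)

lemma R_S: "x \<in> opdom A \<Longrightarrow> R (S x) = x"
  using S_inj R by blast

lemma S_diff: "x \<in> opdom A \<Longrightarrow> y \<in> opdom A \<Longrightarrow> S (x - y) = S x - S y"
  using T_diff by (simp add: S_T)

lemma norm_R: "norm (R y) \<le> norm y"
proof -
  have "(\<mu> - \<omega>) * norm (R y) \<le> norm (S (R y))"
    unfolding S_def by (rule dissipative) (use R(1) in \<open>simp add: perturb_def\<close>)
  moreover have "norm (R y) \<le> (\<mu> - \<omega>) * norm (R y)" using mult_right_mono[OF mu1, of "norm (R y)"] by simp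
  ultimately show ?thesis using R(2) by simp
qed

lemma bounded_clinear_R: "bounded_clinear R"
proof -
  have opd: "opdom (perturb A B) = opdom A" by (simp add: perturb_def)
  have add: "R (x + y) = R x + R y" for x y
  proof (rule S_inj)
    show "R x + R y \<in> opdom A" using linear_op_add[OF linA] R(1) by blast
    have "S (R x + R y) = x + y"
      using linear_op_add[OF lin, of "R x" "R y"] R[of x] R[of y] by (simp add: opd S_def algebra_simps)
    then show "S (R (x + y)) = S (R x + R y)" using R(2) by simp
  qed (rule R)
  have scale: "R (c *\<^sub>C x) = c *\<^sub>C R x" for c x
  proof (rule S_inj)
    show "c *\<^sub>C R x \<in> opdom A" using linA R(1) by (simp add: linear_op_def)
    have "S (c *\<^sub>C R x) = c *\<^sub>C S (R x)"
      using lin R(1)[of x] by (simp add: linear_op_def opd S_def scaleC_diff_right scaleR_scaleC scaleC_scaleC mult.commute)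
    then show "S (R (c *\<^sub>C x)) = S (c *\<^sub>C R x)" using R(2) by simp
  qed (rule R)
  have "bounded_linear R"
    by (rule bounded_linear_intro[of _ 1]) (use add scale norm_R in \<open>auto simp: scaleR_scaleC\<close>)
  then show ?thesis using scale by (simp add: bounded_clinear_def)
qed

section \<open>Invariant domains and equivalent norms\<close>

lemma V_S:
  assumes "x \<in> opdom A" "0 \<le> h"
  shows "V h x \<in> opdom A" "S (V h x) = V h (S x)"
  using gen_commute[of x h] assms by (auto simp: perturb_def S_def V_diff V_scaleR)

lemma S_dom: "k < m \<Longrightarrow> x \<in> dom_pow A (Suc k) \<Longrightarrow> S x \<in> dom_pow A k"
  using T_dom by (simp add: S_T)

lemma R_dom: "k < m \<Longrightarrow> g \<in> dom_pow A k \<Longrightarrow> R g \<in> dom_pow A (Suc k)"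
  by (metis R_S S_onto dom_pow_Suc)

lemma S_below: "k < m \<Longrightarrow> x \<in> dom_pow A (Suc k) \<Longrightarrow> graph_norm A (Suc k) x \<le> cst (Suc k) * graph_norm A k (S x)"
  using T_below[of 1] by (simp add: S_T)

lemma S_above:
  assumes "k < m" "x \<in> dom_pow A (Suc k)"
  shows "graph_norm A k (S x) \<le> (1 + \<mu> + a + b) * graph_norm A (Suc k) x"
proof -
  note d = dom_pow_mono[OF _ assms(2), of k] B_dom[OF assms]
  have dA: "app A x \<in> dom_pow A k" using assms by (simp add: dom_pow_Suc)
  have "graph_norm A k (S x) \<le> graph_norm A k (\<mu> *\<^sub>R x) + graph_norm A k (app A x) + graph_norm A k (app B x)"
    using graph_norm_diff[OF linA dom_pow_diff[OF linA dom_pow_scaleR[OF linA d(1)] dA] d(2), of \<mu>]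
      graph_norm_diff[OF linA dom_pow_scaleR[OF linA d(1)] dA, of \<mu>]
    by (simp add: S_T T_def)
  also have "graph_norm A k (\<mu> *\<^sub>R x) \<le> \<mu> * graph_norm A (Suc k) x"
    using graph_norm_scaleR[OF linA d(1), of \<mu>] mult_left_mono[OF graph_norm_mono[of k "Suc k" A x] mu0] mu0 by simp
  also have "graph_norm A k (app A x) \<le> graph_norm A (Suc k) x" by (simp add: graph_norm_Suc_shift)
  also have "graph_norm A k (app B x) \<le> (a + b) * graph_norm A (Suc k) x" by (rule B_bound'[OF assms])
  finally show ?thesis by (simp add: algebra_simps)
qed

lemma S_pow_dom: "j + k \<le> m \<Longrightarrow> x \<in> dom_pow A (j + k) \<Longrightarrow> (S ^^ k) x \<in> dom_pow A j"
proof (induction k arbitrary: x)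
  case (Suc k)
  then have "(S ^^ k) (S x) \<in> dom_pow A j" using S_dom[of "j + k" x] by (intro Suc.IH) auto
  then show ?case by (simp add: funpow_Suc_right del: funpow.simps)
qed simp

lemma R_pow_dom: "k \<le> m \<Longrightarrow> (R ^^ k) y \<in> dom_pow A k"
  by (induction k) (auto intro: R_dom)

lemma S_pow_R_pow: "(S ^^ k) ((R ^^ k) y) = y"
  by (induction k) (simp_all add: R(2) funpow_Suc_right[of _ S] del: funpow.simps(2) , simp add: R(2))

lemma R_pow_S_pow: "k \<le> m \<Longrightarrow> x \<in> dom_pow A k \<Longrightarrow> (R ^^ k) ((S ^^ k) x) = x"
proof (induction k arbitrary: x)
  case (Suc k)
  then have "(R ^^ k) ((S ^^ k) (S x)) = S x" using S_dom[of k x] by (intro Suc.IH) auto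
  then show ?case using R_S[of x] Suc.prems by (simp add: funpow_swap1 dom_pow_Suc)
qed simp

lemma bounded_clinear_R_pow: "bounded_clinear (R ^^ k)"
proof (induction k)
  case 0
  then show ?case by (simp add: bounded_clinear_def bounded_linear_ident id_def)
next
  case (Suc k)
  then show ?case using bounded_clinear_compose[OF bounded_clinear_R Suc] by (simp add: o_def)
qed

text \<open>Commutation on D(A) gives \<open>V h x = R (V h (S x))\<close>. By induction
  \<open>V h (S x)\<close> stays in D(A^k), and \<open>R\<close> gains the missing order.\<close>

lemma V_S_pow: "k \<le> m \<Longrightarrow> x \<in> dom_pow A k \<Longrightarrow> 0 \<le> h \<Longrightarrow> V h x \<in> dom_pow A k \<and> (S ^^ k) (V h x) = V h ((S ^^ k) x)"
proof (induction k arbitrary: x)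
  case (Suc k)
  have x: "x \<in> opdom A" using Suc.prems by (simp add: dom_pow_Suc)
  have IH: "V h (S x) \<in> dom_pow A k" "(S ^^ k) (V h (S x)) = V h ((S ^^ k) (S x))"
    using Suc.IH[of "S x"] Suc.prems S_dom[of k x] by auto
  have "R (V h (S x)) \<in> dom_pow A (Suc k)" using R_dom IH(1) Suc.prems by simp
  moreover have "R (V h (S x)) = V h x" using R_S V_S[OF x Suc.prems(3)] by metis
  ultimately show ?case using IH(2) V_S[OF x Suc.prems(3)] by (simp add: funpow_swap1)
qed simp

text \<open>Only \<open>a\<close>, \<open>b\<close> and \<open>\<mu>\<close> enter, not
  \<open>B\<close> itself, so in a family one constant serves all times.\<close>

primrec below_const :: "nat \<Rightarrow> real" where
  "below_const 0 = 1"
| "below_const (Suc k) = cst (Suc k) * below_const k"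

lemma S_pow_below: "k \<le> m \<Longrightarrow> x \<in> dom_pow A k \<Longrightarrow> graph_norm A k x \<le> below_const k * norm ((S ^^ k) x)"
proof (induction k arbitrary: x)
  case (Suc k)
  have "graph_norm A (Suc k) x \<le> cst (Suc k) * graph_norm A k (S x)" using Suc.prems by (intro S_below) auto
  also have "\<dots> \<le> cst (Suc k) * (below_const k * norm ((S ^^ k) (S x)))"
    using Suc.prems S_dom[of k x] by (intro mult_left_mono Suc.IH cst_nonneg) auto
  finally show ?case by (simp add: funpow_swap1)
qed simp

lemma S_pow_above:
  assumes "j + k \<le> m" "x \<in> dom_pow A (j + k)"
  shows "graph_norm A j ((S ^^ k) x) \<le> (1 + \<mu> + a + b) ^ k * graph_norm A (j + k) x"
  using assms
proof (induction k arbitrary: x)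
  case (Suc k)
  have "graph_norm A j ((S ^^ k) (S x)) \<le> (1 + \<mu> + a + b) ^ k * graph_norm A (j + k) (S x)"
    using Suc.prems S_dom[of "j + k" x] by (intro Suc.IH) auto
  also have "\<dots> \<le> (1 + \<mu> + a + b) ^ k * ((1 + \<mu> + a + b) * graph_norm A (Suc (j + k)) x)"
    using Suc.prems mu0 ab0 by (intro mult_left_mono S_above) auto
  finally show ?case by (simp add: funpow_swap1 mult.assoc mult.left_commute mult.commute)
qed simp

end

section \<open>Lipschitz families of perturbed generators\<close>

locale perturbed_family =
  fixes A :: "'a::complex_banach operator" and B :: "real \<Rightarrow> 'a operator" and a b \<omega> \<mu> T L :: real and m :: nat
    and V :: "real \<Rightarrow> real \<Rightarrow> 'a \<Rightarrow> 'a"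
  assumes pg: "t \<in> {0..T} \<Longrightarrow> perturbed_generator A (B t) a b \<omega> \<mu> m (V t)"
    and refl: "reflexive_space TYPE('a)" and T0: "0 < T" and L0: "0 \<le> L"
    and dense: "densely_defined A"
    and lip: "t \<in> {0..T} \<Longrightarrow> t' \<in> {0..T} \<Longrightarrow> k < m \<Longrightarrow> x \<in> dom_pow A (Suc k) \<Longrightarrow>
      graph_norm A k (app (B t') x - app (B t) x) \<le> L * \<bar>t' - t\<bar> * graph_norm A (Suc k) x"
begin

abbreviation "S t \<equiv> perturbed_generator.S A (B t) \<mu>"
abbreviation "R t \<equiv> perturbed_generator.R A (B t) \<mu>"
abbreviation "G t \<equiv> perturb A (B t)"

lemma zero_mem: "0 \<in> {0..T}"
  using T0 by simp

lemma qcg: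
  assumes "t \<in> {0..T}" shows "qc_generator (G t) (V t) \<omega>"
proof -
  interpret P: perturbed_generator A "B t" a b \<omega> \<mu> m "V t" by (rule pg[OF assms])
  show ?thesis by (rule P.qc_generator_axioms)
qed

lemma linA: "linear_op A"
  using pg[OF zero_mem] perturbed_generator.linA by blast

lemma m1: "1 \<le> m"
  using pg[OF zero_mem] perturbed_generator.m1 by blast

lemma mu0: "0 \<le> \<mu>"
  using pg[OF zero_mem] perturbed_generator.mu0 by blast

lemma ab0: "0 \<le> a" "0 \<le> b"
  using perturbed_generator.ab0[OF pg[OF zero_mem]] by auto

lemma opdom_G: "opdom (G t) = opdom A"
  by (simp add: perturb_def)

lemma app_G: "t \<in> {0..T} \<Longrightarrow> app (G t) x = \<mu> *\<^sub>R x - S t x"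
  using perturbed_generator.S_def[OF pg] by (simp add: algebra_simps)

lemma S_minus_S:
  assumes "t \<in> {0..T}" "t' \<in> {0..T}"
  shows "S t x - S t' x = app (B t') x - app (B t) x"
  using perturbed_generator.S_def[OF pg[OF assms(1)]] perturbed_generator.S_def[OF pg[OF assms(2)]]
  by (simp add: perturb_def)

lemma S_diff: "t \<in> {0..T} \<Longrightarrow> x \<in> opdom A \<Longrightarrow> y \<in> opdom A \<Longrightarrow> S t (x - y) = S t x - S t y"
  using perturbed_generator.S_diff[OF pg] .

abbreviation "D \<equiv> 1 + \<mu> + a + b"

section \<open>Lipschitz dependence of the powers of S on time\<close>

lemma S_pow_diff:
  assumes t: "t \<in> {0..T}" and "k \<le> m" "x \<in> dom_pow A k" "y \<in> dom_pow A k"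
  shows "(S t ^^ k) (x - y) = (S t ^^ k) x - (S t ^^ k) y"
  using assms(2-4)
proof (induction k arbitrary: x y)
  case (Suc k)
  have xy: "x \<in> opdom A" "y \<in> opdom A" using Suc.prems by (auto simp: dom_pow_Suc)
  have "(S t ^^ k) (S t x - S t y) = (S t ^^ k) (S t x) - (S t ^^ k) (S t y)"
    using Suc.prems perturbed_generator.S_dom[OF pg[OF t]] by (intro Suc.IH) auto
  then show ?case using S_diff[OF t xy] by (simp add: funpow_swap1)
qed simp

text \<open>Telescoping: one factor is exchanged at a time, whence the factor \<open>real k\<close>.
  The other factors are bounded by \<open>D\<close> each; one power of \<open>D\<close> is given
  away, which is harmless as \<open>1 \<le> D\<close>.\<close>

lemma S_pow_lipschitz:
  assumes t: "t \<in> {0..T}" "t' \<in> {0..T}" and "j + k \<le> m" "x \<in> dom_pow A (j + k)"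
  shows "graph_norm A j ((S t ^^ k) x - (S t' ^^ k) x) \<le> (real k * D ^ k * L * \<bar>t - t'\<bar>) * graph_norm A (j + k) x"
  using assms(3,4)
proof (induction k arbitrary: x)
  case 0
  then show ?case using graph_norm_scaleR[OF linA, of x j 0] by simp
next
  case (Suc k)
  define \<epsilon> where "\<epsilon> = L * \<bar>t - t'\<bar>"
  have \<epsilon>: "0 \<le> \<epsilon>" using L0 by (simp add: \<epsilon>_def)
  have D1: "1 \<le> D" using mu0 ab0 by simp
  note p = pg[OF t(1)] pg[OF t(2)]
  have x: "x \<in> dom_pow A (Suc (j + k))" using Suc.prems by simp
  have jk: "j + k < m" using Suc.prems by simp
  have Sx: "S t x \<in> dom_pow A (j + k)" "S t' x \<in> dom_pow A (j + k)"
    using perturbed_generator.S_dom[OF p(1) jk x] perturbed_generator.S_dom[OF p(2) jk x] by auto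
  have Sd: "S t x - S t' x \<in> dom_pow A (j + k)" by (rule dom_pow_diff[OF linA Sx])
  have "(S t' ^^ k) (S t x - S t' x) = (S t' ^^ k) (S t x) - (S t' ^^ k) (S t' x)"
    using Sx Suc.prems by (intro S_pow_diff[OF t(2)]) (auto intro: dom_pow_mono[of k "j + k"])
  then have eq: "(S t ^^ Suc k) x - (S t' ^^ Suc k) x
      = ((S t ^^ k) (S t x) - (S t' ^^ k) (S t x)) + (S t' ^^ k) (S t x - S t' x)"
    by (simp add: funpow_swap1)
  have d: "(S t ^^ k) (S t x) \<in> dom_pow A j" "(S t' ^^ k) (S t x) \<in> dom_pow A j" "(S t' ^^ k) (S t x - S t' x) \<in> dom_pow A j"
    using perturbed_generator.S_pow_dom[OF p(1)] perturbed_generator.S_pow_dom[OF p(2)] Sx Sd jk by auto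
  have "graph_norm A j ((S t ^^ Suc k) x - (S t' ^^ Suc k) x)
      \<le> graph_norm A j ((S t ^^ k) (S t x) - (S t' ^^ k) (S t x)) + graph_norm A j ((S t' ^^ k) (S t x - S t' x))"
    unfolding eq by (intro graph_norm_add[OF linA] dom_pow_diff[OF linA] d)
  also have "\<dots> \<le> (real k * D ^ k * L * \<bar>t - t'\<bar>) * graph_norm A (j + k) (S t x) + D ^ k * graph_norm A (j + k) (S t x - S t' x)"
    using Sx Sd jk by (intro add_mono Suc.IH perturbed_generator.S_pow_above[OF p(2)]) auto
  also have "\<dots> \<le> (real k * D ^ k * L * \<bar>t - t'\<bar>) * (D * graph_norm A (Suc (j + k)) x) + D ^ k * (\<epsilon> * graph_norm A (Suc (j + k)) x)"
  proof (intro add_mono mult_left_mono)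
    show "graph_norm A (j + k) (S t x) \<le> D * graph_norm A (Suc (j + k)) x"
      by (rule perturbed_generator.S_above[OF p(1) jk x])
    show "graph_norm A (j + k) (S t x - S t' x) \<le> \<epsilon> * graph_norm A (Suc (j + k)) x"
      unfolding S_minus_S[OF t] \<epsilon>_def using lip[OF t jk x] by (simp add: abs_minus_commute)
  qed (use D1 L0 in auto)
  also have "\<dots> \<le> (real k * D ^ k * L * \<bar>t - t'\<bar>) * (D * graph_norm A (Suc (j + k)) x) + D ^ Suc k * (\<epsilon> * graph_norm A (Suc (j + k)) x)"
    using D1 \<epsilon> power_increasing[of k "Suc k" D] by (intro add_left_mono mult_right_mono) auto
  also have "\<dots> = (real (Suc k) * D ^ Suc k * L * \<bar>t - t'\<bar>) * graph_norm A (j + Suc k) x"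
    by (simp add: \<epsilon>_def algebra_simps)
  finally show ?case .
qed

definition \<nu> :: "real \<Rightarrow> nat \<Rightarrow> 'a \<Rightarrow> real" where
  "\<nu> t k x = norm ((S t ^^ k) x)"

lemma \<nu>_nonneg [simp]: "0 \<le> \<nu> t k x"
  by (simp add: \<nu>_def)

abbreviation "bc \<equiv> perturbed_generator.below_const a b \<mu>"

lemma bc_nonneg: "0 \<le> bc k"
proof -
  interpret P: perturbed_generator A "B 0" a b \<omega> \<mu> m "V 0" by (rule pg[OF zero_mem])
  show ?thesis
  proof (induction k)
    case (Suc k)
    then show ?case unfolding P.below_const.simps by (intro mult_nonneg_nonneg P.cst_nonneg)
  qed simp
qed

text \<open>The sum dominates each of its terms, so that one constant serves all orders up to
  \<open>m\<close>.\<close>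

definition c :: real where
  "c = (\<Sum>k\<le>m. real k * D ^ k * L * bc k)"

lemma c_nonneg: "0 \<le> c"
  unfolding c_def using mu0 ab0 L0 bc_nonneg by (intro sum_nonneg mult_nonneg_nonneg) auto

lemma graph_norm_le_\<nu>: "t \<in> {0..T} \<Longrightarrow> k \<le> m \<Longrightarrow> x \<in> dom_pow A k \<Longrightarrow> graph_norm A k x \<le> bc k * \<nu> t k x"
  using perturbed_generator.S_pow_below[OF pg] by (simp add: \<nu>_def)

lemma \<nu>_le_graph_norm: "t \<in> {0..T} \<Longrightarrow> k \<le> m \<Longrightarrow> x \<in> dom_pow A k \<Longrightarrow> \<nu> t k x \<le> D ^ k * graph_norm A k x"
  using perturbed_generator.S_pow_above[OF pg, of t 0 k x] by (simp add: \<nu>_def)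

lemma S_pow_lip:
  assumes t: "t \<in> {0..T}" "t' \<in> {0..T}" and k: "k \<le> m" "x \<in> dom_pow A k"
  shows "norm ((S t ^^ k) x - (S t' ^^ k) x) \<le> c * \<bar>t - t'\<bar> * \<nu> t k x"
proof -
  have nn: "0 \<le> real k * D ^ k * L" using mu0 ab0 L0 by simp
  have "norm ((S t ^^ k) x - (S t' ^^ k) x) \<le> (real k * D ^ k * L * \<bar>t - t'\<bar>) * graph_norm A k x"
    using S_pow_lipschitz[OF t, of 0 k x] k by simp
  also have "\<dots> \<le> (real k * D ^ k * L * \<bar>t - t'\<bar>) * (bc k * \<nu> t k x)"
    using nn by (intro mult_left_mono graph_norm_le_\<nu> t k) auto
  also have "\<dots> = (real k * D ^ k * L * bc k) * (\<bar>t - t'\<bar> * \<nu> t k x)" by simp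
  also have "\<dots> \<le> c * (\<bar>t - t'\<bar> * \<nu> t k x)"
  proof (intro mult_right_mono)
    show "real k * D ^ k * L * bc k \<le> c" unfolding c_def
      using mu0 ab0 L0 bc_nonneg k by (intro member_le_sum mult_nonneg_nonneg) auto
  qed simp
  finally show ?thesis by (simp add: mult.assoc)
qed

lemma \<nu>_change:
  assumes t: "t \<in> {0..T}" "t' \<in> {0..T}" and k: "k \<le> m" "x \<in> dom_pow A k"
  shows "\<nu> t' k x \<le> (1 + c * \<bar>t - t'\<bar>) * \<nu> t k x"
proof -
  have "\<nu> t' k x \<le> \<nu> t k x + norm ((S t ^^ k) x - (S t' ^^ k) x)"
    unfolding \<nu>_def by (metis norm_minus_commute norm_triangle_sub)
  then show ?thesis using S_pow_lip[OF assms] by (simp add: algebra_simps)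
qed

lemma \<nu>_change_T:
  assumes t: "t \<in> {0..T}" "t' \<in> {0..T}" and k: "k \<le> m" "x \<in> dom_pow A k"
  shows "\<nu> t' k x \<le> (1 + c * T) * \<nu> t k x"
proof -
  have "\<bar>t - t'\<bar> \<le> T" using t by auto
  then have "(1 + c * \<bar>t - t'\<bar>) * \<nu> t k x \<le> (1 + c * T) * \<nu> t k x"
    using c_nonneg by (intro mult_right_mono add_left_mono mult_left_mono) auto
  with \<nu>_change[OF assms] show ?thesis by simp
qed

lemma S_lip:
  assumes "t \<in> {0..T}" "t' \<in> {0..T}" "x \<in> opdom A"
  shows "norm (S t x - S t' x) \<le> c * \<bar>t - t'\<bar> * \<nu> t 1 x"
  using S_pow_lip[OF assms(1,2) m1, of x] assms by (simp add: dom_pow_1)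

lemma norm_le_\<nu>: "t \<in> {0..T} \<Longrightarrow> x \<in> opdom A \<Longrightarrow> norm x \<le> \<nu> t 1 x"
  using perturbed_generator.norm_R[OF pg, of t "S t x"] perturbed_generator.R_S[OF pg, of t x] by (simp add: \<nu>_def)

lemma norm_G_le: 
  assumes "t \<in> {0..T}" "x \<in> opdom A"
  shows "norm (app (G t) x) \<le> (\<mu> + 1) * \<nu> t 1 x"
proof -
  have "norm (app (G t) x) \<le> \<mu> * norm x + norm (S t x)"
    unfolding app_G[OF assms(1)] using norm_triangle_ineq4[of "\<mu> *\<^sub>R x" "S t x"] mu0 by simp
  also have "\<dots> \<le> \<mu> * \<nu> t 1 x + \<nu> t 1 x"
    using norm_le_\<nu>[OF assms] mu0 by (intro add_mono mult_left_mono) (auto simp: \<nu>_def)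
  finally show ?thesis by (simp add: algebra_simps)
qed

text \<open>The absolute value makes the growth factor nondecreasing in time, so \<open>E\<close>
  bounds it on all of [0, T].\<close>

definition \<Omega> :: real where "\<Omega> = \<bar>\<omega>\<bar>"
definition E :: real where "E = exp (\<Omega> * T)"

lemma E_ge_1: "1 \<le> E"
  using T0 by (simp add: E_def \<Omega>_def)

lemma exp_le_E: "r \<le> T \<Longrightarrow> exp (\<Omega> * r) \<le> E"
  by (simp add: E_def \<Omega>_def mult_left_mono)

section \<open>The static semigroups in the time-dependent norms\<close>

lemma V_bound:
  assumes "t \<in> {0..T}" "0 \<le> h"
  shows "norm (V t h x) \<le> exp (\<Omega> * h) * norm x"
proof -
  have "norm (V t h x) \<le> exp (\<omega> * h) * norm x" by (rule qc_generator.V_bound[OF qcg[OF assms(1)] assms(2)])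
  also have "\<dots> \<le> exp (\<Omega> * h) * norm x" using assms by (intro mult_right_mono) (auto simp: \<Omega>_def mult_right_mono)
  finally show ?thesis .
qed

lemma V_\<nu>:
  assumes "t \<in> {0..T}" "0 \<le> h" "k \<le> m" "x \<in> dom_pow A k"
  shows "V t h x \<in> dom_pow A k" "\<nu> t k (V t h x) \<le> exp (\<Omega> * h) * \<nu> t k x"
  using perturbed_generator.V_S_pow[OF pg[OF assms(1)] assms(3,4,2)] V_bound[OF assms(1,2)]
  by (auto simp: \<nu>_def)

lemma V_S:
  assumes "t \<in> {0..T}" "0 \<le> h" "x \<in> opdom A"
  shows "V t h x \<in> opdom A" "S t (V t h x) = V t h (S t x)"
  using perturbed_generator.V_S[OF pg[OF assms(1)] assms(3,2)] by auto

lemma V_minus_id: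
  assumes t: "t \<in> {0..T}" and h: "0 \<le> h" "h \<le> T" and x: "x \<in> opdom A"
  shows "norm (V t h x - x) \<le> E * (\<mu> + 1) * h * \<nu> t 1 x"
proof -
  have "norm (V t h x - x - h *\<^sub>R 0) \<le> (E * ((\<mu> + 1) * \<nu> t 1 x)) * h"
  proof (rule qc_generator.V_increment[OF qcg[OF t] _ h(1)])
    fix r :: real assume r: "0 \<le> r" "r < h"
    have "norm (V t r (app (G t) x)) \<le> exp (\<Omega> * r) * norm (app (G t) x)" by (rule V_bound[OF t r(1)])
    also have "\<dots> \<le> E * ((\<mu> + 1) * \<nu> t 1 x)"
      using r h E_ge_1 by (intro mult_mono exp_le_E norm_G_le t x) auto
    finally show "norm (V t r (app (G t) x) - 0) \<le> E * ((\<mu> + 1) * \<nu> t 1 x)" by simp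
  qed (use x in \<open>simp add: opdom_G\<close>)
  then show ?thesis by (simp add: algebra_simps)
qed

lemma semigroup_of_eq:
  assumes "t \<in> {0..T}" "0 \<le> h"
  shows "semigroup_of (G t) h = V t h"
proof (rule qc_generator.unique_semigroup[OF qcg[OF assms(1)] _ _ _ assms(2)])
  interpret Q: qc_generator "G t" "V t" \<omega> by (rule qcg[OF assms(1)])
  have "c0_semigroup (V t)" using Q.qc by (simp add: quasicontraction_semigroup_def)
  then show "c0_semigroup (semigroup_of (G t))" "is_generator (G t) (semigroup_of (G t))"
    using c0_semigroup_semigroup_of Q.gen by auto
  show "densely_defined (G t)" using dense by (simp add: densely_defined_def opdom_G)
qed

end

section \<open>Stepwise static approximations\<close>

lemma grid_Suc: "grid T n (Suc i) = grid T n i + T / n"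
  by (simp add: grid_def algebra_simps add_divide_distrib)

lemma grid_diff: "p \<le> q \<Longrightarrow> grid T n q - grid T n p = real (q - p) * (T / n)"
  by (simp add: grid_def of_nat_diff left_diff_distrib diff_divide_distrib)

lemma grid_mem: "0 \<le> T \<Longrightarrow> i \<le> n \<Longrightarrow> grid T n i \<in> {0..T}"
  using mult_right_mono[of "real i / real n" 1 T] by (auto simp: grid_def divide_le_eq)

lemma grid_cell_less:
  assumes "0 < T" "1 \<le> n" "0 \<le> t" "t < T"
  shows "\<exists>i<n. grid T n i \<le> t \<and> t < grid T n (Suc i)"
proof -
  define i where "i = nat \<lfloor>t * n / T\<rfloor>"
  have "0 \<le> t * n / T" using assms by simp
  then have i: "real i \<le> t * n / T" "t * n / T < real i + 1"
    unfolding i_def by linarith+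
  have "grid T n i \<le> t" "t < grid T n (Suc i)" using i assms by (auto simp: grid_def field_simps)
  moreover have "t * n / T < n" using assms by (simp add: field_simps)
  then have "i < n" using i by linarith
  ultimately show ?thesis by blast
qed

lemma grid_cell:
  assumes "0 < T" "1 \<le> n" "0 \<le> t" "t \<le> T"
  shows "\<exists>i<n. grid T n i \<le> t \<and> t \<le> grid T n (Suc i)"
proof (cases "t = T")
  case True
  then show ?thesis using assms by (intro exI[of _ "n - 1"]) (auto simp: grid_def field_simps of_nat_diff)
next
  case False
  then show ?thesis using grid_cell_less[OF assms(1-3)] assms(4) by (meson less_imp_le order_le_imp_less_or_eq)
qed

text \<open>Closed cells overlap at grid points, so independently chosen cells for \<open>s\<close>
  and \<open>t\<close> can come in the wrong order. Then \<open>s\<close> and \<open>t\<close> are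
  the same grid point and one cell serves both.\<close>

lemma grid_cells:
  assumes "0 < T" "1 \<le> n" "0 \<le> s" "s \<le> t" "t \<le> T"
  obtains p q where "p \<le> q" "q < n" "grid T n p \<le> s" "s \<le> grid T n (Suc p)" "grid T n q \<le> t" "t \<le> grid T n (Suc q)"
proof -
  obtain p where p: "p < n" "grid T n p \<le> s" "s \<le> grid T n (Suc p)" using grid_cell[of T n s] assms by auto
  obtain q where q: "q < n" "grid T n q \<le> t" "t \<le> grid T n (Suc q)" using grid_cell[of T n t] assms by auto
  show ?thesis
  proof (cases "p \<le> q")
    case True
    then show ?thesis using that p q by blast
  next
    case False
    then have "grid T n (Suc q) \<le> grid T n p" using mono_grid[of T n] assms by (auto simp: mono_def)
    then have "t = grid T n p" "s = grid T n p" using p q assms by auto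
    then show ?thesis using that[of p p] p by simp
  qed
qed

context perturbed_family
begin

section \<open>Composition over the grid cells\<close>

lemma exp_\<Omega>_mult: "exp (\<Omega> * (t - r)) * exp (\<Omega> * (r - s)) = exp (\<Omega> * (t - s))"
  by (simp add: exp_add[symmetric] distrib_left[symmetric])

lemma V_0: "t \<in> {0..T} \<Longrightarrow> V t 0 = id"
  by (rule qc_generator.V_0[OF qcg])

lemma V_add: "t \<in> {0..T} \<Longrightarrow> 0 \<le> r \<Longrightarrow> 0 \<le> h \<Longrightarrow> V t (r + h) = V t r \<circ> V t h"
  using qc_generator.V_add[OF qcg] by (simp add: fun_eq_iff)

lemma V_clinear: "t \<in> {0..T} \<Longrightarrow> 0 \<le> h \<Longrightarrow> bounded_clinear (V t h)"
  by (rule qc_generator.V_clinear[OF qcg])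

lemma V_diff: "t \<in> {0..T} \<Longrightarrow> 0 \<le> h \<Longrightarrow> V t h (x - y) = V t h x - V t h y"
  by (rule qc_generator.V_diff[OF qcg])

definition U :: "nat \<Rightarrow> real \<Rightarrow> real \<Rightarrow> 'a \<Rightarrow> 'a" where
  "U n = stepwise_approx T (\<lambda>t. G t) n"

lemma grid_T: "i \<le> n \<Longrightarrow> grid T n i \<in> {0..T}"
  using grid_mem T0 by simp

lemma generates: "t \<in> {0..T} \<Longrightarrow> \<exists>V. c0_semigroup V \<and> is_generator (G t) V"
  using qcg unfolding qc_generator_def quasicontraction_semigroup_def by blast

lemma U_single:
  assumes "i < n" "grid T n i \<le> s" "s \<le> t" "t \<le> grid T n (Suc i)"
  shows "U n t s = V (grid T n i) (t - s)"
  using stepwise_approx_single[of T "\<lambda>t. G t", OF _ generates assms] semigroup_of_eq[OF grid_T, of i n "t - s"] assms T0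
  by (simp add: U_def)

lemma U_refl:
  assumes "1 \<le> n" "s \<in> {0..T}" shows "U n s s = id"
proof -
  obtain i where "i < n" "grid T n i \<le> s" "s \<le> grid T n (Suc i)" using grid_cell[OF T0 assms(1), of s] assms by auto
  then show ?thesis using U_single[of i n s s] V_0[OF grid_T, of i n] by simp
qed

lemma U_step:
  assumes q: "Suc q < n" and s: "0 \<le> s" "s \<le> grid T n (Suc q)" and t: "grid T n (Suc q) \<le> t" "t \<le> grid T n (Suc (Suc q))"
  shows "U n t s = V (grid T n (Suc q)) (t - grid T n (Suc q)) \<circ> U n (grid T n (Suc q)) s"
proof -
  let ?r = "grid T n (Suc q)"
  have r: "?r \<in> {0..T}" using q by (intro grid_T) simp
  have tr: "U n t ?r = V ?r (t - ?r)" using U_single[OF q, of ?r t] t by simp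
  consider "s = ?r" | "t = ?r" | "s < ?r" "?r < t" using s t by linarith
  then show ?thesis
  proof cases
    case 1
    then show ?thesis using tr U_refl[OF _ r, of n] q by simp
  next
    case 2
    then show ?thesis using V_0[OF r] by simp
  next
    case 3
    then show ?thesis
      using stepwise_approx_split[of T "Suc q" n s t "\<lambda>t. G t"] T0 q s tr by (simp add: U_def)
  qed
qed

text \<open>The estimates of the approximations are inductions over the cells from \<open>s\<close>
  to \<open>t\<close>. \<open>Q\<close> carries the cell index besides the time: a grid point
  belongs to two cells, and at the induction step the estimate still refers to the left one.\<close>

lemma U_induct:
  assumes "1 \<le> n" "p \<le> q" "q < n" and s: "grid T n p \<le> s" "s \<le> grid T n (Suc p)"
    and t: "s \<le> t" "grid T n q \<le> t" "t \<le> grid T n (Suc q)"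
    and base: "\<And>t. s \<le> t \<Longrightarrow> t \<le> grid T n (Suc p) \<Longrightarrow> Q p t (V (grid T n p) (t - s))"
    and step: "\<And>q t. p \<le> q \<Longrightarrow> Suc q < n \<Longrightarrow> s \<le> grid T n (Suc q) \<Longrightarrow> grid T n (Suc q) \<le> t \<Longrightarrow>
        t \<le> grid T n (Suc (Suc q)) \<Longrightarrow> Q q (grid T n (Suc q)) (U n (grid T n (Suc q)) s) \<Longrightarrow>
        Q (Suc q) t (V (grid T n (Suc q)) (t - grid T n (Suc q)) \<circ> U n (grid T n (Suc q)) s)"
  shows "Q q t (U n t s)"
  using assms(2,3) t
proof (induction q arbitrary: t rule: dec_induct)
  case base
  then show ?case using assms(9)[of t] U_single[of p n s t] s by simp
next
  case (step q)
  have mono: "mono (grid T n)" using mono_grid T0 by simp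
  have s': "s \<le> grid T n (Suc q)" using s(2) monoD[OF mono, of "Suc p" "Suc q"] step.hyps by simp
  have s0: "0 \<le> s" using s(1) grid_T[of p n] step by auto
  have "Q q (grid T n (Suc q)) (U n (grid T n (Suc q)) s)"
    using step s' monoD[OF mono, of q "Suc q"] by (intro step.IH) auto
  moreover have "U n t s = V (grid T n (Suc q)) (t - grid T n (Suc q)) \<circ> U n (grid T n (Suc q)) s"
    using step s' s0 by (intro U_step) auto
  ultimately show ?case using assms(10)[of q t] step.prems step.hyps s' by argo
qed

section \<open>Stability of the approximations\<close>

lemma U_bounded:
  assumes "1 \<le> n" "0 \<le> s" "s \<le> t" "t \<le> T"
  shows "bounded_clinear (U n t s) \<and> (\<forall>x. norm (U n t s x) \<le> exp (\<Omega> * (t - s)) * norm x)"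
proof -
  obtain p q where pq: "p \<le> q" "q < n" "grid T n p \<le> s" "s \<le> grid T n (Suc p)" "grid T n q \<le> t" "t \<le> grid T n (Suc q)"
    using grid_cells[OF T0 assms] by blast
  show ?thesis
  proof (rule U_induct[of n p q s t "\<lambda>q t F. bounded_clinear F \<and> (\<forall>x. norm (F x) \<le> exp (\<Omega> * (t - s)) * norm x)"])
    fix t assume "s \<le> t" "t \<le> grid T n (Suc p)"
    then show "bounded_clinear (V (grid T n p) (t - s)) \<and>
        (\<forall>x. norm (V (grid T n p) (t - s) x) \<le> exp (\<Omega> * (t - s)) * norm x)"
      using V_clinear[OF grid_T] V_bound[OF grid_T] pq by simp
  next
    fix q t assume q: "Suc q < n" "s \<le> grid T n (Suc q)" "grid T n (Suc q) \<le> t"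
    let ?r = "grid T n (Suc q)"
    assume IH: "bounded_clinear (U n ?r s) \<and> (\<forall>x. norm (U n ?r s x) \<le> exp (\<Omega> * (?r - s)) * norm x)"
    have r: "?r \<in> {0..T}" using q by (intro grid_T) simp
    have "norm (V ?r (t - ?r) (U n ?r s x)) \<le> exp (\<Omega> * (t - s)) * norm x" for x
    proof -
      have "norm (V ?r (t - ?r) (U n ?r s x)) \<le> exp (\<Omega> * (t - ?r)) * norm (U n ?r s x)"
        using q by (intro V_bound[OF r]) simp
      also have "\<dots> \<le> exp (\<Omega> * (t - ?r)) * (exp (\<Omega> * (?r - s)) * norm x)" using IH by (intro mult_left_mono) auto
      also have "\<dots> = exp (\<Omega> * (t - s)) * norm x"
        using exp_\<Omega>_mult[of t ?r s] by (simp only: mult.assoc[symmetric])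
      finally show ?thesis .
    qed
    then show "bounded_clinear (V ?r (t - ?r) \<circ> U n ?r s) \<and>
        (\<forall>x. norm ((V ?r (t - ?r) \<circ> U n ?r s) x) \<le> exp (\<Omega> * (t - s)) * norm x)"
      using bounded_clinear_compose[OF V_clinear[OF r, of "t - ?r"], of "U n ?r s"] IH q by (simp add: o_def)
  qed (use pq assms in auto)
qed

lemma U_norm:
  assumes "1 \<le> n" "0 \<le> s" "s \<le> t" "t \<le> T"
  shows "norm (U n t s x) \<le> E * norm x"
proof -
  have "norm (U n t s x) \<le> exp (\<Omega> * (t - s)) * norm x" using U_bounded[OF assms] by blast
  also have "\<dots> \<le> E * norm x" using assms by (intro mult_right_mono exp_le_E) auto
  finally show ?thesis .
qed

lemma U_diff:
  assumes "1 \<le> n" "0 \<le> s" "s \<le> t" "t \<le> T"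
  shows "U n t s (x - y) = U n t s x - U n t s y"
  using U_bounded[OF assms] by (simp add: bounded_clinear_def linear_diff bounded_linear.linear)


definition M :: real where
  "M = (1 + c * T) * (E * exp (c * T)) * (1 + c * T)"

lemma M_ge: "1 + c * T \<le> M" "1 \<le> M"
proof -
  have 1: "1 \<le> E * exp (c * T)" "1 \<le> 1 + c * T"
    using mult_mono[of 1 E 1 "exp (c * T)"] E_ge_1 c_nonneg T0 by auto
  then have "1 \<le> (1 + c * T) * (E * exp (c * T))" using mult_mono[of 1 "1 + c * T" 1] by simp
  then have "1 * (1 + c * T) \<le> M" unfolding M_def by (rule mult_right_mono) (use 1 in simp)
  then show "1 + c * T \<le> M" by simp
  then show "1 \<le> M" using 1 by simp
qed

text \<open>Inside a cell only the exponential growth counts, and its exponents add up. Each of the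
  \<open>q - p\<close> grid points crossed changes the norm and costs one factor; together these
  stay below \<open>exp (c * T)\<close> uniformly in \<open>n\<close>.\<close>

lemma U_\<nu>_grid:
  assumes n: "1 \<le> n" and pq: "p \<le> q" "q < n" "grid T n p \<le> s" "s \<le> grid T n (Suc p)" "s \<le> t" "grid T n q \<le> t" "t \<le> grid T n (Suc q)"
    and k: "k \<le> m" "x \<in> dom_pow A k"
  shows "U n t s x \<in> dom_pow A k \<and>
    \<nu> (grid T n q) k (U n t s x) \<le> exp (\<Omega> * (t - s)) * (1 + c * (T / n)) ^ (q - p) * \<nu> (grid T n p) k x"
proof (rule U_induct[OF n pq, of "\<lambda>q t F. F x \<in> dom_pow A k \<and>
    \<nu> (grid T n q) k (F x) \<le> exp (\<Omega> * (t - s)) * (1 + c * (T / n)) ^ (q - p) * \<nu> (grid T n p) k x"])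
  fix t assume "s \<le> t" "t \<le> grid T n (Suc p)"
  then show "V (grid T n p) (t - s) x \<in> dom_pow A k \<and>
    \<nu> (grid T n p) k (V (grid T n p) (t - s) x) \<le> exp (\<Omega> * (t - s)) * (1 + c * (T / n)) ^ (p - p) * \<nu> (grid T n p) k x"
    using V_\<nu>[OF grid_T _ k, of p n "t - s"] pq by simp
next
  fix q t assume q: "p \<le> q" "Suc q < n" "s \<le> grid T n (Suc q)" "grid T n (Suc q) \<le> t"
  let ?r = "grid T n (Suc q)"
  let ?y = "U n ?r s x"
  let ?d = "1 + c * (T / n)"
  assume IH: "?y \<in> dom_pow A k \<and> \<nu> (grid T n q) k ?y \<le> exp (\<Omega> * (?r - s)) * ?d ^ (q - p) * \<nu> (grid T n p) k x"
  have r: "?r \<in> {0..T}" "grid T n q \<in> {0..T}" using q by (auto intro!: grid_T[unfolded atLeastAtMost_iff])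
  have d0: "0 \<le> ?d" using c_nonneg T0 by simp
  have "\<nu> ?r k (V ?r (t - ?r) ?y) \<le> exp (\<Omega> * (t - ?r)) * \<nu> ?r k ?y" using q r IH k by (intro V_\<nu>) auto
  also have "\<dots> \<le> exp (\<Omega> * (t - ?r)) * (?d * \<nu> (grid T n q) k ?y)"
    using \<nu>_change[OF r(2,1) k(1), of ?y] IH T0 by (intro mult_left_mono) (auto simp: grid_Suc)
  also have "\<dots> \<le> exp (\<Omega> * (t - ?r)) * (?d * (exp (\<Omega> * (?r - s)) * ?d ^ (q - p) * \<nu> (grid T n p) k x))"
    using IH d0 by (intro mult_left_mono) auto
  also have "\<dots> = (exp (\<Omega> * (t - ?r)) * exp (\<Omega> * (?r - s))) * ?d ^ Suc (q - p) * \<nu> (grid T n p) k x"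
    by (simp add: mult_ac)
  also have "exp (\<Omega> * (t - ?r)) * exp (\<Omega> * (?r - s)) = exp (\<Omega> * (t - s))" by (rule exp_\<Omega>_mult)
  finally show "(V ?r (t - ?r) \<circ> U n ?r s) x \<in> dom_pow A k \<and>
    \<nu> ?r k ((V ?r (t - ?r) \<circ> U n ?r s) x) \<le> exp (\<Omega> * (t - s)) * ?d ^ (Suc q - p) * \<nu> (grid T n p) k x"
    using V_\<nu>(1)[OF r(1) _ k(1), of "t - ?r" ?y] IH q by (simp add: Suc_diff_le)
qed

lemma U_\<nu>:
  assumes "1 \<le> n" "0 \<le> s" "s \<le> t" "t \<le> T" and k: "k \<le> m" "x \<in> dom_pow A k" and t': "t' \<in> {0..T}" "s' \<in> {0..T}"
  shows "U n t s x \<in> dom_pow A k" "\<nu> t' k (U n t s x) \<le> M * \<nu> s' k x"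
proof -
  obtain p q where pq: "p \<le> q" "q < n" "grid T n p \<le> s" "s \<le> grid T n (Suc p)" "grid T n q \<le> t" "t \<le> grid T n (Suc q)"
    using grid_cells[OF T0 assms(1-4)] by blast
  have gpq: "grid T n p \<in> {0..T}" "grid T n q \<in> {0..T}" using pq by (auto intro!: grid_T[unfolded atLeastAtMost_iff])
  have cT: "0 \<le> 1 + c * T" "0 \<le> c * (T / n)" using c_nonneg T0 by auto
  note * = U_\<nu>_grid[OF assms(1) pq(1-4) assms(3) pq(5,6) k]
  then show U: "U n t s x \<in> dom_pow A k" by blast
  have "\<nu> t' k (U n t s x) \<le> (1 + c * T) * \<nu> (grid T n q) k (U n t s x)"
    by (rule \<nu>_change_T[OF gpq(2) t'(1) k(1) U])
  also have "\<dots> \<le> (1 + c * T) * (exp (\<Omega> * (t - s)) * (1 + c * (T / n)) ^ (q - p) * \<nu> (grid T n p) k x)"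
    using * cT by (intro mult_left_mono) auto
  also have "\<dots> \<le> (1 + c * T) * (E * exp (c * T) * ((1 + c * T) * \<nu> s' k x))"
  proof (intro mult_left_mono mult_mono)
    show "exp (\<Omega> * (t - s)) \<le> E" using assms by (intro exp_le_E) simp
    have "(1 + c * (T / n)) ^ (q - p) \<le> (1 + c * (T / n)) ^ n" using cT pq by (intro power_increasing) auto
    also have "\<dots> \<le> exp (c * (T / n)) ^ n" using cT by (intro power_mono) auto
    also have "\<dots> = exp (c * T)" using assms(1) by (simp add: exp_of_nat_mult[symmetric])
    finally show "(1 + c * (T / n)) ^ (q - p) \<le> exp (c * T)" .
    show "\<nu> (grid T n p) k x \<le> (1 + c * T) * \<nu> s' k x" by (rule \<nu>_change_T[OF t'(2) gpq(1) k])
  qed (use cT E_ge_1 in auto)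
  also have "\<dots> = M * \<nu> s' k x" by (simp add: M_def mult_ac)
  finally show "\<nu> t' k (U n t s x) \<le> M * \<nu> s' k x" .
qed

lemma U_opdom:
  assumes "1 \<le> n" "0 \<le> s" "s \<le> t" "t \<le> T" "x \<in> opdom A"
  shows "U n t s x \<in> opdom A"
  using U_\<nu>(1)[OF assms(1-4) m1, of x 0 0] assms T0 by (simp add: dom_pow_1)

lemma U_\<nu>1:
  assumes "1 \<le> n" "0 \<le> s" "s \<le> t" "t \<le> T" "x \<in> opdom A" "t' \<in> {0..T}"
  shows "\<nu> t' 1 (U n t s x) \<le> M * \<nu> 0 1 x"
  using U_\<nu>(2)[OF assms(1-4) m1, of x t' 0] assms T0 by (simp add: dom_pow_1)

text \<open>\<open>stepwise_approx_split\<close> cuts at grid points only. For arbitrary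
  \<open>r\<close> the cell of \<open>r\<close> is treated by the semigroup law, with
  \<open>s\<close> either in that cell or before it; later cells are composed on the left on both
  sides.\<close>

lemma U_cocycle:
  assumes n: "1 \<le> n" and "0 \<le> s" "s \<le> r" "r \<le> t" "t \<le> T"
  shows "U n t r \<circ> U n r s = U n t s"
proof -
  obtain p q where pq: "p \<le> q" "q < n" "grid T n p \<le> r" "r \<le> grid T n (Suc p)" "grid T n q \<le> t" "t \<le> grid T n (Suc q)"
    using grid_cells[OF T0 n order_trans[OF assms(2,3)] assms(4,5)] by blast
  have "U n t s = U n t r \<circ> U n r s"
  proof (rule U_induct[OF n pq(1-4) assms(4) pq(5,6), of "\<lambda>q t F. U n t s = F \<circ> U n r s"])
    fix t assume t: "r \<le> t" "t \<le> grid T n (Suc p)"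
    have gp: "grid T n p \<in> {0..T}" using pq by (intro grid_T) auto
    show "U n t s = V (grid T n p) (t - r) \<circ> U n r s"
    proof (cases "grid T n p \<le> s")
      case True
      then have "U n t s = V (grid T n p) (t - s)" "U n r s = V (grid T n p) (r - s)"
        using U_single[of p n s] pq t assms by auto
      then show ?thesis using V_add[OF gp, of "t - r" "r - s"] t assms by simp
    next
      case False
      \<comment> \<open>\<open>p\<close> is positive because grid point 0 is 0, which does not
        exceed \<open>s\<close>.\<close>
      then obtain p' where p': "p = Suc p'" using assms(2) by (cases p) (auto simp: grid_def)
      have h: "Suc p' < n" "s \<le> grid T n (Suc p')" "grid T n (Suc p') \<le> r" "t \<le> grid T n (Suc (Suc p'))"
        using False pq t unfolding p' by linarith+
      have "U n t s = V (grid T n p) (t - grid T n p) \<circ> U n (grid T n p) s"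
        unfolding p' by (rule U_step[OF h(1) assms(2) h(2) order_trans[OF h(3) t(1)] h(4)])
      moreover have "U n r s = V (grid T n p) (r - grid T n p) \<circ> U n (grid T n p) s"
        unfolding p' by (rule U_step[OF h(1) assms(2) h(2,3) order_trans[OF t(1) h(4)]])
      ultimately show ?thesis using V_add[OF gp, of "t - r" "r - grid T n p"] t pq by (simp add: comp_assoc[symmetric])
    qed
  next
    fix q t assume q: "p \<le> q" "Suc q < n" "r \<le> grid T n (Suc q)" "grid T n (Suc q) \<le> t" "t \<le> grid T n (Suc (Suc q))"
      and IH: "U n (grid T n (Suc q)) s = U n (grid T n (Suc q)) r \<circ> U n r s"
    have "U n t s = V (grid T n (Suc q)) (t - grid T n (Suc q)) \<circ> U n (grid T n (Suc q)) s"
      using q assms by (intro U_step) auto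
    then show "U n t s = V (grid T n (Suc q)) (t - grid T n (Suc q)) \<circ> U n (grid T n (Suc q)) r \<circ> U n r s"
      unfolding IH by (simp add: comp_assoc)
  qed
  then show ?thesis by simp
qed

end

section \<open>Increments in time and the commutator with S\<close>

lemma norm_diff_triangle: "norm (x - z) \<le> norm (x - y) + norm (y - z :: 'a::real_normed_vector)"
  using dist_triangle[of x z y] by (simp add: dist_norm)

context perturbed_family
begin

text \<open>\<open>E * (\<mu> + 1)\<close> is the Lipschitz constant of a single semigroup orbit in
  terms of the norm at its own frozen time; \<open>M\<close> pays for stability and for the passage
  to time 0.\<close>

definition K :: real where
  "K = E * (\<mu> + 1) * M"

lemma K_nonneg: "0 \<le> K"
  using E_ge_1 mu0 M_ge by (simp add: K_def)

lemma V_lipschitz: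
  assumes "t \<in> {0..T}" "0 \<le> h" "h \<le> T" "x \<in> opdom A"
  shows "norm (V t h x - x) \<le> K * h * \<nu> 0 1 x"
proof -
  have "norm (V t h x - x) \<le> E * (\<mu> + 1) * h * \<nu> t 1 x" by (rule V_minus_id[OF assms])
  also have "\<dots> \<le> E * (\<mu> + 1) * h * (M * \<nu> 0 1 x)"
  proof (intro mult_left_mono)
    have "\<nu> t 1 x \<le> (1 + c * T) * \<nu> 0 1 x" using \<nu>_change_T[OF zero_mem assms(1) m1, of x] assms(4) by (simp add: dom_pow_1)
    also have "\<dots> \<le> M * \<nu> 0 1 x" by (intro mult_right_mono M_ge) simp
    finally show "\<nu> t 1 x \<le> M * \<nu> 0 1 x" .
  qed (use assms E_ge_1 mu0 in auto)
  finally show ?thesis by (simp add: K_def mult_ac)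
qed

text \<open>The increments over the cells add up with the same constant: each is bounded through the
  norm of the current value, which stability keeps below \<open>M * \<nu> 0 1 x\<close> however many
  cells have passed.\<close>

lemma U_lipschitz:
  assumes "1 \<le> n" "0 \<le> s" "s \<le> t" "t \<le> T" "x \<in> opdom A"
  shows "norm (U n t s x - x) \<le> K * (t - s) * \<nu> 0 1 x"
proof -
  obtain p q where pq: "p \<le> q" "q < n" "grid T n p \<le> s" "s \<le> grid T n (Suc p)" "grid T n q \<le> t" "t \<le> grid T n (Suc q)"
    using grid_cells[OF T0 assms(1-4)] by blast
  show ?thesis
  proof (rule U_induct[OF assms(1) pq(1-4) assms(3) pq(5,6), of "\<lambda>q t F. norm (F x - x) \<le> K * (t - s) * \<nu> 0 1 x"])
    fix t assume t: "s \<le> t" "t \<le> grid T n (Suc p)"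
    have "grid T n p \<in> {0..T}" "grid T n (Suc p) \<in> {0..T}" using pq by (auto intro!: grid_T[unfolded atLeastAtMost_iff])
    then show "norm (V (grid T n p) (t - s) x - x) \<le> K * (t - s) * \<nu> 0 1 x"
      using t assms by (intro V_lipschitz) auto
  next
    fix q t assume q: "p \<le> q" "Suc q < n" "s \<le> grid T n (Suc q)" "grid T n (Suc q) \<le> t" "t \<le> grid T n (Suc (Suc q))"
    let ?r = "grid T n (Suc q)"
    let ?y = "U n ?r s x"
    assume IH: "norm (?y - x) \<le> K * (?r - s) * \<nu> 0 1 x"
    have r: "?r \<in> {0..T}" "grid T n (Suc (Suc q)) \<in> {0..T}" using q by (auto intro!: grid_T[unfolded atLeastAtMost_iff])
    have y: "?y \<in> opdom A" "\<nu> ?r 1 ?y \<le> M * \<nu> 0 1 x"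
      using U_opdom[of n s ?r x] U_\<nu>1[of n s ?r x ?r] assms q r by auto
    have "norm (V ?r (t - ?r) ?y - x) \<le> norm (V ?r (t - ?r) ?y - ?y) + norm (?y - x)"
      using norm_triangle_ineq[of "V ?r (t - ?r) ?y - ?y" "?y - x"] by simp
    also have "\<dots> \<le> E * (\<mu> + 1) * (t - ?r) * \<nu> ?r 1 ?y + K * (?r - s) * \<nu> 0 1 x"
      using q r y IH by (intro add_mono V_minus_id) auto
    also have "\<dots> \<le> E * (\<mu> + 1) * (t - ?r) * (M * \<nu> 0 1 x) + K * (?r - s) * \<nu> 0 1 x"
      using y q E_ge_1 mu0 by (intro add_right_mono mult_left_mono) auto
    also have "\<dots> = K * (t - s) * \<nu> 0 1 x" by (simp add: K_def algebra_simps)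
    finally show "norm ((V ?r (t - ?r) \<circ> U n ?r s) x - x) \<le> K * (t - s) * \<nu> 0 1 x" by simp
  qed
qed

text \<open>
  \<open>U n t s\<close> commutes with \<open>S\<close> inside every grid cell, and at each of the grid points in between
  \<open>S\<close> jumps by \<open>O(1 / n)\<close>; hence the commutator is of the order of \<open>t - s\<close>.
\<close>

lemma U_S_grid:
  assumes n: "1 \<le> n" and pq: "p \<le> q" "q < n" "grid T n p \<le> s" "s \<le> grid T n (Suc p)" "s \<le> t" "grid T n q \<le> t" "t \<le> grid T n (Suc q)"
    and x: "x \<in> opdom A"
  shows "norm (S (grid T n q) (U n t s x) - U n t s (S (grid T n p) x))
    \<le> real (q - p) * exp (\<Omega> * (t - s)) * (c * (T / n) * (M * \<nu> 0 1 x))"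
proof (rule U_induct[OF n pq, of "\<lambda>q t F. norm (S (grid T n q) (F x) - F (S (grid T n p) x))
    \<le> real (q - p) * exp (\<Omega> * (t - s)) * (c * (T / n) * (M * \<nu> 0 1 x))"])
  fix t assume "s \<le> t" "t \<le> grid T n (Suc p)"
  then show "norm (S (grid T n p) (V (grid T n p) (t - s) x) - V (grid T n p) (t - s) (S (grid T n p) x))
    \<le> real (p - p) * exp (\<Omega> * (t - s)) * (c * (T / n) * (M * \<nu> 0 1 x))"
    using V_S(2)[OF grid_T _ x, of p n "t - s"] pq by simp
next
  fix q t assume q: "p \<le> q" "Suc q < n" "s \<le> grid T n (Suc q)" "grid T n (Suc q) \<le> t"
  let ?r = "grid T n (Suc q)"
  let ?y = "U n ?r s x"
  let ?z = "U n ?r s (S (grid T n p) x)"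
  let ?j = "c * (T / n) * (M * \<nu> 0 1 x)"
  assume IH: "norm (S (grid T n q) ?y - ?z) \<le> real (q - p) * exp (\<Omega> * (?r - s)) * ?j"
  have r: "?r \<in> {0..T}" "grid T n q \<in> {0..T}" "0 \<le> s"
    using q pq grid_T[of p n] grid_T[of q n] grid_T[of "Suc q" n] by auto
  have y: "?y \<in> opdom A" "\<nu> (grid T n q) 1 ?y \<le> M * \<nu> 0 1 x"
    using U_opdom[of n s ?r x] U_\<nu>1[of n s ?r x "grid T n q"] n x q r by auto
  have j: "0 \<le> ?j" using c_nonneg T0 M_ge by simp
  have e: "1 \<le> exp (\<Omega> * (?r - s))" using q by (simp add: \<Omega>_def)
  have "norm (S ?r ?y - ?z) \<le> norm (S ?r ?y - S (grid T n q) ?y) + norm (S (grid T n q) ?y - ?z)"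
    by (rule norm_diff_triangle)
  also have "\<dots> \<le> ?j + real (q - p) * exp (\<Omega> * (?r - s)) * ?j"
  proof (intro add_mono IH)
    have "norm (S (grid T n q) ?y - S ?r ?y) \<le> c * \<bar>grid T n q - ?r\<bar> * \<nu> (grid T n q) 1 ?y"
      by (rule S_lip[OF r(2,1) y(1)])
    also have "\<dots> \<le> c * (T / n) * (M * \<nu> 0 1 x)"
      using y T0 c_nonneg by (intro mult_mono) (auto simp: grid_Suc)
    finally show "norm (S ?r ?y - S (grid T n q) ?y) \<le> ?j" by (simp add: norm_minus_commute)
  qed
  also have "\<dots> \<le> exp (\<Omega> * (?r - s)) * ?j + real (q - p) * exp (\<Omega> * (?r - s)) * ?j"
    using mult_right_mono[OF e j] by simp
  also have "\<dots> = real (Suc q - p) * exp (\<Omega> * (?r - s)) * ?j"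
    using q by (simp add: Suc_diff_le algebra_simps)
  finally have *: "norm (S ?r ?y - ?z) \<le> real (Suc q - p) * exp (\<Omega> * (?r - s)) * ?j" .
  have "S ?r (V ?r (t - ?r) ?y) - V ?r (t - ?r) ?z = V ?r (t - ?r) (S ?r ?y - ?z)"
    using V_S(2)[OF r(1) _ y(1)] V_diff[OF r(1)] q by simp
  then have "norm (S ?r (V ?r (t - ?r) ?y) - V ?r (t - ?r) ?z) \<le> exp (\<Omega> * (t - ?r)) * norm (S ?r ?y - ?z)"
    using V_bound[OF r(1)] q by simp
  also have "\<dots> \<le> exp (\<Omega> * (t - ?r)) * (real (Suc q - p) * exp (\<Omega> * (?r - s)) * ?j)"
    using * by (intro mult_left_mono) auto
  also have "\<dots> = real (Suc q - p) * (exp (\<Omega> * (t - ?r)) * exp (\<Omega> * (?r - s))) * ?j" by (simp add: mult_ac)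
  also have "exp (\<Omega> * (t - ?r)) * exp (\<Omega> * (?r - s)) = exp (\<Omega> * (t - s))" by (rule exp_\<Omega>_mult)
  finally show "norm (S ?r ((V ?r (t - ?r) \<circ> U n ?r s) x) - (V ?r (t - ?r) \<circ> U n ?r s) (S (grid T n p) x))
    \<le> real (Suc q - p) * exp (\<Omega> * (t - s)) * ?j" by simp
qed

text \<open>Three errors, each at most \<open>E * c * M * (t - s + T / n) * \<nu> 0 1 x\<close>:
  rounding \<open>t\<close> to its grid point, the commutator on the grid, and rounding
  \<open>s\<close>. The mesh size disappears in the limit and leaves a multiple of
  \<open>t - s\<close>.\<close>

lemma U_S:
  assumes "1 \<le> n" "0 \<le> s" "s \<le> t" "t \<le> T" "x \<in> opdom A"
  shows "norm (S t (U n t s x) - U n t s (S s x)) \<le> 3 * E * c * M * (t - s + T / n) * \<nu> 0 1 x"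
proof -
  obtain p q where pq: "p \<le> q" "q < n" "grid T n p \<le> s" "s \<le> grid T n (Suc p)" "grid T n q \<le> t" "t \<le> grid T n (Suc q)"
    using grid_cells[OF T0 assms(1-4)] by blast
  define w where "w = c * (M * \<nu> 0 1 x)"
  have w: "0 \<le> w" using c_nonneg M_ge by (simp add: w_def)
  have mem: "grid T n p \<in> {0..T}" "grid T n q \<in> {0..T}" "t \<in> {0..T}" "s \<in> {0..T}"
    using pq assms grid_T[of p n] grid_T[of q n] by auto
  let ?y = "U n t s x"
  have y: "?y \<in> opdom A" using U_opdom assms by blast
  have 1: "norm (S t ?y - S (grid T n q) ?y) \<le> w * (T / n)"
  proof -
    have "norm (S t ?y - S (grid T n q) ?y) \<le> c * \<bar>t - grid T n q\<bar> * \<nu> t 1 ?y" by (rule S_lip[OF mem(3,2) y])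
    also have "\<dots> \<le> c * (T / n) * (M * \<nu> 0 1 x)"
      using U_\<nu>1[OF assms mem(3)] pq c_nonneg T0 by (intro mult_mono) (auto simp: grid_Suc)
    finally show ?thesis by (simp add: w_def mult_ac)
  qed
  have 2: "norm (S (grid T n q) ?y - U n t s (S (grid T n p) x)) \<le> E * w * (t - s + T / n)"
  proof -
    have "norm (S (grid T n q) ?y - U n t s (S (grid T n p) x)) \<le> real (q - p) * exp (\<Omega> * (t - s)) * (c * (T / n) * (M * \<nu> 0 1 x))"
      by (rule U_S_grid[OF assms(1) pq(1-4) assms(3) pq(5,6) assms(5)])
    also have "\<dots> = exp (\<Omega> * (t - s)) * w * (real (q - p) * (T / n))" by (simp add: w_def mult_ac)
    also have "real (q - p) * (T / n) = grid T n q - grid T n p" using grid_diff[OF pq(1)] by simp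
    also have "exp (\<Omega> * (t - s)) * w * (grid T n q - grid T n p) \<le> E * w * (t - s + T / n)"
      using pq w assms mono_grid[of T n] T0 E_ge_1 by (intro mult_mono exp_le_E) (auto simp: grid_Suc mono_def)
    finally show ?thesis .
  qed
  have 3: "norm (U n t s (S (grid T n p) x) - U n t s (S s x)) \<le> E * w * (T / n)"
  proof -
    have "norm (U n t s (S (grid T n p) x) - U n t s (S s x)) = norm (U n t s (S s x - S (grid T n p) x))"
      using assms by (simp add: U_diff norm_minus_commute)
    also have "\<dots> \<le> E * norm (S s x - S (grid T n p) x)" using assms by (intro U_norm) auto
    also have "\<dots> \<le> E * (c * \<bar>s - grid T n p\<bar> * \<nu> s 1 x)" using E_ge_1 by (intro mult_left_mono S_lip mem assms) auto
    also have "\<dots> \<le> E * (c * (T / n) * (M * \<nu> 0 1 x))"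
    proof (intro mult_left_mono mult_mono)
      have "\<nu> s 1 x \<le> (1 + c * T) * \<nu> 0 1 x" using \<nu>_change_T[OF zero_mem mem(4) m1, of x] assms(5) by (simp add: dom_pow_1)
      also have "\<dots> \<le> M * \<nu> 0 1 x" by (intro mult_right_mono M_ge) simp
      finally show "\<nu> s 1 x \<le> M * \<nu> 0 1 x" .
    qed (use pq c_nonneg T0 E_ge_1 in \<open>auto simp: grid_Suc\<close>)
    finally show ?thesis by (simp add: w_def mult_ac)
  qed
  have "norm (S t ?y - U n t s (S s x)) \<le> norm (S t ?y - S (grid T n q) ?y)
      + norm (S (grid T n q) ?y - U n t s (S (grid T n p) x)) + norm (U n t s (S (grid T n p) x) - U n t s (S s x))"
    using norm_diff_triangle[of "S t ?y" "U n t s (S s x)" "U n t s (S (grid T n p) x)"]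
      norm_diff_triangle[of "S t ?y" "U n t s (S (grid T n p) x)" "S (grid T n q) ?y"] by linarith
  also have "\<dots> \<le> w * (T / n) + E * w * (t - s + T / n) + E * w * (T / n)" using 1 2 3 by simp
  also have "\<dots> \<le> E * w * (t - s + T / n) + E * w * (t - s + T / n) + E * w * (t - s + T / n)"
    using E_ge_1 w T0 assms mult_right_mono[of 1 E w] by (intro add_mono mult_mono) auto
  also have "\<dots> = 3 * E * c * M * (t - s + T / n) * \<nu> 0 1 x" by (simp add: w_def)
  finally show ?thesis .
qed

end

section \<open>Convergence of the approximations\<close>

lemma continuous_on_forward_lipschitz:
  fixes f :: "real \<Rightarrow> 'a::real_normed_vector"
  assumes "0 \<le> C" "\<And>r q. a \<le> r \<Longrightarrow> r \<le> q \<Longrightarrow> q \<le> b \<Longrightarrow> norm (f q - f r) \<le> C * (q - r)"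
  shows "continuous_on {a..b} f"
proof (rule lipschitz_on_continuous_on[of C])
  show "C-lipschitz_on {a..b} f"
  proof (rule lipschitz_onI)
    fix x y assume "x \<in> {a..b}" "y \<in> {a..b}"
    then show "dist (f x) (f y) \<le> C * dist x y"
      using assms(2)[of x y] assms(2)[of y x] by (cases "x \<le> y") (auto simp: dist_norm norm_minus_commute)
  qed fact
qed

section \<open>Comparison of two propagators\<close>

context perturbed_family
begin

text \<open>Collects what the approximations and a single frozen semigroup have in common, so that
  one comparison yields both the Cauchy property and the local error. \<open>g r\<close> is the time
  whose generator drives \<open>P\<close> just after \<open>r\<close>.\<close>

definition propagator :: "(real \<Rightarrow> real \<Rightarrow> 'a \<Rightarrow> 'a) \<Rightarrow> (real \<Rightarrow> real) \<Rightarrow> real \<Rightarrow> real \<Rightarrow> bool" where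
  "propagator P g s0 t0 \<longleftrightarrow>
    (\<forall>s t. s0 \<le> s \<and> s \<le> t \<and> t \<le> t0 \<longrightarrow>
      (\<forall>x y. P t s (x - y) = P t s x - P t s y) \<and> (\<forall>x. norm (P t s x) \<le> E * norm x) \<and>
      (\<forall>x\<in>opdom A. P t s x \<in> opdom A \<and> \<nu> 0 1 (P t s x) \<le> M * \<nu> 0 1 x \<and> norm (P t s x - x) \<le> K * (t - s) * \<nu> 0 1 x) \<and>
      (\<forall>r. s \<le> r \<and> r \<le> t \<longrightarrow> P t r \<circ> P r s = P t s) \<and> P s s = id) \<and>
    (\<forall>r. s0 \<le> r \<and> r < t0 \<longrightarrow> g r \<in> {0..T} \<and> eventually (\<lambda>h. P (r + h) r = V (g r) h) (at_right 0))"

lemma propagatorD: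
  assumes "propagator P g s0 t0" "s0 \<le> s" "s \<le> t" "t \<le> t0"
  shows "P t s (x - y) = P t s x - P t s y" "norm (P t s x) \<le> E * norm x"
    "x \<in> opdom A \<Longrightarrow> P t s x \<in> opdom A" "x \<in> opdom A \<Longrightarrow> \<nu> 0 1 (P t s x) \<le> M * \<nu> 0 1 x"
    "x \<in> opdom A \<Longrightarrow> norm (P t s x - x) \<le> K * (t - s) * \<nu> 0 1 x"
    "s \<le> r \<Longrightarrow> r \<le> t \<Longrightarrow> P t r (P r s x) = P t s x" "P s s x = x"
  using assms unfolding propagator_def by (auto simp: fun_eq_iff)

definition K3 :: real where "K3 = E * c * (1 + c * T) * M"

lemma K3_nonneg: "0 \<le> K3"
  using E_ge_1 c_nonneg T0 M_ge by (simp add: K3_def)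

text \<open>The curve \<open>f\<close> joins \<open>P t0 s0 x\<close> to \<open>Q t0 s0 x\<close>.
  Its increment over [r, r + h] is \<open>P t0 (r + h)\<close> applied to the difference of two
  short semigroup steps from the same vector, which up to o(h) is \<open>h\<close> times the
  difference of the generators at \<open>g' r\<close> and \<open>g r\<close>. The Lipschitz
  condition bounds that difference by a multiple of \<open>\<delta>\<close>.\<close>

lemma propagator_compare:
  assumes P: "propagator P g s0 t0" and Q: "propagator Q g' s0 t0" and st: "s0 \<le> t0"
    and x: "x \<in> opdom A" and \<delta>: "0 \<le> \<delta>" "\<And>r. s0 \<le> r \<Longrightarrow> r < t0 \<Longrightarrow> \<bar>g r - g' r\<bar> \<le> \<delta>"
  shows "norm (P t0 s0 x - Q t0 s0 x) \<le> K3 * \<delta> * (t0 - s0) * \<nu> 0 1 x"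
proof -
  define f where "f = (\<lambda>r. P t0 r (Q r s0 x))"
  \<comment> \<open>Bounds the difference of the generators along \<open>Q r s0 x\<close>:
    \<open>1 + c * T\<close> moves the norm from time \<open>g r\<close> to 0, and \<open>M\<close>
    is the stability of \<open>Q\<close>.\<close>
  define C0 where "C0 = c * \<delta> * ((1 + c * T) * (M * \<nu> 0 1 x))"
  note PD = propagatorD[OF P] and QD = propagatorD[OF Q]
  have E0: "0 < E" using E_ge_1 by simp
  have y: "Q r s0 x \<in> opdom A" "\<nu> 0 1 (Q r s0 x) \<le> M * \<nu> 0 1 x" if "s0 \<le> r" "r \<le> t0" for r
    using QD(3,4)[of s0 r x] that x by auto
  have "norm (f t0 - f s0) \<le> (E * C0) * (t0 - s0)"
  proof (rule right_difference_bound[OF st])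
    show "continuous_on {s0..t0} f"
    proof (rule continuous_on_forward_lipschitz)
      show "0 \<le> E * (2 * K * (M * \<nu> 0 1 x))" using E_ge_1 K_nonneg M_ge by simp
      fix r q assume rq: "s0 \<le> r" "r \<le> q" "q \<le> t0"
      let ?y = "Q r s0 x"
      have "f q - f r = P t0 q (Q q r ?y) - P t0 q (P q r ?y)"
        using rq QD(6)[of s0 q r x] PD(6)[of r t0 q] by (simp add: f_def)
      also have "\<dots> = P t0 q (Q q r ?y - P q r ?y)" using PD(1)[of q t0] rq by simp
      also have "norm \<dots> \<le> E * norm (Q q r ?y - P q r ?y)" using PD(2)[of q t0] rq by simp
      also have "\<dots> \<le> E * (norm (Q q r ?y - ?y) + norm (P q r ?y - ?y))"
        using E0 norm_diff_triangle[of "Q q r ?y" "P q r ?y" ?y] by (simp add: norm_minus_commute)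
      also have "\<dots> \<le> E * (K * (q - r) * \<nu> 0 1 ?y + K * (q - r) * \<nu> 0 1 ?y)"
        using E0 rq y[of r] by (intro mult_left_mono add_mono PD(5) QD(5)) auto
      also have "\<dots> \<le> E * (K * (q - r) * (M * \<nu> 0 1 x) + K * (q - r) * (M * \<nu> 0 1 x))"
        using E0 K_nonneg rq y[of r] by (intro mult_left_mono add_mono) auto
      finally show "norm (f q - f r) \<le> E * (2 * K * (M * \<nu> 0 1 x)) * (q - r)" by (simp add: mult_ac)
    qed
    fix r e :: real assume r: "s0 \<le> r" "r < t0" and e: "0 < e"
    let ?y = "Q r s0 x"
    have gr: "g r \<in> {0..T}" "g' r \<in> {0..T}" using P Q r unfolding propagator_def by auto
    have yr: "?y \<in> opdom A" "\<nu> 0 1 ?y \<le> M * \<nu> 0 1 x" using y r by auto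
    have lim: "((\<lambda>h. norm ((V (g' r) h ?y - ?y) /\<^sub>R h - (V (g r) h ?y - ?y) /\<^sub>R h)) \<longlongrightarrow> norm (app (G (g' r)) ?y - app (G (g r)) ?y)) (at_right 0)"
      by (intro tendsto_norm tendsto_diff qc_generator.gen_limit[OF qcg] gr) (simp_all add: opdom_G yr)
    have "norm (app (G (g' r)) ?y - app (G (g r)) ?y) = norm (S (g r) ?y - S (g' r) ?y)"
      using gr by (simp add: app_G)
    also have "\<dots> \<le> c * \<bar>g r - g' r\<bar> * \<nu> (g r) 1 ?y" by (rule S_lip[OF gr yr(1)])
    also have "\<dots> \<le> c * \<delta> * ((1 + c * T) * \<nu> 0 1 ?y)"
      using \<nu>_change_T[OF zero_mem gr(1) m1, of ?y] yr \<delta>(1) \<delta>(2)[OF r] c_nonneg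
      by (intro mult_mono) (auto simp: dom_pow_1)
    also have "\<dots> \<le> C0" unfolding C0_def using yr \<delta>(1) c_nonneg T0 by (intro mult_left_mono) auto
    also have "C0 < C0 + e / E" using e E0 by simp
    finally have "eventually (\<lambda>h. norm ((V (g' r) h ?y - ?y) /\<^sub>R h - (V (g r) h ?y - ?y) /\<^sub>R h) < C0 + e / E) (at_right 0)"
      by (rule order_tendstoD(2)[OF lim])
    moreover have "eventually (\<lambda>h. P (r + h) r = V (g r) h) (at_right 0)" "eventually (\<lambda>h. Q (r + h) r = V (g' r) h) (at_right 0)"
      using P Q r unfolding propagator_def by auto
    moreover have "eventually (\<lambda>h. h \<in> {0<..<t0 - r}) (at_right 0)" using r by (intro eventually_at_right_real) auto
    ultimately show "eventually (\<lambda>h. norm (f (r + h) - f r) \<le> (E * C0 + e) * h) (at_right 0)"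
    proof eventually_elim
      case (elim h)
      then have h: "0 < h" "r + h \<le> t0" by auto
      have "f (r + h) - f r = P t0 (r + h) (Q (r + h) r ?y) - P t0 (r + h) (P (r + h) r ?y)"
        using r h QD(6)[of s0 "r + h" r x] PD(6)[of r t0 "r + h"] by (simp add: f_def)
      also have "\<dots> = P t0 (r + h) (V (g' r) h ?y - V (g r) h ?y)" using PD(1)[of "r + h" t0] r h elim by simp
      also have "V (g' r) h ?y - V (g r) h ?y = h *\<^sub>R ((V (g' r) h ?y - ?y) /\<^sub>R h - (V (g r) h ?y - ?y) /\<^sub>R h)"
        using h by (simp add: algebra_simps)
      also have "norm (P t0 (r + h) \<dots>) \<le> E * norm (h *\<^sub>R ((V (g' r) h ?y - ?y) /\<^sub>R h - (V (g r) h ?y - ?y) /\<^sub>R h))"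
        by (rule PD(2)) (use r h in auto)
      also have "\<dots> = E * (h * norm ((V (g' r) h ?y - ?y) /\<^sub>R h - (V (g r) h ?y - ?y) /\<^sub>R h))" using h by simp
      also have "\<dots> \<le> E * (h * (C0 + e / E))" using less_imp_le[OF elim(1)] h E0 by (intro mult_left_mono) auto
      also have "\<dots> = (E * C0 + e) * h" using E0 by (simp add: field_simps)
      finally show ?case .
    qed
  qed
  moreover have "f t0 = Q t0 s0 x" "f s0 = P t0 s0 x" using PD(7)[of t0 t0] QD(7)[of s0 s0] st by (auto simp: f_def)
  ultimately show ?thesis by (simp add: C0_def K3_def norm_minus_commute mult_ac)
qed

text \<open>The cells are half-open: just after \<open>r\<close> the approximation follows the
  semigroup of this cell, also when \<open>r\<close> is a grid point.\<close>

definition cell :: "nat \<Rightarrow> real \<Rightarrow> real" where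
  "cell n r = grid T n (SOME i. i < n \<and> grid T n i \<le> r \<and> r < grid T n (Suc i))"

lemma cell:
  assumes "1 \<le> n" "0 \<le> r" "r < T"
  obtains i where "i < n" "cell n r = grid T n i" "grid T n i \<le> r" "r < grid T n (Suc i)"
  using someI_ex[OF grid_cell_less[OF T0 assms]] that unfolding cell_def by blast

lemma cell_dist:
  assumes "1 \<le> n" "0 \<le> r" "r < T"
  shows "\<bar>cell n r - r\<bar> \<le> T / n"
  using cell[OF assms] by (smt (verit) grid_Suc)

lemma propagator_U:
  assumes n: "1 \<le> n" and st: "0 \<le> s0" "t0 \<le> T"
  shows "propagator (U n) (cell n) s0 t0"
  unfolding propagator_def
proof (intro conjI allI impI ballI; (elim conjE)?)
  fix s t assume *: "s0 \<le> s" "s \<le> t" "t \<le> t0"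
  have st': "0 \<le> s" "s \<le> t" "t \<le> T" using * st by auto
  show "U n t s (x - y) = U n t s x - U n t s y" for x y by (rule U_diff[OF n st'])
  show "norm (U n t s x) \<le> E * norm x" for x by (rule U_norm[OF n st'])
  show "U n t s x \<in> opdom A" if "x \<in> opdom A" for x by (rule U_opdom[OF n st' that])
  show "\<nu> 0 1 (U n t s x) \<le> M * \<nu> 0 1 x" if "x \<in> opdom A" for x by (rule U_\<nu>1[OF n st' that zero_mem])
  show "norm (U n t s x - x) \<le> K * (t - s) * \<nu> 0 1 x" if "x \<in> opdom A" for x by (rule U_lipschitz[OF n st' that])
  show "U n t r \<circ> U n r s = U n t s" if "s \<le> r" "r \<le> t" for r by (rule U_cocycle[OF n st'(1) that st'(3)])
  show "U n s s = id" using U_refl[OF n] st' by simp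
next
  fix r assume r: "s0 \<le> r" "r < t0"
  obtain i where i: "i < n" "cell n r = grid T n i" "grid T n i \<le> r" "r < grid T n (Suc i)"
    using cell[OF n, of r] r st by auto
  show "cell n r \<in> {0..T}" using grid_T[of i n] i by simp
  have "eventually (\<lambda>h. h \<in> {0<..<grid T n (Suc i) - r}) (at_right 0)"
    using i by (intro eventually_at_right_real) auto
  then show "eventually (\<lambda>h. U n (r + h) r = V (cell n r) h) (at_right 0)"
    by eventually_elim (use i U_single[OF i(1), of r] in auto)
qed

lemma propagator_V:
  assumes t: "t \<in> {0..T}" and st: "0 \<le> s0" "t0 \<le> T"
  shows "propagator (\<lambda>q p. V t (q - p)) (\<lambda>_. t) s0 t0"
  unfolding propagator_def
proof (intro conjI allI impI ballI; (elim conjE)?)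
  fix p q assume *: "s0 \<le> p" "p \<le> q" "q \<le> t0"
  have h: "0 \<le> q - p" "q - p \<le> T" using * st by auto
  show "V t (q - p) (x - y) = V t (q - p) x - V t (q - p) y" for x y by (rule V_diff[OF t h(1)])
  show "norm (V t (q - p) x) \<le> E * norm x" for x
    by (rule order_trans[OF V_bound[OF t h(1)] mult_right_mono[OF exp_le_E[OF h(2)]]]) simp
  show V: "V t (q - p) x \<in> opdom A" if "x \<in> opdom A" for x by (rule V_S(1)[OF t h(1) that])
  show "\<nu> 0 1 (V t (q - p) x) \<le> M * \<nu> 0 1 x" if x: "x \<in> opdom A" for x
  proof -
    have cT: "0 \<le> 1 + c * T" using c_nonneg T0 by simp
    have "\<nu> 0 1 (V t (q - p) x) \<le> (1 + c * T) * \<nu> t 1 (V t (q - p) x)"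
      using \<nu>_change_T[OF t zero_mem m1, of "V t (q - p) x"] V[OF x] by (simp add: dom_pow_1)
    also have "\<dots> \<le> (1 + c * T) * (exp (\<Omega> * (q - p)) * \<nu> t 1 x)"
      using V_\<nu>(2)[OF t h(1) m1, of x] x cT by (intro mult_left_mono) (auto simp: dom_pow_1)
    also have "\<dots> \<le> (1 + c * T) * (E * exp (c * T) * ((1 + c * T) * \<nu> 0 1 x))"
    proof (intro mult_left_mono mult_mono)
      have "exp (\<Omega> * (q - p)) \<le> E * 1" using exp_le_E[OF h(2)] by simp
      also have "\<dots> \<le> E * exp (c * T)" using E_ge_1 c_nonneg T0 by (intro mult_left_mono) auto
      finally show "exp (\<Omega> * (q - p)) \<le> E * exp (c * T)" .
      show "\<nu> t 1 x \<le> (1 + c * T) * \<nu> 0 1 x" using \<nu>_change_T[OF zero_mem t m1, of x] x by (simp add: dom_pow_1)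
    qed (use cT E_ge_1 in auto)
    finally show ?thesis by (simp add: M_def mult_ac)
  qed
  show "norm (V t (q - p) x - x) \<le> K * (q - p) * \<nu> 0 1 x" if "x \<in> opdom A" for x by (rule V_lipschitz[OF t h that])
  show "V t (q - r) \<circ> V t (r - p) = V t (q - p)" if "p \<le> r" "r \<le> q" for r
    using V_add[OF t, of "q - r" "r - p"] that by simp
  show "V t (p - p) = id" using V_0[OF t] by simp
qed (use t in auto)

lemma U_cauchy:
  assumes n: "1 \<le> n" "1 \<le> l" and st: "0 \<le> s" "s \<le> t" "t \<le> T" and x: "x \<in> opdom A"
  shows "norm (U n t s x - U l t s x) \<le> K3 * (T / n + T / l) * (t - s) * \<nu> 0 1 x"
proof (rule propagator_compare[OF propagator_U[OF n(1) st(1,3)] propagator_U[OF n(2) st(1,3)] st(2) x])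
  show "0 \<le> T / n + T / l" using T0 by simp
  fix r assume "s \<le> r" "r < t"
  then have "0 \<le> r" "r < T" using st by auto
  then show "\<bar>cell n r - cell l r\<bar> \<le> T / n + T / l" using cell_dist[OF n(1), of r] cell_dist[OF n(2), of r] by linarith
qed

lemma U_V:
  assumes n: "1 \<le> n" and st: "0 \<le> s" "s \<le> t" "t \<le> T" and x: "x \<in> opdom A" and p: "p \<in> {s..t}"
  shows "norm (U n t s x - V p (t - s) x) \<le> K3 * (T / n + (t - s)) * (t - s) * \<nu> 0 1 x"
proof (rule propagator_compare[OF propagator_U[OF n(1) st(1,3)] propagator_V[OF _ st(1,3)] st(2) x])
  show "0 \<le> T / n + (t - s)" using T0 st by simp
  show "p \<in> {0..T}" using p st by auto
  fix r assume r: "s \<le> r" "r < t"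
  then have "0 \<le> r" "r < T" using st by auto
  then show "\<bar>cell n r - p\<bar> \<le> T / n + (t - s)" using cell_dist[OF n(1), of r] p r by auto
qed

section \<open>The strong limit\<close>

definition W :: "real \<Rightarrow> real \<Rightarrow> 'a \<Rightarrow> 'a" where
  "W t s x = lim (\<lambda>n. U n t s x)"

text \<open>For \<open>n = 0\<close> division by zero collapses the grid, so the estimates of
  \<open>U n\<close> start at 1.\<close>

lemma eventually_ge_1: "eventually (\<lambda>n. 1 \<le> (n::nat)) sequentially"
  by (rule eventually_ge_at_top)

lemma dense_approx:
  obtains y where "\<And>n. y n \<in> opdom A" "y \<longlonglongrightarrow> x"
proof -
  have "x \<in> closure (opdom A)" using dense by (simp add: densely_defined_def)
  then show ?thesis using that unfolding closure_sequential by blast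
qed

lemma U_convergent:
  assumes st: "0 \<le> s" "s \<le> t" "t \<le> T"
  shows "(\<lambda>n. U n t s x) \<longlonglongrightarrow> W t s x"
proof -
  have "Cauchy (\<lambda>n. U n t s x)"
  proof (rule CauchyI)
    fix e :: real assume e: "0 < e"
    obtain y where y: "\<And>n. y n \<in> opdom A" "y \<longlonglongrightarrow> x" using dense_approx by blast
    have E0: "0 < E" using E_ge_1 by simp
    obtain j where j: "norm (y j - x) < e / (4 * E)"
      using LIMSEQ_D[OF y(2), of "e / (4 * E)"] e E0 by auto
    \<comment> \<open>Four quarters of \<open>e\<close>: two from replacing \<open>x\<close> by
      \<open>y j\<close> in both approximations, two from \<open>F / n\<close> and
      \<open>F / l\<close>.\<close>
    define F where "F = K3 * T * (t - s) * \<nu> 0 1 (y j)"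
    have F0: "0 \<le> F" using K3_nonneg T0 st by (simp add: F_def)
    obtain N where "max 1 (4 * F / e) < real N" using reals_Archimedean2 by blast
    then have N: "1 \<le> N" "4 * F / e < real N" by auto
    have "norm (U n t s x - U l t s x) < e" if "N \<le> n" "N \<le> l" for n l
    proof -
      have nl: "1 \<le> n" "1 \<le> l" using that N by auto
      have 1: "norm (U i t s x - U i t s (y j)) \<le> e / 4" if "1 \<le> i" for i
      proof -
        have "norm (U i t s x - U i t s (y j)) \<le> E * norm (x - y j)"
          using U_norm[OF that st, of "x - y j"] U_diff[OF that st] by simp
        also have "\<dots> \<le> E * (e / (4 * E))" using j E0 by (intro mult_left_mono) (auto simp: norm_minus_commute)
        finally show ?thesis using E0 by simp
      qed
      have F4: "F / i < e / 4" if "N \<le> i" for i :: nat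
      proof -
        have "4 * F / e < real i" using N that by (meson less_le_trans of_nat_le_iff)
        moreover have "0 < real i" using that N by simp
        ultimately show ?thesis using e by (simp add: field_simps)
      qed
      have "norm (U n t s (y j) - U l t s (y j)) \<le> K3 * (T / n + T / l) * (t - s) * \<nu> 0 1 (y j)"
        by (rule U_cauchy[OF nl st y(1)])
      also have "\<dots> = F / n + F / l" by (simp add: F_def distrib_left distrib_right)
      finally have 2: "norm (U n t s (y j) - U l t s (y j)) < e / 4 + e / 4" using F4[OF that(1)] F4[OF that(2)] by linarith
      show ?thesis
        using 1[OF nl(1)] 1[OF nl(2)] 2 norm_diff_triangle[of "U n t s x" "U l t s x" "U n t s (y j)"]
          norm_diff_triangle[of "U n t s (y j)" "U l t s x" "U l t s (y j)"]
          norm_minus_commute[of "U l t s x" "U l t s (y j)"] by linarith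
    qed
    then show "\<exists>N. \<forall>m\<ge>N. \<forall>n\<ge>N. norm (U m t s x - U n t s x) < e" by blast
  qed
  then show ?thesis unfolding W_def using Cauchy_convergent_iff convergent_LIMSEQ_iff by blast
qed

lemma W_tendsto_bound:
  assumes st: "0 \<le> s" "s \<le> t" "t \<le> T" and le: "\<And>n. 1 \<le> n \<Longrightarrow> norm (U n t s x - z) \<le> f n" and f: "f \<longlonglongrightarrow> C"
  shows "norm (W t s x - z) \<le> C"
proof (rule tendsto_le[OF _ f])
  show "(\<lambda>n. norm (U n t s x - z)) \<longlonglongrightarrow> norm (W t s x - z)"
    by (intro tendsto_intros U_convergent st)
  show "eventually (\<lambda>n. norm (U n t s x - z) \<le> f n) sequentially"
    using eventually_ge_1 by eventually_elim (rule le)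
qed simp

lemma T_over_n: "(\<lambda>n. T / real n) \<longlonglongrightarrow> 0"
  by (rule lim_const_over_n)

lemma W_norm:
  assumes st: "0 \<le> s" "s \<le> t" "t \<le> T"
  shows "norm (W t s x) \<le> E * norm x"
  using W_tendsto_bound[OF st, of x 0 "\<lambda>_. E * norm x"] U_norm st by simp

lemma W_lipschitz:
  assumes st: "0 \<le> s" "s \<le> t" "t \<le> T" and x: "x \<in> opdom A"
  shows "norm (W t s x - x) \<le> K * (t - s) * \<nu> 0 1 x"
  by (rule W_tendsto_bound[OF st U_lipschitz[OF _ st x]]) auto

lemma W_V:
  assumes st: "0 \<le> s" "s \<le> t" "t \<le> T" and x: "x \<in> opdom A" and p: "p \<in> {s..t}"
  shows "norm (W t s x - V p (t - s) x) \<le> K3 * (t - s) * (t - s) * \<nu> 0 1 x"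
proof (rule W_tendsto_bound[OF st U_V[OF _ st x p]])
  have "(\<lambda>n. K3 * (T / real n + (t - s)) * (t - s) * \<nu> 0 1 x) \<longlonglongrightarrow> K3 * (0 + (t - s)) * (t - s) * \<nu> 0 1 x"
    by (intro tendsto_intros T_over_n)
  then show "(\<lambda>n. K3 * (T / real n + (t - s)) * (t - s) * \<nu> 0 1 x) \<longlonglongrightarrow> K3 * (t - s) * (t - s) * \<nu> 0 1 x" by simp
qed auto

lemma bounded_linear_scaleC: "bounded_linear (\<lambda>x :: 'a. z *\<^sub>C x)"
  by (rule bounded_linear_intro[of _ "cmod z"])
    (auto simp: scaleC_add_right norm_scaleC scaleR_scaleC scaleC_scaleC mult.commute)

lemma W_clinear:
  assumes st: "0 \<le> s" "s \<le> t" "t \<le> T"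
  shows "bounded_clinear (W t s)"
proof -
  have Ub: "bounded_clinear (U n t s)" if "1 \<le> n" for n using U_bounded[OF that st] by blast
  have add: "W t s (x + y) = W t s x + W t s y" for x y
  proof (rule LIMSEQ_unique[OF U_convergent[OF st]])
    have ev: "eventually (\<lambda>n. U n t s x + U n t s y = U n t s (x + y)) sequentially"
      using eventually_ge_1 by eventually_elim (use Ub in \<open>simp add: bounded_clinear_def linear_add bounded_linear.linear\<close>)
    show "(\<lambda>n. U n t s (x + y)) \<longlonglongrightarrow> W t s x + W t s y"
      by (rule Lim_transform_eventually[OF tendsto_add[OF U_convergent[OF st] U_convergent[OF st]] ev])
  qed
  have scale: "W t s (z *\<^sub>C x) = z *\<^sub>C W t s x" for z x
  proof (rule LIMSEQ_unique[OF U_convergent[OF st]])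
    have ev: "eventually (\<lambda>n. z *\<^sub>C U n t s x = U n t s (z *\<^sub>C x)) sequentially"
      using eventually_ge_1 by eventually_elim (use Ub in \<open>simp add: bounded_clinear_def\<close>)
    show "(\<lambda>n. U n t s (z *\<^sub>C x)) \<longlonglongrightarrow> z *\<^sub>C W t s x"
      by (rule Lim_transform_eventually[OF bounded_linear.tendsto[OF bounded_linear_scaleC U_convergent[OF st]] ev])
  qed
  have "bounded_linear (W t s)"
    by (rule bounded_linear_intro[of _ E]) (use add scale W_norm[OF st] in \<open>auto simp: scaleR_scaleC mult.commute\<close>)
  then show ?thesis using scale by (simp add: bounded_clinear_def)
qed

lemma W_linear: "0 \<le> s \<Longrightarrow> s \<le> t \<Longrightarrow> t \<le> T \<Longrightarrow> bounded_linear (W t s)"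
  using W_clinear by (simp add: bounded_clinear_def)

lemma W_diff: "0 \<le> s \<Longrightarrow> s \<le> t \<Longrightarrow> t \<le> T \<Longrightarrow> W t s (x - y) = W t s x - W t s y"
  by (rule linear_diff[OF bounded_linear.linear[OF W_linear]])

lemma W_scaleR: "0 \<le> s \<Longrightarrow> s \<le> t \<Longrightarrow> t \<le> T \<Longrightarrow> W t s (r *\<^sub>R x) = r *\<^sub>R W t s x"
  by (rule linear_scale[OF bounded_linear.linear[OF W_linear]])

lemma W_refl:
  assumes "s \<in> {0..T}"
  shows "W s s = id"
proof
  fix x
  have "norm (W s s x - x) \<le> 0"
    using assms U_refl[OF _ assms] by (intro W_tendsto_bound[of s s x x "\<lambda>_. 0"]) auto
  then show "W s s x = id x" by simp
qed

lemma W_cocycle: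
  assumes "0 \<le> s" "s \<le> r" "r \<le> t" "t \<le> T"
  shows "W t r (W r s x) = W t s x"
proof (rule LIMSEQ_unique)
  have str: "0 \<le> r" "r \<le> t" "t \<le> T" "0 \<le> s" "s \<le> r" "r \<le> T" "s \<le> t" using assms by auto
  show "(\<lambda>n. U n t s x) \<longlonglongrightarrow> W t s x" using str by (intro U_convergent)
  have "(\<lambda>n. U n t r (U n r s x) - U n t r (W r s x)) \<longlonglongrightarrow> 0"
  proof (rule Lim_null_comparison)
    show "eventually (\<lambda>n. norm (U n t r (U n r s x) - U n t r (W r s x)) \<le> E * norm (U n r s x - W r s x)) sequentially"
      using eventually_ge_1
    proof eventually_elim
      case (elim n)
      then show ?case using U_norm[OF elim str(1-3), of "U n r s x - W r s x"] U_diff[OF elim str(1-3)] by simp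
    qed
    have "(\<lambda>n. E * norm (U n r s x - W r s x)) \<longlonglongrightarrow> E * norm (W r s x - W r s x)"
      by (intro tendsto_intros U_convergent str)
    then show "(\<lambda>n. E * norm (U n r s x - W r s x)) \<longlonglongrightarrow> 0" by simp
  qed
  from tendsto_add[OF this U_convergent[OF str(1-3), of "W r s x"]]
  have "(\<lambda>n. U n t r (U n r s x)) \<longlonglongrightarrow> W t r (W r s x)" by simp
  moreover have "eventually (\<lambda>n. U n t r (U n r s x) = U n t s x) sequentially"
    using eventually_ge_1 by eventually_elim (use U_cocycle assms in \<open>simp add: fun_eq_iff\<close>)
  ultimately show "(\<lambda>n. U n t s x) \<longlonglongrightarrow> W t r (W r s x)" by (rule Lim_transform_eventually)
qed

text \<open>Reflexivity enters here: balls of \<open>D(A\<^sup>k)\<close> are closed in the ambient space.\<close>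

lemma W_dom:
  assumes st: "0 \<le> s" "s \<le> t" "t \<le> T" and k: "k \<le> m" "x \<in> dom_pow A k"
  shows "W t s x \<in> dom_pow A k" "\<nu> 0 k (W t s x) \<le> M * \<nu> 0 k x"
proof -
  note p = pg[OF zero_mem]
  \<comment> \<open>The index is shifted because the bounds hold from 1 on.\<close>
  have Ud: "U (Suc n) t s x \<in> dom_pow A k" "\<nu> 0 k (U (Suc n) t s x) \<le> M * \<nu> 0 k x" for n
    using U_\<nu>[OF _ st k zero_mem zero_mem, of "Suc n"] by auto
  have "\<exists>y0. (R 0 ^^ k) y0 = W t s x \<and> norm (y0 - 0) \<le> M * \<nu> 0 k x"
  proof (rule reflexive_range_closed[OF refl perturbed_generator.bounded_clinear_R_pow[OF p]])
    show "(\<lambda>n. (R 0 ^^ k) ((S 0 ^^ k) (U (Suc n) t s x))) \<longlonglongrightarrow> W t s x"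
      using LIMSEQ_Suc[OF U_convergent[OF st, of x]] perturbed_generator.R_pow_S_pow[OF p k(1) Ud(1)] by simp
    show "norm ((S 0 ^^ k) (U (Suc n) t s x) - 0) \<le> M * \<nu> 0 k x" for n using Ud(2) by (simp add: \<nu>_def)
  qed (rule tendsto_const)
  then obtain y0 where y0: "(R 0 ^^ k) y0 = W t s x" "norm y0 \<le> M * \<nu> 0 k x" by auto
  show "W t s x \<in> dom_pow A k" using perturbed_generator.R_pow_dom[OF p k(1), of y0] y0 by simp
  show "\<nu> 0 k (W t s x) \<le> M * \<nu> 0 k x"
    using perturbed_generator.S_pow_R_pow[OF p, of k y0] y0 by (simp add: \<nu>_def)
qed

lemma W_opdom:
  assumes "0 \<le> s" "s \<le> t" "t \<le> T" "x \<in> opdom A"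
  shows "W t s x \<in> opdom A" "\<nu> 0 1 (W t s x) \<le> M * \<nu> 0 1 x"
  using W_dom[OF assms(1-3) m1, of x] assms(4) by (auto simp: dom_pow_1)

section \<open>The commutator in the limit\<close>

definition K5 :: real where "K5 = 3 * E * c * M"

lemma K5_nonneg: "0 \<le> K5"
  using E_ge_1 c_nonneg M_ge by (simp add: K5_def)

text \<open>The vectors \<open>S t (U n t s x)\<close> are bounded only; their weak cluster point is
  \<open>S t (W t s x)\<close>, while the centres \<open>U n t s (S s x)\<close> converge in norm.
  \<open>reflexive_range_closed\<close> wants one radius for the whole sequence, so the tail from
  \<open>N\<close> on is used with radius \<open>\<rho> N\<close>, and \<open>N\<close> tends to
  infinity afterwards.\<close>

lemma W_S:
  assumes st: "0 \<le> s" "s \<le> t" "t \<le> T" and x: "x \<in> opdom A"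
  shows "norm (S t (W t s x) - W t s (S s x)) \<le> K5 * (t - s) * \<nu> 0 1 x"
proof (rule tendsto_lowerbound)
  have t: "t \<in> {0..T}" using st by simp
  note p = pg[OF t]
  define \<rho> where "\<rho> = (\<lambda>N. K5 * (t - s + T / real N) * \<nu> 0 1 x)"
  have "\<rho> \<longlonglongrightarrow> K5 * (t - s + 0) * \<nu> 0 1 x" unfolding \<rho>_def by (intro tendsto_intros T_over_n)
  then show "\<rho> \<longlonglongrightarrow> K5 * (t - s) * \<nu> 0 1 x" by simp
  have le: "norm (S t (W t s x) - W t s (S s x)) \<le> \<rho> N" if N: "1 \<le> N" for N
  proof -
    have "\<exists>y0. R t y0 = W t s x \<and> norm (y0 - W t s (S s x)) \<le> \<rho> N"
    proof (rule reflexive_range_closed[OF refl perturbed_generator.bounded_clinear_R[OF p]])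
      show "(\<lambda>n. R t (S t (U (n + N) t s x))) \<longlonglongrightarrow> W t s x"
        using LIMSEQ_ignore_initial_segment[OF U_convergent[OF st, of x], of N]
          perturbed_generator.R_S[OF p U_opdom[OF _ st x]] N by simp
      show "(\<lambda>n. U (n + N) t s (S s x)) \<longlonglongrightarrow> W t s (S s x)"
        by (rule LIMSEQ_ignore_initial_segment[OF U_convergent[OF st]])
      fix n
      have "norm (S t (U (n + N) t s x) - U (n + N) t s (S s x)) \<le> K5 * (t - s + T / real (n + N)) * \<nu> 0 1 x"
        unfolding K5_def using N by (intro U_S st x) simp
      also have "\<dots> \<le> \<rho> N"
        unfolding \<rho>_def using N T0 K5_nonneg by (intro mult_right_mono mult_left_mono add_left_mono divide_left_mono) auto
      finally show "norm (S t (U (n + N) t s x) - U (n + N) t s (S s x)) \<le> \<rho> N" .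
    qed
    then obtain y0 where y0: "R t y0 = W t s x" "norm (y0 - W t s (S s x)) \<le> \<rho> N" by blast
    then show ?thesis using perturbed_generator.R(2)[OF p, of y0] by simp
  qed
  show "eventually (\<lambda>N. norm (S t (W t s x) - W t s (S s x)) \<le> \<rho> N) sequentially"
    using eventually_ge_1 by eventually_elim (rule le)
qed simp

end

section \<open>The limit is an evolution system\<close>

text \<open>After subtracting the linear function with slope \<open>w t\<close>, the right
  derivative is small near \<open>t\<close>, and the mean value inequality applies on either side of
  \<open>t\<close>. At \<open>b\<close> the value \<open>w b\<close> enters through continuity
  only.\<close>

lemma has_vector_derivative_from_right:
  fixes f :: "real \<Rightarrow> 'a::real_normed_vector"
  assumes f: "continuous_on {a..b} f" and w: "continuous_on {a..b} w"
    and D: "\<And>r. a \<le> r \<Longrightarrow> r < b \<Longrightarrow> ((\<lambda>h. (f (r + h) - f r) /\<^sub>R h) \<longlongrightarrow> w r) (at_right 0)"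
    and t: "t \<in> {a..b}"
  shows "(f has_vector_derivative w t) (at t within {a..b})"
  unfolding has_vector_derivative_def has_derivative_within_alt
proof (intro conjI allI impI)
  show "bounded_linear (\<lambda>x. x *\<^sub>R w t)" by (rule bounded_linear_scaleR_left)
  fix e :: real assume "0 < e"
  then obtain d where d: "0 < d" "\<And>r. r \<in> {a..b} \<Longrightarrow> dist r t < d \<Longrightarrow> dist (w r) (w t) < e"
    using w t unfolding continuous_on_iff by blast
  have *: "norm ((f q - q *\<^sub>R w t) - (f p - p *\<^sub>R w t)) \<le> e * (q - p)"
    if pq: "a \<le> p" "p \<le> q" "q \<le> b" "\<bar>p - t\<bar> < d" "\<bar>q - t\<bar> < d" for p q
  proof (rule right_derivative_bound[of p q "\<lambda>r. f r - r *\<^sub>R w t" "\<lambda>r. w r - w t", OF pq(2)])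
    show "continuous_on {p..q} (\<lambda>r. f r - r *\<^sub>R w t)"
      by (intro continuous_intros continuous_on_subset[OF f]) (use pq in auto)
    fix r assume r: "p \<le> r" "r < q"
    have "((\<lambda>h. (f (r + h) - f r) /\<^sub>R h - w t) \<longlongrightarrow> w r - w t) (at_right 0)"
      using r pq by (intro tendsto_intros D) auto
    moreover have "eventually (\<lambda>h. (f (r + h) - f r) /\<^sub>R h - w t =
        (f (r + h) - (r + h) *\<^sub>R w t - (f r - r *\<^sub>R w t)) /\<^sub>R h) (at_right 0)"
      using eventually_at_right_less[of 0] by eventually_elim (simp add: algebra_simps)
    ultimately show "((\<lambda>h. (f (r + h) - (r + h) *\<^sub>R w t - (f r - r *\<^sub>R w t)) /\<^sub>R h) \<longlongrightarrow> w r - w t) (at_right 0)"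
      by (rule Lim_transform_eventually)
    have "\<bar>r - t\<bar> < d" using r pq by arith
    then show "norm (w r - w t) \<le> e" using d(2)[of r] r pq by (simp add: dist_norm)
  qed
  show "\<exists>d>0. \<forall>y\<in>{a..b}. norm (y - t) < d \<longrightarrow> norm (f y - f t - (y - t) *\<^sub>R w t) \<le> e * norm (y - t)"
  proof (intro exI[of _ d] conjI ballI impI d(1))
    fix y assume y: "y \<in> {a..b}" "norm (y - t) < d"
    show "norm (f y - f t - (y - t) *\<^sub>R w t) \<le> e * norm (y - t)"
    proof (cases "t \<le> y")
      case True
      have eq: "f y - f t - (y - t) *\<^sub>R w t = (f y - y *\<^sub>R w t) - (f t - t *\<^sub>R w t)" by (simp add: algebra_simps)
      have "norm (f y - f t - (y - t) *\<^sub>R w t) \<le> e * (y - t)"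
        unfolding eq by (rule *) (use True y t d(1) in auto)
      then show ?thesis using True by simp
    next
      case False
      have eq: "f y - f t - (y - t) *\<^sub>R w t = - ((f t - t *\<^sub>R w t) - (f y - y *\<^sub>R w t))" by (simp add: algebra_simps)
      have "norm (f y - f t - (y - t) *\<^sub>R w t) \<le> e * (t - y)"
        unfolding eq norm_minus_cancel by (rule *) (use False y t d(1) in auto)
      then show ?thesis using False by simp
    qed
  qed
qed

section \<open>Joint continuity of the limit\<close>

context perturbed_family
begin

abbreviation "\<Delta> \<equiv> {(t, s). 0 \<le> s \<and> s \<le> t \<and> t \<le> T}"

lemma W_lipschitz_both:
  assumes "(t, s) \<in> \<Delta>" "(t', s') \<in> \<Delta>" and x: "x \<in> opdom A"
  shows "norm (W t' s' x - W t s x) \<le> K * M * \<nu> 0 1 x * \<bar>t' - t\<bar> + E * K * \<nu> 0 1 x * \<bar>s' - s\<bar>"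
proof -
  have tt: "norm (W q s x - W p s x) \<le> K * M * \<nu> 0 1 x * (q - p)" if "0 \<le> s" "s \<le> p" "p \<le> q" "q \<le> T" for p q s
  proof -
    have y: "W p s x \<in> opdom A" "\<nu> 0 1 (W p s x) \<le> M * \<nu> 0 1 x" using W_opdom[of s p x] that x by auto
    have "W q s x = W q p (W p s x)" using W_cocycle that by simp
    then have "norm (W q s x - W p s x) \<le> K * (q - p) * \<nu> 0 1 (W p s x)" using W_lipschitz[of p q "W p s x"] that y by simp
    also have "\<dots> \<le> K * (q - p) * (M * \<nu> 0 1 x)" using y K_nonneg that by (intro mult_left_mono) auto
    finally show ?thesis by (simp add: mult_ac)
  qed
  have ss: "norm (W t q x - W t p x) \<le> E * K * \<nu> 0 1 x * (q - p)" if "0 \<le> p" "p \<le> q" "q \<le> t" "t \<le> T" for p q t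
  proof -
    have "W t q x - W t p x = W t q (x - W q p x)" using W_cocycle[of p q t x] W_diff[of q t] that by simp
    then have "norm (W t q x - W t p x) \<le> E * norm (W q p x - x)" using W_norm[of q t] that by (simp add: norm_minus_commute)
    also have "\<dots> \<le> E * (K * (q - p) * \<nu> 0 1 x)" using E_ge_1 that x by (intro mult_left_mono W_lipschitz) auto
    finally show ?thesis by (simp add: mult_ac)
  qed
  have ss': "norm (W t s' x - W t s x) \<le> E * K * \<nu> 0 1 x * \<bar>s' - s\<bar>" if "0 \<le> s" "0 \<le> s'" "s \<le> t" "s' \<le> t" "t \<le> T" for t
    using ss[of s s' t] ss[of s' s t] that by (cases "s \<le> s'") (auto simp: norm_minus_commute)
  \<comment> \<open>The intermediate corner takes the larger of the two end times and so stays
    inside the triangle \<open>\<Delta>\<close>.\<close>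
  show ?thesis
  proof (cases "t \<le> t'")
    case True
    then show ?thesis
      using tt[of s t t'] ss'[of t'] assms norm_diff_triangle[of "W t' s' x" "W t s x" "W t' s x"] by auto
  next
    case False
    then show ?thesis
      using tt[of s' t' t] ss'[of t] assms norm_diff_triangle[of "W t' s' x" "W t s x" "W t s' x"]
        norm_minus_commute[of "W t s' x" "W t' s' x"] by auto
  qed
qed

lemma W_continuous: "continuous_on \<Delta> (\<lambda>(t, s). W t s x)"
proof -
  obtain y where y: "\<And>n. y n \<in> opdom A" "y \<longlonglongrightarrow> x" using dense_approx by blast
  have yc: "continuous_on \<Delta> (\<lambda>(t, s). W t s (y n))" for n
    unfolding continuous_on_iff
  proof (intro ballI allI impI)
    fix p :: "real \<times> real" and e :: real assume p: "p \<in> \<Delta>" and e: "0 < e"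
    define C where "C = K * M * \<nu> 0 1 (y n) + E * K * \<nu> 0 1 (y n) + 1"
    have C: "0 < C" using K_nonneg M_ge E_ge_1 by (simp add: C_def add_nonneg_pos)
    show "\<exists>d>0. \<forall>q\<in>\<Delta>. dist q p < d \<longrightarrow> dist (case q of (t, s) \<Rightarrow> W t s (y n)) (case p of (t, s) \<Rightarrow> W t s (y n)) < e"
    proof (intro exI[of _ "e / C"] conjI ballI impI)
      show "0 < e / C" using e C by simp
      fix q assume q: "q \<in> \<Delta>" "dist q p < e / C"
      obtain t s t' s' where pq: "p = (t, s)" "q = (t', s')" by (metis surj_pair)
      have d: "\<bar>t' - t\<bar> \<le> dist q p" "\<bar>s' - s\<bar> \<le> dist q p"
        using dist_fst_le[of q p] dist_snd_le[of q p] by (auto simp: pq dist_real_def)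
      have "norm (W t' s' (y n) - W t s (y n)) \<le> K * M * \<nu> 0 1 (y n) * \<bar>t' - t\<bar> + E * K * \<nu> 0 1 (y n) * \<bar>s' - s\<bar>"
        using p q pq y by (intro W_lipschitz_both) auto
      also have "\<dots> \<le> K * M * \<nu> 0 1 (y n) * dist q p + E * K * \<nu> 0 1 (y n) * dist q p"
        using d K_nonneg M_ge E_ge_1 by (intro add_mono mult_left_mono) auto
      also have "\<dots> \<le> C * dist q p" unfolding C_def by (simp add: distrib_right)
      also have "\<dots> < e" using q(2) C by (simp add: field_simps)
      finally show "dist (case q of (t, s) \<Rightarrow> W t s (y n)) (case p of (t, s) \<Rightarrow> W t s (y n)) < e"
        by (simp add: pq dist_norm)
    qed
  qed
  have unif: "uniform_limit \<Delta> (\<lambda>n (t, s). W t s (y n)) (\<lambda>(t, s). W t s x) sequentially"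
  proof (rule uniform_limitI)
    fix e :: real assume e: "0 < e"
    have E0: "0 < E" using E_ge_1 by simp
    have "eventually (\<lambda>n. dist (y n) x < e / E) sequentially" using tendstoD[OF y(2)] e E0 by simp
    then show "eventually (\<lambda>n. \<forall>p\<in>\<Delta>. dist (case p of (t, s) \<Rightarrow> W t s (y n)) (case p of (t, s) \<Rightarrow> W t s x) < e) sequentially"
    proof eventually_elim
      case (elim n)
      show ?case
      proof (intro ballI)
        fix p assume p: "p \<in> \<Delta>"
        obtain t s where ts: "p = (t, s)" by (metis surj_pair)
        have "norm (W t s (y n) - W t s x) \<le> E * norm (y n - x)" using p ts W_norm[of s t "y n - x"] W_diff[of s t] by simp
        also have "\<dots> < e" using elim E0 by (simp add: dist_norm field_simps)
        finally show "dist (case p of (t, s) \<Rightarrow> W t s (y n)) (case p of (t, s) \<Rightarrow> W t s x) < e" by (simp add: ts dist_norm)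
      qed
    qed
  qed
  show ?thesis
    by (rule uniform_limit_theorem[OF always_eventually unif]) (use yc in auto)
qed

lemma W_continuous_t:
  assumes "0 \<le> s"
  shows "continuous_on {s..T} (\<lambda>t. W t s x)"
proof -
  have "continuous_on {s..T} (\<lambda>t. case (t, s) of (t, s) \<Rightarrow> W t s x)"
    by (rule continuous_on_compose2[OF W_continuous]) (use assms in \<open>auto intro!: continuous_intros\<close>)
  then show ?thesis by simp
qed

lemma W_continuous_s:
  assumes "t \<le> T"
  shows "continuous_on {0..t} (\<lambda>s. W t s x)"
proof -
  have "continuous_on {0..t} (\<lambda>s. case (t, s) of (t, s) \<Rightarrow> W t s x)"
    by (rule continuous_on_compose2[OF W_continuous]) (use assms in \<open>auto intro!: continuous_intros\<close>)
  then show ?thesis by simp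
qed

lemma W_local:
  assumes p: "p \<in> {0..T}" and x: "x \<in> opdom A" and e: "0 < e"
  obtains d where "0 < d" "\<And>q r. 0 \<le> q \<Longrightarrow> q \<le> r \<Longrightarrow> r \<le> T \<Longrightarrow> r - q < d \<Longrightarrow> p \<in> {q..r} \<Longrightarrow>
    norm (W r q x - x - (r - q) *\<^sub>R app (G p) x) \<le> e * (r - q)"
proof -
  interpret Q: qc_generator "G p" "V p" \<omega> by (rule qcg[OF p])
  have "((\<lambda>h. V p h (app (G p) x)) \<longlongrightarrow> app (G p) x) (at_right 0)" by (rule Q.V_tendsto_0)
  then have "eventually (\<lambda>h. dist (V p h (app (G p) x)) (app (G p) x) < e / 2) (at_right 0)"
    using e by (intro tendstoD) auto
  then obtain d1 where d1: "0 < d1" "\<And>h. 0 < h \<Longrightarrow> h < d1 \<Longrightarrow> norm (V p h (app (G p) x) - app (G p) x) < e / 2"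
    unfolding eventually_at_right_field by (auto simp: dist_norm)
  \<comment> \<open>The error of \<open>W_V\<close> is at most \<open>C * h * h\<close>, hence at
    most \<open>(e / 2) * h\<close> for \<open>h\<close> below \<open>e / (2 * C)\<close>; the
    \<open>+ 1\<close> keeps \<open>C\<close> positive.\<close>
  define C where "C = K3 * \<nu> 0 1 x + 1"
  have C: "0 < C" using K3_nonneg by (simp add: C_def add_nonneg_pos)
  show ?thesis
  proof (rule that[of "min d1 (e / (2 * C))"])
    show "0 < min d1 (e / (2 * C))" using d1 e C by simp
    fix q r assume qr: "0 \<le> q" "q \<le> r" "r \<le> T" "r - q < min d1 (e / (2 * C))" "p \<in> {q..r}"
    define h where "h = r - q"
    have h: "0 \<le> h" "h < d1" "h * C \<le> e / 2" using qr C by (auto simp: h_def field_simps)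
    have "norm (V p h x - x - h *\<^sub>R app (G p) x) \<le> (e / 2) * h"
    proof (rule Q.V_increment[OF _ h(1)])
      show "x \<in> opdom (G p)" using x by (simp add: opdom_G)
      fix r assume "0 \<le> r" "r < h"
      then show "norm (V p r (app (G p) x) - app (G p) x) \<le> e / 2"
        using d1(2)[of r] h e Q.V_0 by (cases "r = 0") auto
    qed
    moreover have "norm (W r q x - V p h x) \<le> (e / 2) * h"
    proof -
      have "norm (W r q x - V p h x) \<le> K3 * h * h * \<nu> 0 1 x" unfolding h_def by (rule W_V[OF qr(1-3) x qr(5)])
      also have "\<dots> \<le> (h * C) * h" using h by (simp add: C_def algebra_simps)
      also have "\<dots> \<le> (e / 2) * h" using h by (intro mult_right_mono) auto
      finally show ?thesis .
    qed
    ultimately have "norm (W r q x - x - h *\<^sub>R app (G p) x) \<le> e * h"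
      using norm_triangle_ineq[of "W r q x - V p h x" "V p h x - x - h *\<^sub>R app (G p) x"] by (simp add: algebra_simps)
    then show "norm (W r q x - x - (r - q) *\<^sub>R app (G p) x) \<le> e * (r - q)" by (simp add: h_def)
  qed
qed

section \<open>Derivatives of the limit in both time arguments\<close>

lemma W_right_derivative:
  assumes "0 \<le> s" "s \<le> t" "t < T" and x: "x \<in> opdom A"
  shows "((\<lambda>h. (W (t + h) s x - W t s x) /\<^sub>R h) \<longlongrightarrow> app (G t) (W t s x)) (at_right 0)"
proof (rule tendstoI)
  fix e :: real assume e: "0 < e"
  let ?y = "W t s x"
  have t: "t \<in> {0..T}" using assms by simp
  have y: "?y \<in> opdom A" using W_opdom assms by simp
  obtain d where d: "0 < d" "\<And>q r. 0 \<le> q \<Longrightarrow> q \<le> r \<Longrightarrow> r \<le> T \<Longrightarrow> r - q < d \<Longrightarrow> t \<in> {q..r} \<Longrightarrow>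
    norm (W r q ?y - ?y - (r - q) *\<^sub>R app (G t) ?y) \<le> (e / 2) * (r - q)"
    using W_local[OF t y, of "e / 2"] e by auto
  have "eventually (\<lambda>h. h \<in> {0<..<min d (T - t)}) (at_right 0)"
    using d assms by (intro eventually_at_right_real) auto
  then show "eventually (\<lambda>h. dist ((W (t + h) s x - ?y) /\<^sub>R h) (app (G t) ?y) < e) (at_right 0)"
  proof eventually_elim
    case (elim h)
    then have h: "0 < h" "h < d" "t + h \<le> T" by auto
    have "W (t + h) s x = W (t + h) t ?y" using W_cocycle[of s t "t + h" x] assms h by simp
    then have *: "norm (W (t + h) s x - ?y - h *\<^sub>R app (G t) ?y) \<le> (e / 2) * h"
      using d(2)[of t "t + h"] h t by simp
    have eq: "(W (t + h) s x - ?y) /\<^sub>R h - app (G t) ?y = (W (t + h) s x - ?y - h *\<^sub>R app (G t) ?y) /\<^sub>R h"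
      using h by (simp add: scaleR_diff_right[of "inverse _"])
    have "norm ((W (t + h) s x - ?y) /\<^sub>R h - app (G t) ?y) = inverse h * norm (W (t + h) s x - ?y - h *\<^sub>R app (G t) ?y)"
      unfolding eq using h by simp
    also have "\<dots> \<le> inverse h * ((e / 2) * h)" using * h by (intro mult_left_mono) auto
    also have "\<dots> = e / 2" using h by simp
    finally show ?case using e by (simp add: dist_norm)
  qed
qed

text \<open>
  Left continuity of \<open>z\<close> needs the drift bound and not only boundedness: from an earlier time
  \<open>t0\<close> the orbit \<open>W r t0 (z t0)\<close> is continuous in \<open>r\<close> and stays close to \<open>z r\<close>.
\<close>

lemma small_drift_continuous:
  assumes s: "0 \<le> s" and C: "0 \<le> C"
    and drift: "\<And>t r. s \<le> t \<Longrightarrow> t \<le> r \<Longrightarrow> r \<le> T \<Longrightarrow> norm (z r - W r t (z t)) \<le> C * (r - t)"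
  shows "continuous_on {s..T} z"
  unfolding continuous_on_iff
proof (intro ballI allI impI)
  fix t and e :: real assume t: "t \<in> {s..T}" and e: "0 < e"
  \<comment> \<open>Drift over the length \<open>2 * \<eta>\<close>, the most that occurs between
    \<open>t0\<close> and \<open>r\<close>, is at most \<open>e / 2\<close>; the \<open>+ 1\<close>
    covers \<open>C = 0\<close>.\<close>
  define \<eta> where "\<eta> = e / (4 * (C + 1))"
  have \<eta>: "0 < \<eta>" "C * \<eta> \<le> e / 4" using e C by (auto simp: \<eta>_def field_simps)
  define t0 where "t0 = max s (t - \<eta>)"
  have t0: "s \<le> t0" "t0 \<le> t" "t - t0 \<le> \<eta>" using t \<eta> by (auto simp: t0_def)
  have "continuous_on {t0..T} (\<lambda>r. W r t0 (z t0))" using t0 s by (intro W_continuous_t) simp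
  moreover have "t \<in> {t0..T}" "0 < e / 4" using t t0 e by auto
  ultimately obtain d where d: "0 < d"
    "\<And>r. r \<in> {t0..T} \<Longrightarrow> dist r t < d \<Longrightarrow> dist (W r t0 (z t0)) (W t t0 (z t0)) < e / 4"
    unfolding continuous_on_iff by blast
  show "\<exists>d>0. \<forall>r\<in>{s..T}. dist r t < d \<longrightarrow> dist (z r) (z t) < e"
  proof (intro exI[of _ "min d \<eta>"] conjI ballI impI)
    show "0 < min d \<eta>" using d \<eta> by simp
    fix r assume r: "r \<in> {s..T}" "dist r t < min d \<eta>"
    then have rt: "t0 \<le> r" "r \<le> T" "r - t0 \<le> 2 * \<eta>" "dist r t < d"
      using t0 by (auto simp: t0_def dist_real_def)
    have 1: "norm (z r - W r t0 (z t0)) \<le> e / 2"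
    proof -
      have "norm (z r - W r t0 (z t0)) \<le> C * (r - t0)" using rt t0 by (intro drift) auto
      also have "\<dots> \<le> C * (2 * \<eta>)" using rt C by (intro mult_left_mono) auto
      finally show ?thesis using \<eta> by simp
    qed
    have 2: "norm (z t - W t t0 (z t0)) \<le> e / 4"
    proof -
      have "norm (z t - W t t0 (z t0)) \<le> C * (t - t0)" using t t0 by (intro drift) auto
      also have "\<dots> \<le> C * \<eta>" using t0 C by (intro mult_left_mono) auto
      finally show ?thesis using \<eta> by simp
    qed
    have 3: "norm (W r t0 (z t0) - W t t0 (z t0)) < e / 4" using d(2)[of r] rt by (simp add: dist_norm)
    show "dist (z r) (z t) < e"
      using 1 2 3 norm_diff_triangle[of "z r" "z t" "W r t0 (z t0)"] norm_diff_triangle[of "W r t0 (z t0)" "z t" "W t t0 (z t0)"]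
        norm_minus_commute[of "z t" "W t t0 (z t0)"] by (simp add: dist_norm)
  qed
qed

text \<open>For \<open>z r = S r (W r s x)\<close> the drift condition is the commutator bound
  \<open>W_S\<close> started from \<open>W p s x\<close>, with a constant that stability makes
  independent of \<open>p\<close>.\<close>

lemma W_derivative_t:
  assumes st: "0 \<le> s" "s \<le> t" "t \<le> T" and x: "x \<in> opdom A"
  shows "((\<lambda>\<tau>. W \<tau> s x) has_vector_derivative app (G t) (W t s x)) (at t within {s..T})"
proof (rule has_vector_derivative_from_right[of s T _ "\<lambda>r. app (G r) (W r s x)"])
  show "continuous_on {s..T} (\<lambda>\<tau>. W \<tau> s x)" by (rule W_continuous_t[OF st(1)])
  define z where "z = (\<lambda>r. S r (W r s x))"
  have "continuous_on {s..T} z"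
  proof (rule small_drift_continuous[OF st(1)])
    show "0 \<le> K5 * (M * \<nu> 0 1 x)" using K5_nonneg M_ge by simp
    fix p r assume pr: "s \<le> p" "p \<le> r" "r \<le> T"
    have y: "W p s x \<in> opdom A" "\<nu> 0 1 (W p s x) \<le> M * \<nu> 0 1 x" using W_opdom[of s p x] st pr x by auto
    have "norm (S r (W r p (W p s x)) - W r p (S p (W p s x))) \<le> K5 * (r - p) * \<nu> 0 1 (W p s x)"
      using st pr by (intro W_S y) auto
    also have "\<dots> \<le> K5 * (r - p) * (M * \<nu> 0 1 x)" using K5_nonneg pr y by (intro mult_left_mono) auto
    finally show "norm (z r - W r p (z p)) \<le> K5 * (M * \<nu> 0 1 x) * (r - p)"
      using W_cocycle[of s p r x] st pr by (simp add: z_def mult_ac)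
  qed
  then have "continuous_on {s..T} (\<lambda>r. \<mu> *\<^sub>R W r s x - z r)"
    by (intro continuous_intros W_continuous_t st)
  then show "continuous_on {s..T} (\<lambda>r. app (G r) (W r s x))"
    by (rule continuous_on_eq) (use st in \<open>simp add: app_G z_def\<close>)
  fix r assume "s \<le> r" "r < T"
  then show "((\<lambda>h. (W (r + h) s x - W r s x) /\<^sub>R h) \<longlongrightarrow> app (G r) (W r s x)) (at_right 0)"
    using st x by (intro W_right_derivative) auto
qed (use st in auto)

text \<open>Below \<open>s\<close> the fixed operator \<open>W t s\<close> is applied to the local
  expansion. Above \<open>s\<close> the operator \<open>W t \<sigma>\<close> varies as well, and
  strong continuity in the second time argument (\<open>d2\<close>) replaces it by
  \<open>W t s\<close>.\<close>

lemma W_derivative_s: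
  assumes st: "0 \<le> s" "s \<le> t" "t \<le> T" and x: "x \<in> opdom A"
  shows "((\<lambda>\<sigma>. W t \<sigma> x) has_vector_derivative - W t s (app (G s) x)) (at s within {0..t})"
  unfolding has_vector_derivative_def has_derivative_within_alt
proof (intro conjI allI impI)
  let ?g = "app (G s) x"
  show "bounded_linear (\<lambda>r. r *\<^sub>R (- W t s ?g))" by (rule bounded_linear_scaleR_left)
  fix e :: real assume e: "0 < e"
  have s: "s \<in> {0..T}" using st by simp
  have E0: "0 < E" using E_ge_1 by simp
  obtain d1 where d1: "0 < d1" "\<And>q r. 0 \<le> q \<Longrightarrow> q \<le> r \<Longrightarrow> r \<le> T \<Longrightarrow> r - q < d1 \<Longrightarrow> s \<in> {q..r} \<Longrightarrow>
    norm (W r q x - x - (r - q) *\<^sub>R ?g) \<le> (e / (2 * E)) * (r - q)"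
    using W_local[OF s x, of "e / (2 * E)"] e E0 by auto
  obtain d2 where d2: "0 < d2" "\<And>\<sigma>. \<sigma> \<in> {0..t} \<Longrightarrow> dist \<sigma> s < d2 \<Longrightarrow> dist (W t \<sigma> ?g) (W t s ?g) < e / 2"
    using W_continuous_s[OF st(3), of ?g] st e unfolding continuous_on_iff by (metis atLeastAtMost_iff half_gt_zero)
  show "\<exists>d>0. \<forall>\<sigma>\<in>{0..t}. norm (\<sigma> - s) < d \<longrightarrow>
      norm (W t \<sigma> x - W t s x - (\<sigma> - s) *\<^sub>R (- W t s ?g)) \<le> e * norm (\<sigma> - s)"
  proof (intro exI[of _ "min d1 d2"] conjI ballI impI)
    show "0 < min d1 d2" using d1 d2 by simp
    fix \<sigma> assume \<sigma>: "\<sigma> \<in> {0..t}" "norm (\<sigma> - s) < min d1 d2"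
    show "norm (W t \<sigma> x - W t s x - (\<sigma> - s) *\<^sub>R (- W t s ?g)) \<le> e * norm (\<sigma> - s)"
    proof (cases "s \<le> \<sigma>")
      case True
      define h where "h = \<sigma> - s"
      have h: "0 \<le> h" "h < d1" using True \<sigma> by (auto simp: h_def)
      have dst: "dist (W t \<sigma> ?g) (W t s ?g) < e / 2" using d2(2)[of \<sigma>] \<sigma> by (simp add: dist_real_def)
      have lin: "W t \<sigma> (W \<sigma> s x - x - h *\<^sub>R ?g) = W t s x - W t \<sigma> x - h *\<^sub>R W t \<sigma> ?g"
        using W_diff[of \<sigma> t] W_scaleR[of \<sigma> t] W_cocycle[of s \<sigma> t x] \<sigma> True st by simp
      have eq: "W t \<sigma> x - W t s x - h *\<^sub>R (- W t s ?g) = - W t \<sigma> (W \<sigma> s x - x - h *\<^sub>R ?g) - h *\<^sub>R (W t \<sigma> ?g - W t s ?g)"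
        unfolding lin by (simp add: algebra_simps)
      have "norm (W t \<sigma> x - W t s x - h *\<^sub>R (- W t s ?g)) \<le> norm (W t \<sigma> (W \<sigma> s x - x - h *\<^sub>R ?g)) + h * norm (W t \<sigma> ?g - W t s ?g)"
        unfolding eq using norm_triangle_ineq4[of "- W t \<sigma> (W \<sigma> s x - x - h *\<^sub>R ?g)" "h *\<^sub>R (W t \<sigma> ?g - W t s ?g)"] h by simp
      also have "\<dots> \<le> E * ((e / (2 * E)) * h) + h * (e / 2)"
      proof (intro add_mono mult_left_mono h)
        have "norm (W t \<sigma> (W \<sigma> s x - x - h *\<^sub>R ?g)) \<le> E * norm (W \<sigma> s x - x - h *\<^sub>R ?g)"
          using \<sigma> st by (intro W_norm) auto
        also have "\<dots> \<le> E * ((e / (2 * E)) * h)"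
          using d1(2)[of s \<sigma>] True \<sigma> st h E0 by (intro mult_left_mono) (auto simp: h_def)
        finally show "norm (W t \<sigma> (W \<sigma> s x - x - h *\<^sub>R ?g)) \<le> E * ((e / (2 * E)) * h)" .
        show "norm (W t \<sigma> ?g - W t s ?g) \<le> e / 2" using dst by (simp add: dist_norm)
      qed
      also have "\<dots> = e * h" using E0 by (simp add: field_simps)
      finally show ?thesis using h by (simp add: h_def)
    next
      case False
      define h where "h = s - \<sigma>"
      have h: "0 \<le> h" "h < d1" using False \<sigma> by (auto simp: h_def)
      have lin: "W t s (W s \<sigma> x - x - h *\<^sub>R ?g) = W t \<sigma> x - W t s x - h *\<^sub>R W t s ?g"
        using W_diff[of s t] W_scaleR[of s t] W_cocycle[of \<sigma> s t x] \<sigma> False st by simp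
      have eq: "W t \<sigma> x - W t s x - (\<sigma> - s) *\<^sub>R (- W t s ?g) = W t s (W s \<sigma> x - x - h *\<^sub>R ?g)"
        unfolding lin by (simp add: h_def algebra_simps)
      have "norm (W t s (W s \<sigma> x - x - h *\<^sub>R ?g)) \<le> E * norm (W s \<sigma> x - x - h *\<^sub>R ?g)"
        using st by (intro W_norm) auto
      also have "\<dots> \<le> E * ((e / (2 * E)) * h)"
        using d1(2)[of \<sigma> s] False \<sigma> st h E0 by (intro mult_left_mono) (auto simp: h_def)
      also have "\<dots> = (e / 2) * h" using E0 by simp
      also have "\<dots> \<le> e * h" using e h by (intro mult_right_mono) auto
      finally show ?thesis unfolding eq using False by (simp add: h_def)
    qed
  qed
qed

theorem evolution_system_W: "evolution_system T (\<lambda>t. G t) W"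
  unfolding evolution_system_def
proof (intro conjI allI impI ballI; (elim conjE)?)
  fix s t assume st: "0 \<le> s" "s \<le> t" "t \<le> T"
  show "bounded_clinear (W t s)" by (rule W_clinear[OF st])
  fix x assume "x \<in> opdom (G s)"
  then have x: "x \<in> opdom A" by (simp add: opdom_G)
  show "W t s x \<in> opdom (G t)" using W_opdom(1)[OF st x] by (simp add: opdom_G)
  show "((\<lambda>\<tau>. W \<tau> s x) has_vector_derivative app (G t) (W t s x)) (at t within {s..T})"
    by (rule W_derivative_t[OF st x])
  show "((\<lambda>\<sigma>. W t \<sigma> x) has_vector_derivative - W t s (app (G s) x)) (at s within {0..t})"
    by (rule W_derivative_s[OF st x])
next
  show "W s s = id" if "s \<in> {0..T}" for s by (rule W_refl[OF that])
  show "W t r \<circ> W r s = W t s" if "0 \<le> s" "s \<le> r" "r \<le> t" "t \<le> T" for s r t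
    using W_cocycle[OF that] by (simp add: fun_eq_iff)
  show "continuous_on \<Delta> (\<lambda>(t, s). W t s x)" for x by (rule W_continuous)
qed

lemma op_norm_W:
  assumes st: "0 \<le> s" "s \<le> t" "t \<le> T" and k: "k \<le> m"
  shows "op_norm A k k (W t s) < \<infinity>"
proof -
  define C where "C = bc k * (M * D ^ k)"
  have "graph_norm A k (W t s x) / graph_norm A k x \<le> C" if x: "x \<in> dom_pow A k - {0}" for x
  proof -
    have xk: "x \<in> dom_pow A k" using x by simp
    have "graph_norm A k (W t s x) \<le> bc k * \<nu> 0 k (W t s x)"
      by (rule graph_norm_le_\<nu>[OF zero_mem k W_dom(1)[OF st k xk]])
    also have "\<dots> \<le> bc k * (M * (D ^ k * graph_norm A k x))"
      using M_ge(2) by (intro mult_left_mono bc_nonneg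
          order_trans[OF W_dom(2)[OF st k xk] mult_left_mono[OF \<nu>_le_graph_norm[OF zero_mem k xk]]]) simp
    finally have "graph_norm A k (W t s x) \<le> C * graph_norm A k x" by (simp add: C_def mult_ac)
    moreover have "0 < norm x" using x by simp
    then have "0 < graph_norm A k x" using norm_le_graph_norm[of x A k] by linarith
    ultimately show ?thesis by (simp add: divide_le_eq)
  qed
  then have "op_norm A k k (W t s) \<le> ennreal C"
    unfolding op_norm_def by (intro SUP_least ennreal_leI) auto
  then show ?thesis by (simp add: le_less_trans)
qed

end

section \<open>Uniform constants\<close>

lemma rel_bound_less_consts:
  assumes "rel_bound m A B < ennreal c"
  obtains b where "rel_bound_consts m A B c b"
proof -
  obtain a b where ab: "rel_bound_consts m A B a b" "ennreal a < ennreal c"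
    using assms unfolding rel_bound_def Inf_less_iff by blast
  have "0 \<le> a" using ab(1) by (simp add: rel_bound_consts_def)
  then have ac: "a \<le> c" using ab(2) by (simp add: ennreal_less_iff)
  have "rel_bound_consts m A B c b"
    using ab(1) ac mult_right_mono[OF ac norm_ge_zero] unfolding rel_bound_consts_def by (smt (verit))
  then show ?thesis using that by blast
qed

lemma lipschitz_sup_bound:
  assumes fin: "lipschitz_sup m A B T < \<infinity>" and A: "linear_op A" and B: "\<forall>t\<in>{0..T}. linear_op (B t)"
    and dom: "\<And>t. t \<in> {0..T} \<Longrightarrow> opdom A \<subseteq> opdom (B t)"
    and t: "t \<in> {0..T}" "t' \<in> {0..T}" and k: "k < m" and x: "x \<in> dom_pow A (Suc k)"
  shows "graph_norm A k (app (B t') x - app (B t) x) \<le> enn2real (lipschitz_sup m A B T) * \<bar>t' - t\<bar> * graph_norm A (Suc k) x"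
proof (cases "t' = t \<or> x = 0")
  \<comment> \<open>These cases are left out of the suprema, which range over distinct times and
    nonzero vectors.\<close>
  case True
  have "app (B t') x - app (B t) x = 0"
    using True linear_op_zero[of "B t"] linear_op_zero[of "B t'"] B t by auto
  moreover have "graph_norm A k 0 = 0"
  proof -
    have "0 \<in> dom_pow A k" using linear_op_zero[OF A] by (induction k) (auto simp: dom_pow_Suc)
    then show ?thesis using graph_norm_scaleR[OF A, of 0 k 0] graph_norm_nonneg[of A k 0] by simp
  qed
  ultimately show ?thesis by simp
next
  case False
  define F where "F = (\<lambda>x. app (B t') x - app (B t) x)"
  define L where "L = enn2real (lipschitz_sup m A B T)"
  have L: "lipschitz_sup m A B T = ennreal L" using fin by (simp add: L_def)
  have L0: "0 \<le> L" by (simp add: L_def)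
  have "0 < norm x" using False by simp
  then have n: "0 < graph_norm A (Suc k) x" using norm_le_graph_norm[of x A "Suc k"] by linarith
  have d: "0 < \<bar>t' - t\<bar>" using False by simp
  have "ennreal (graph_norm A k (F x) / graph_norm A (Suc k) x / \<bar>t' - t\<bar>)
      = ennreal (graph_norm A k (F x) / graph_norm A (Suc k) x) / ennreal \<bar>t' - t\<bar>"
    using d n by (intro divide_ennreal[symmetric]) auto
  also have "\<dots> \<le> op_norm A (Suc k) (Suc k - 1) F / ennreal \<bar>t' - t\<bar>"
    unfolding op_norm_def using x False by (intro divide_right_mono_ennreal SUP_upper2[of x]) auto
  also have "\<dots> \<le> (\<Sum>k=1..m. op_norm A k (k - 1) F / ennreal \<bar>t' - t\<bar>)"
    using k by (intro member_le_sum) auto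
  also have "\<dots> \<le> ennreal L"
    unfolding L[symmetric] lipschitz_sup_def F_def
    using t False by (intro SUP_upper2[of "(t, t')"]) auto
  finally have "graph_norm A k (F x) / graph_norm A (Suc k) x / \<bar>t' - t\<bar> \<le> L" using L0 by simp
  then have "graph_norm A k (F x) \<le> L * \<bar>t' - t\<bar> * graph_norm A (Suc k) x"
    using d n by (simp add: divide_le_eq mult_ac)
  then show ?thesis by (simp add: F_def L_def)
qed

text \<open>The constant \<open>a0\<close> is common to all times, the second constant is not.
  Passing from \<open>t\<close> to the grid point on its left changes B x by at most
  \<open>\<epsilon>\<close> times the next graph norm. Hence finitely many second constants suffice,
  while \<open>a0\<close> rises by \<open>\<epsilon>\<close>, which may use up half of its gap to
  1.\<close>

lemma uniform_rel_bound_consts: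
  assumes A: "linear_op A" and T: "0 < T" and m: "1 \<le> m"
    and a0: "0 \<le> a0" "a0 < 1" and rbc: "\<And>t. t \<in> {0..T} \<Longrightarrow> \<exists>b. rel_bound_consts m A (B t) a0 b"
    and L0: "0 \<le> L" and lip: "\<And>t t' k x. t \<in> {0..T} \<Longrightarrow> t' \<in> {0..T} \<Longrightarrow> k < m \<Longrightarrow> x \<in> dom_pow A (Suc k) \<Longrightarrow>
      graph_norm A k (app (B t') x - app (B t) x) \<le> L * \<bar>t' - t\<bar> * graph_norm A (Suc k) x"
  obtains b where "0 \<le> b" "\<And>t. t \<in> {0..T} \<Longrightarrow> rel_bound_consts m A (B t) ((1 + a0) / 2) b"
proof -
  obtain \<beta> where \<beta>: "\<And>t. t \<in> {0..T} \<Longrightarrow> rel_bound_consts m A (B t) a0 (\<beta> t)" using rbc by metis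
  \<comment> \<open>The mesh is so fine that \<open>\<epsilon>\<close> fits into
    \<open>(1 - a0) / 2\<close>.\<close>
  obtain N :: nat where N: "max 1 (2 * L * T / (1 - a0)) < real N" using reals_Archimedean2 by blast
  then have N1: "1 \<le> N" by auto
  define \<epsilon> where "\<epsilon> = L * (T / N)"
  have \<epsilon>: "0 \<le> \<epsilon>" "\<epsilon> \<le> (1 - a0) / 2" using N a0 L0 T by (auto simp: \<epsilon>_def field_simps)
  have mem: "grid T N i \<in> {0..T}" if "i \<le> N" for i using grid_mem[of T i N] T that by simp
  have \<beta>0: "0 \<le> \<beta> (grid T N i)" if "i \<le> N" for i using \<beta>[OF mem[OF that]] by (simp add: rel_bound_consts_def)
  define b where "b = (\<Sum>i\<le>N. \<beta> (grid T N i)) + \<epsilon>"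
  have b0: "0 \<le> b" unfolding b_def using \<beta>0 \<epsilon> by (intro add_nonneg_nonneg sum_nonneg) auto
  have "rel_bound_consts m A (B t) ((1 + a0) / 2) b" if t: "t \<in> {0..T}" for t
    unfolding rel_bound_consts_def
  proof (intro conjI ballI)
    fix k' x assume k': "k' \<in> {1..m}" and x': "x \<in> dom_pow A k'"
    obtain k where k: "k' = Suc k" "k < m" using k' by (cases k') auto
    have x: "x \<in> dom_pow A (Suc k)" using x' k by simp
    have Bt: "app (B r) x \<in> dom_pow A k"
      "graph_norm A k (app (B r) x) \<le> a0 * norm ((app A ^^ Suc k) x) + \<beta> r * graph_norm A k x" if "r \<in> {0..T}" for r
      using \<beta>[OF that] k' x' unfolding rel_bound_consts_def k(1) by force+
    show "app (B t) x \<in> dom_pow A (k' - 1)" using Bt(1)[OF t] k by simp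
    obtain i where i: "i < N" "grid T N i \<le> t" "t \<le> grid T N (Suc i)" using grid_cell[OF T N1, of t] t by auto
    let ?r = "grid T N i"
    have r: "?r \<in> {0..T}" using mem i by simp
    let ?p = "norm ((app A ^^ Suc k) x)" and ?n = "graph_norm A k x"
    have "graph_norm A k (app (B t) x) \<le> graph_norm A k (app (B ?r) x) + graph_norm A k (app (B t) x - app (B ?r) x)"
      using graph_norm_add[OF A Bt(1)[OF r] dom_pow_diff[OF A Bt(1)[OF t] Bt(1)[OF r]]] by simp
    also have "graph_norm A k (app (B ?r) x) \<le> a0 * ?p + \<beta> ?r * ?n" by (rule Bt(2)[OF r])
    also have "graph_norm A k (app (B t) x - app (B ?r) x) \<le> \<epsilon> * (?n + ?p)"
    proof -
      have "graph_norm A k (app (B t) x - app (B ?r) x) \<le> L * \<bar>t - ?r\<bar> * graph_norm A (Suc k) x" by (rule lip[OF r t k(2) x])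
      also have "\<dots> \<le> \<epsilon> * graph_norm A (Suc k) x"
        unfolding \<epsilon>_def using i L0 by (intro mult_right_mono mult_left_mono) (auto simp: grid_Suc)
      finally show ?thesis by (simp add: graph_norm_Suc)
    qed
    also have "a0 * ?p + \<beta> ?r * ?n + \<epsilon> * (?n + ?p) = (a0 + \<epsilon>) * ?p + (\<beta> ?r + \<epsilon>) * ?n" by (simp add: algebra_simps)
    also have "\<dots> \<le> (1 + a0) / 2 * ?p + b * ?n"
    proof (intro add_mono mult_right_mono)
      show "a0 + \<epsilon> \<le> (1 + a0) / 2" using \<epsilon> by (simp add: field_simps)
      have "\<beta> ?r \<le> (\<Sum>i\<le>N. \<beta> (grid T N i))" using i \<beta>0 by (intro member_le_sum) auto
      then show "\<beta> ?r + \<epsilon> \<le> b" by (simp add: b_def)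
    qed auto
    finally show "graph_norm A (k' - 1) (app (B t) x) \<le> (1 + a0) / 2 * norm ((app A ^^ k') x) + b * graph_norm A (k' - 1) x"
      by (simp only: k(1) diff_Suc_1)
  qed (use a0 b0 in auto)
  then show ?thesis using that b0 by blast
qed

theorem theoremV4:
  fixes A :: "'a::complex_banach operator"
    and B :: "real \<Rightarrow> 'a operator"
    and T \<omega> :: real
    and m :: nat
  assumes "reflexive_space TYPE('a)"
    and "T > 0" and "m \<ge> 1"
    and "linear_op A" and "\<forall>t\<in>{0..T}. linear_op (B t)"
    and "\<forall>t\<in>{0..T}. \<exists>V. quasicontraction_semigroup \<omega> V \<and> is_generator (perturb A (B t)) V"
    and "closed_op A" and "resolvent_set A \<noteq> {}"
    and "\<forall>t\<in>{0..T}. rel_bounded m A (B t)"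
    and "(SUP t\<in>{0..T}. rel_bound m A (B t)) < 1"
    and "lipschitz_sup m A B T < \<infinity>"
  shows "\<exists>U. evolution_system T (\<lambda>t. perturb A (B t)) U \<and>
    (\<forall>s t. 0 \<le> s \<and> s \<le> t \<and> t \<le> T \<longrightarrow>
      (\<forall>x. (\<lambda>k. stepwise_approx T (\<lambda>t. perturb A (B t)) k t s x) \<longlonglongrightarrow> U t s x) \<and>
      (\<forall>k\<le>m. U t s ` dom_pow A k \<subseteq> dom_pow A k \<and> op_norm A k k (U t s) < \<infinity>))"
proof -
  define L where "L = enn2real (lipschitz_sup m A B T)"
  have dom: "opdom A \<subseteq> opdom (B t)" if "t \<in> {0..T}" for t
    using assms(9) that by (auto simp: rel_bounded_def)
  have lip: "graph_norm A k (app (B t') x - app (B t) x) \<le> L * \<bar>t' - t\<bar> * graph_norm A (Suc k) x"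
    if "t \<in> {0..T}" "t' \<in> {0..T}" "k < m" "x \<in> dom_pow A (Suc k)" for t t' k x
    unfolding L_def by (rule lipschitz_sup_bound[OF assms(11,4,5) dom that])
  \<comment> \<open>A value strictly above the supremum turns each relative bound, which is only an
    infimum, into an actual constant.\<close>
  obtain c where c: "(SUP t\<in>{0..T}. rel_bound m A (B t)) < c" "c < 1" using dense[OF assms(10)] by blast
  define a0 where "a0 = enn2real c"
  have "c < top" by (rule less_trans[OF c(2)]) simp
  then have ca0: "c = ennreal a0" by (simp add: a0_def)
  have a0: "0 \<le> a0" "a0 < 1" using c(2) unfolding ca0 by (auto simp: a0_def)
  have rbc: "\<exists>b. rel_bound_consts m A (B t) a0 b" if "t \<in> {0..T}" for t
  proof -
    have "rel_bound m A (B t) < ennreal a0"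
      using c(1) SUP_upper[OF that, of "\<lambda>t. rel_bound m A (B t)"] unfolding ca0 by (rule le_less_trans[rotated])
    then show ?thesis using rel_bound_less_consts by blast
  qed
  have L0: "0 \<le> L" by (simp add: L_def)
  obtain b where b: "0 \<le> b" "\<And>t. t \<in> {0..T} \<Longrightarrow> rel_bound_consts m A (B t) ((1 + a0) / 2) b"
    using uniform_rel_bound_consts[OF assms(4,2,3) a0 rbc L0 lip] by blast
  define a where "a = (1 + a0) / 2"
  have a1: "a < 1" using a0 by (simp add: a_def)
  \<comment> \<open>The first two summands give \<open>1 \<le> \<mu> - \<omega>\<close>; the last
    one makes the quotient of \<open>\<bar>\<omega>\<bar> + b\<close> by
    \<open>\<mu> - \<omega>\<close> at most \<open>(1 - a) / 2\<close>.\<close>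
  define \<mu> where "\<mu> = \<bar>\<omega>\<bar> + 1 + 2 * (\<bar>\<omega>\<bar> + b) / (1 - a)"
  have pos: "0 \<le> 2 * (\<bar>\<omega>\<bar> + b) / (1 - a)" using b(1) a1 by simp
  have mu: "0 \<le> \<mu>" "1 \<le> \<mu> - \<omega>" "(\<bar>\<omega>\<bar> + b) / (\<mu> - \<omega>) \<le> (1 - a) / 2"
  proof -
    show "0 \<le> \<mu>" "1 \<le> \<mu> - \<omega>" using pos by (auto simp: \<mu>_def)
    have "2 * (\<bar>\<omega>\<bar> + b) / (1 - a) \<le> \<mu> - \<omega>" using pos by (simp add: \<mu>_def)
    then have "2 * (\<bar>\<omega>\<bar> + b) \<le> (\<mu> - \<omega>) * (1 - a)" using a1 by (simp add: pos_divide_le_eq)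
    then show "(\<bar>\<omega>\<bar> + b) / (\<mu> - \<omega>) \<le> (1 - a) / 2"
      using \<open>1 \<le> \<mu> - \<omega>\<close> by (simp add: pos_divide_le_eq field_simps)
  qed
  obtain V where V: "\<And>t. t \<in> {0..T} \<Longrightarrow> quasicontraction_semigroup \<omega> (V t) \<and> is_generator (perturb A (B t)) (V t)"
    using assms(6) by metis
  have z: "0 \<in> {0..T}" using assms(2) by simp
  interpret F: perturbed_family A B a b \<omega> \<mu> T L m V
  proof (rule perturbed_family.intro)
    show "perturbed_generator A (B t) a b \<omega> \<mu> m (V t)" if "t \<in> {0..T}" for t
      using assms that V[OF that] dom[OF that] b(2)[OF that] mu a1 by unfold_locales (auto simp: a_def)
    show "densely_defined A" using assms(9) z by (auto simp: rel_bounded_def)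
  qed (use assms(1,2) L0 lip in auto)
  show ?thesis
  proof (intro exI[of _ F.W] conjI allI impI; (elim conjE)?)
    show "evolution_system T (\<lambda>t. perturb A (B t)) F.W" by (rule F.evolution_system_W)
    fix s t assume st: "0 \<le> s" "s \<le> t" "t \<le> T"
    show "(\<lambda>k. stepwise_approx T (\<lambda>t. perturb A (B t)) k t s x) \<longlonglongrightarrow> F.W t s x" for x
      using F.U_convergent[OF st, of x] by (simp add: F.U_def)
    show "F.W t s ` dom_pow A k \<subseteq> dom_pow A k" if "k \<le> m" for k using F.W_dom(1)[OF st that] by blast
    show "op_norm A k k (F.W t s) < \<infinity>" if "k \<le> m" for k by (rule F.op_norm_W[OF st that])
  qed
qed

end
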